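(* Let $d>1$ and let $X=Y+Z$ be a Lévy process in $\mathbb{R}^d$, where, for some linear subspace $V\subset\mathbb{R}^d$ with $\dim V=1$: $Y$ and $Z$ are independent Lévy processes; $Y$ is either zero or a compound Poisson process whose Lévy measure vanishes on $V$; $Z$ is supported on $V$ and is not a compound Poisson process. Assume that $h^{Z,\lambda}(0)=\lim_{v\in V,\,v\to0}h^{Z,\lambda}(v)=1$ (equivalently, that $0$ is regular for $\{0\}$). Then $\mathcal{K}(X)\subsetneq\mathbb{K}(X)$, $$\mathcal{K}(X)=\Big\{q:\ \lim_{r\to0^+}\sup_{x\in\mathbb{R}^d}\int_{B(0,r)\cap V}|q(x+v)|\,dv=0\Big\},$$ and $$\mathbb{K}(X)=\Big\{q:\ \sup_{x\in\mathbb{R}^d}\int_{B(0,1)\cap V}|q(x+v)|\,dv<\infty\Big\},$$ where $dv$ is the one-dimensional Lebesgue measure on $V$.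
   Context: All functions $q:\mathbb{R}^d\to\mathbb{R}$ are Borel. $\mathbb{P}^x,\mathbb{E}^x$ are the law and expectation of the process started at $x$; $B(x,r)$ is the open Euclidean ball. $T^Z_{\{v\}}=\inf\{t>0:Z_t=v\}$ ($\inf\emptyset=\infty$), $h^{Z,\lambda}(v)=\mathbb{E}^0e^{-\lambda T^Z_{\{v\}}}$ for $\lambda>0$. The point $0$ is regular for $\{0\}$ for a process if, started at $0$, its hitting time $\inf\{t>0:\cdot_t=0\}$ is $0$ almost surely; for $X=Y+Z$ with $Y$ and $Z$ independent Lévy processes, $Y$ either zero or a compound Poisson process whose Lévy measure vanishes on a one-dimensional linear subspace $V\subset\mathbb{R}^d$, $d>1$, and $Z$ supported on $V$ and not a compound Poisson process, this holds for $X$ if and only if it holds for $Z$. A Lévy process is called compound Poisson if its Gaussian part is zero, its Lévy measure $\nu$ is finite, and its drift is zero (exponent $\psi(x)=-\int(e^{i\langle x,z\rangle}-1)\nu(dz)$ with $\nu$ finite). $\mathbb{K}(X)$ is the set of $q$ with $\lim_{t\to0^+}\sup_x\mathbb{E}^x\int_0^t|q(X_u)|du=0$. $\mathcal{K}(X)$ is the set of $q$ such that for some (equivalently every) $\lambda>0$, $\lim_{r\to0^+}\sup_x\mathbb{E}^x\int_0^\infty e^{-\lambda u}\mathbf 1_{B(x,r)}(X_u)|q(X_u)|du=0$. *)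

theory Defs
  imports "HOL-Probability.Probability"
begin

text \<open>
  Processes are families indexed by \<open>real\<close>, of which only the times \<open>t \<ge> 0\<close> matter.
  A Levy process starts at the origin; under the law \<open>P\<^sup>x\<close> it is the process \<open>x + X\<close>, so
  expectations under \<open>P\<^sup>x\<close> are written as expectations of functionals of \<open>x + X\<close> under \<open>M\<close>.
\<close>

definition cadlag :: "(real \<Rightarrow> 'a::topological_space) \<Rightarrow> bool" where
  "cadlag f \<longleftrightarrow>
     (\<forall>t\<ge>0. (f \<longlongrightarrow> f t) (at_right t)) \<and> (\<forall>t>0. \<exists>l. (f \<longlongrightarrow> l) (at_left t))"

definition levy_process :: "'w measure \<Rightarrow> (real \<Rightarrow> 'w \<Rightarrow> 'a::euclidean_space) \<Rightarrow> bool" where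
  "levy_process M X \<longleftrightarrow>
     prob_space M \<and>
     (\<forall>t\<ge>0. X t \<in> borel_measurable M) \<and>
     (AE \<omega> in M. X 0 \<omega> = 0) \<and>
     (\<forall>(n::nat) (t :: nat \<Rightarrow> real). 0 \<le> t 0 \<and> (\<forall>i<n. t i \<le> t (Suc i)) \<longrightarrow>
        prob_space.indep_vars M (\<lambda>_. borel) (\<lambda>i \<omega>. X (t (Suc i)) \<omega> - X (t i) \<omega>) {..<n}) \<and>
     (\<forall>s\<ge>0. \<forall>t\<ge>0. distr M borel (\<lambda>\<omega>. X (s + t) \<omega> - X s \<omega>) = distr M borel (X t)) \<and>
     (AE \<omega> in M. cadlag (\<lambda>t. X t \<omega>))"

definition indep_processes ::
    "'w measure \<Rightarrow> (real \<Rightarrow> 'w \<Rightarrow> 'a::euclidean_space) \<Rightarrow> (real \<Rightarrow> 'w \<Rightarrow> 'a) \<Rightarrow> bool" where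
  "indep_processes M Y Z \<longleftrightarrow>
     prob_space.indep_var M
       (Pi\<^sub>M {0..} (\<lambda>_. borel)) (\<lambda>\<omega>. \<lambda>t\<in>{0..}. Y t \<omega>)
       (Pi\<^sub>M {0..} (\<lambda>_. borel)) (\<lambda>\<omega>. \<lambda>t\<in>{0..}. Z t \<omega>)"

definition zero_process :: "'w measure \<Rightarrow> (real \<Rightarrow> 'w \<Rightarrow> 'a::euclidean_space) \<Rightarrow> bool" where
  "zero_process M Y \<longleftrightarrow> (\<forall>t\<ge>0. AE \<omega> in M. Y t \<omega> = 0)"

definition has_levy_exponent ::
    "'w measure \<Rightarrow> (real \<Rightarrow> 'w \<Rightarrow> 'a::euclidean_space) \<Rightarrow> ('a \<Rightarrow> complex) \<Rightarrow> bool" where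
  "has_levy_exponent M X \<psi> \<longleftrightarrow>
     (\<forall>t\<ge>0. \<forall>x. (LINT \<omega>|M. cis (x \<bullet> X t \<omega>)) = exp (- (of_real t * \<psi> x)))"

text \<open>
  The finite Levy measure \<open>\<nu>\<close> of a compound Poisson process is uniquely determined, thanks to
  the normalisation \<open>\<nu> {0} = 0\<close>.  The value \<open>\<nu> = 0\<close> is allowed (as the definition through
  the exponent does), so that the zero process counts as compound Poisson.
\<close>

definition compound_poisson_with ::
    "'w measure \<Rightarrow> (real \<Rightarrow> 'w \<Rightarrow> 'a::euclidean_space) \<Rightarrow> 'a measure \<Rightarrow> bool" where
  "compound_poisson_with M Y \<nu> \<longleftrightarrow>
     levy_process M Y \<and> sets \<nu> = sets borel \<and> finite_measure \<nu> \<and> emeasure \<nu> {0} = 0 \<and>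
     has_levy_exponent M Y (\<lambda>x. - (LINT z|\<nu>. cis (x \<bullet> z) - 1))"

definition compound_poisson :: "'w measure \<Rightarrow> (real \<Rightarrow> 'w \<Rightarrow> 'a::euclidean_space) \<Rightarrow> bool" where
  "compound_poisson M Y \<longleftrightarrow> (\<exists>\<nu>. compound_poisson_with M Y \<nu>)"

definition supported_on ::
    "'w measure \<Rightarrow> (real \<Rightarrow> 'w \<Rightarrow> 'a::euclidean_space) \<Rightarrow> 'a set \<Rightarrow> bool" where
  "supported_on M Z V \<longleftrightarrow> (\<forall>t\<ge>0. AE \<omega> in M. Z t \<omega> \<in> V)"

definition hitting_time :: "(real \<Rightarrow> 'w \<Rightarrow> 'a) \<Rightarrow> 'a \<Rightarrow> 'w \<Rightarrow> ereal" where
  "hitting_time Z v \<omega> = Inf (ereal ` {t. 0 < t \<and> Z t \<omega> = v})"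

text \<open>
  Hitting times of cadlag processes need only be measurable with respect to the completed
  sigma-algebra, whence the completion.
\<close>

definition hit_laplace ::
    "'w measure \<Rightarrow> (real \<Rightarrow> 'w \<Rightarrow> 'a::euclidean_space) \<Rightarrow> real \<Rightarrow> 'a \<Rightarrow> real" where
  "hit_laplace M Z lam v =
     (LINT \<omega>|completion M.
        (if hitting_time Z v \<omega> = \<infinity> then 0
         else exp (- lam * real_of_ereal (hitting_time Z v \<omega>))))"

definition kato_time ::
    "'w measure \<Rightarrow> (real \<Rightarrow> 'w \<Rightarrow> 'a::euclidean_space) \<Rightarrow> ('a \<Rightarrow> real) set" where
  "kato_time M X =
     {q \<in> borel_measurable borel.
        ((\<lambda>t. SUP x. \<integral>\<^sup>+\<omega>. (\<integral>\<^sup>+u\<in>{0..t}. ennreal \<bar>q (x + X u \<omega>)\<bar> \<partial>lborel) \<partial>M)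
           \<longlongrightarrow> 0) (at_right 0)}"

definition kato_space ::
    "'w measure \<Rightarrow> (real \<Rightarrow> 'w \<Rightarrow> 'a::euclidean_space) \<Rightarrow> ('a \<Rightarrow> real) set" where
  "kato_space M X =
     {q \<in> borel_measurable borel. \<exists>lam>0.
        ((\<lambda>r. SUP x. \<integral>\<^sup>+\<omega>. (\<integral>\<^sup>+u\<in>{0..}.
             ennreal (exp (- lam * u)) * indicator (ball x r) (x + X u \<omega>) *
             ennreal \<bar>q (x + X u \<omega>)\<bar> \<partial>lborel) \<partial>M)
           \<longlongrightarrow> 0) (at_right 0)}"

text \<open>
  One-dimensional Lebesgue measure on a line \<open>V\<close> through the origin, as the image of Lebesgue
  measure under \<open>s \<mapsto> s *\<^sub>R e\<close> for a unit vector \<open>e\<close> of \<open>V\<close>.  The two possible choices of \<open>e\<close>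
  give the same measure, see \<open>line_lebesgue_eq\<close> below.
\<close>

definition line_lebesgue :: "'a::euclidean_space set \<Rightarrow> 'a measure" where
  "line_lebesgue V = distr lborel borel (\<lambda>s::real. s *\<^sub>R (SOME e. e \<in> V \<and> norm e = 1))"

lemma line_lebesgue_eq:
  fixes V :: "'a::euclidean_space set" and e :: 'a
  assumes "subspace V" "dim V = 1" "e \<in> V" "norm e = 1"
  shows "line_lebesgue V = distr lborel borel (\<lambda>s::real. s *\<^sub>R e)"
proof -
  define f where "f = (SOME e. e \<in> V \<and> norm e = 1)"
  have f: "f \<in> V" "norm f = 1"
    using someI[of "\<lambda>e. e \<in> V \<and> norm e = 1" e] assms unfolding f_def by auto
  have "e \<noteq> 0" using assms by auto
  then have "independent {e}" by simp
  moreover have "dim V = card {e}" using assms by simp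
  ultimately have "V \<subseteq> span {e}"
    using assms card_ge_dim_independent[of "{e}" V] by simp
  then obtain k where k: "f = k *\<^sub>R e"
    using f by (auto simp: span_singleton)
  then have "\<bar>k\<bar> = 1" using f assms by simp
  then consider "f = e" | "f = - e" using k by (auto simp: abs_if split: if_splits)
  then show ?thesis
  proof cases
    case 1
    then show ?thesis by (simp add: line_lebesgue_def f_def)
  next
    case 2
    have "distr lborel borel (\<lambda>s::real. s *\<^sub>R f) = distr (distr lborel borel uminus) borel (\<lambda>s::real. s *\<^sub>R e)"
      by (subst distr_distr) (auto simp: 2 comp_def)
    also have "distr lborel borel (uminus :: real \<Rightarrow> real) = lborel"
      using lborel_distr_uminus by simp
    finally show ?thesis by (simp add: line_lebesgue_def f_def)
  qed
qed

end

theory Submission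
  imports Defs
begin

text \<open>
  Write \<open>U\<close> for the \<open>\<lambda>\<close>-potential measure of \<open>Z\<close>.  Waiting until the time \<open>T\<close> when \<open>Z\<close> hits \<open>v\<close> and
  restarting there gives \<open>U (v + A) \<ge> h v * U A\<close>, where \<open>h v\<close> is the expectation of \<open>exp (- \<lambda> * T)\<close>.  As \<open>h v\<close> tends to 1, \<open>U\<close> hardly changes under small shifts along
  \<open>V\<close>, and averaging over these shifts shows that near 0 the measure \<open>U\<close> is comparable with Lebesgue
  measure on \<open>V\<close>.  Strong Markov arguments and the measurability of hitting times are avoided by waiting, along
  a fine grid of times, for the first visit to a small ball around \<open>v\<close>: in the limit this happens no
  later than \<open>T\<close>, which is all that is needed.  By the Markov property at time \<open>t\<close>, the occupation before
  \<open>t\<close> is \<open>U\<close> minus an average of shifts of \<open>U\<close> by \<open>Z t\<close>, hence a small fraction of \<open>U\<close> for small \<open>t\<close>.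
  Finally \<open>Y\<close> stays at 0 up to time \<open>u\<close> with probability at least \<open>exp (- c * u)\<close>, which transfers
  the estimates from \<open>Z\<close> to \<open>X\<close>.  The inclusion is strict because in dimension \<open>d > 1\<close> a function
  may concentrate unit mass on ever shorter segments parallel to \<open>V\<close>.
\<close>

subsection \<open>Transition functions and occupation measures\<close>

text \<open>The two classes differ in where smallness may come from. Restricting to a ball of radius
  \<open>r\<close> changes potentials only through integrals over segments of length comparable to
  \<open>r\<close>, up to fixed constants, so these integrals must themselves tend to 0. Observing
  up to a small time multiplies a bound over unit segments by an arbitrarily small factor, so
  finiteness suffices; this needs shifts that cost a factor \<kappa> close to 1, not merely a
  bounded one.

  Passing from \<open>Z\<close> to \<open>X\<close> meets two obstacles. Keeping \<open>Y\<close> at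
  0 costs exp (- c * u), which raises the discount rate from \<mu> to \<mu> + c, while the limit of
  \<open>hit_laplace\<close> is given at a single rate: Bernoulli's inequality carries it to all
  rates. For upper bounds, the position of \<open>Y\<close> varies with the time at which
  \<open>Z\<close> is observed, so \<open>X\<close> does not simply see the potential of
  \<open>Z\<close> from one random point; on [0, 1] the laws of \<open>Y\<close> are therefore
  dominated by its law at time 1, and longer times are cut into blocks.\<close>

lemma levy_processD:
  assumes "levy_process M X"
  shows "prob_space M" "\<And>t. t \<ge> 0 \<Longrightarrow> X t \<in> borel_measurable M" "AE \<omega> in M. X 0 \<omega> = 0"
    "\<And>s t. s \<ge> 0 \<Longrightarrow> t \<ge> 0 \<Longrightarrow>
       distr M borel (\<lambda>\<omega>. X (s + t) \<omega> - X s \<omega>) = distr M borel (X t)"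
    "AE \<omega> in M. cadlag (\<lambda>t. X t \<omega>)"
    "\<And>(n::nat) (t :: nat \<Rightarrow> real). 0 \<le> t 0 \<Longrightarrow> (\<And>i. i < n \<Longrightarrow> t i \<le> t (Suc i)) \<Longrightarrow>
        prob_space.indep_vars M (\<lambda>_. borel) (\<lambda>i \<omega>. X (t (Suc i)) \<omega> - X (t i) \<omega>) {..<n}"
  using assms unfolding levy_process_def by auto

lemma cadlag_sequentially:
  assumes "cadlag f" "t \<ge> 0" "\<And>n. s n > t" "s \<longlonglongrightarrow> t"
  shows "(\<lambda>n. f (s n)) \<longlonglongrightarrow> f t"
proof -
  have "(f \<longlongrightarrow> f t) (at_right t)" using assms unfolding cadlag_def by auto
  moreover have "filterlim s (at_right t) sequentially"
    using assms by (auto simp: filterlim_at eventually_sequentially less_imp_neq[symmetric])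
  ultimately show ?thesis by (rule filterlim_compose)
qed

text \<open>Fubini needs joint measurability in time and path, which is not part of
  \<open>levy_process\<close>. It comes from right continuity: off a null set containing the bad
  paths, the process is a limit of step processes read along a grid from the right. On the null set
  the path is set to 0; negative times, where nothing is known, are folded to 0.\<close>

lemma levy_modification:
  fixes X :: "real \<Rightarrow> 'w \<Rightarrow> 'a::euclidean_space"
  assumes "levy_process M X"
  obtains X' where "case_prod X' \<in> borel_measurable (borel \<Otimes>\<^sub>M M)"
    and "AE \<omega> in M. \<forall>t. X' t \<omega> = X (max t 0) \<omega>"
proof -
  note L = levy_processD[OF assms]
  obtain N where N: "{\<omega>\<in>space M. \<not> cadlag (\<lambda>t. X t \<omega>)} \<subseteq> N" "N \<in> null_sets M"
    using L(5) by (auto elim: AE_E simp: null_sets_def)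
  define X' where "X' t \<omega> = (if \<omega> \<in> N then 0 else X (max t 0) \<omega>)" for t \<omega>
  \<comment> \<open>Adding 1 to the floor gives a grid point strictly to the right of
    \<open>max t 0\<close>, so right continuity alone gives convergence; for fixed \<open>n\<close>
    only countably many values occur.\<close>
  define a where "a n t = (of_int \<lfloor>max t 0 * real (Suc n)\<rfloor> + 1) / real (Suc n)" for n :: nat and t :: real
  have a_gt: "a n t > max t 0" for n t
  proof -
    have "max t 0 * real (Suc n) < of_int \<lfloor>max t 0 * real (Suc n)\<rfloor> + 1" by linarith
    then show ?thesis unfolding a_def by (subst pos_less_divide_eq) auto
  qed
  have a_le: "a n t \<le> max t 0 + 1 / Suc n" for n t
  proof -
    have "of_int \<lfloor>max t 0 * real (Suc n)\<rfloor> \<le> max t 0 * real (Suc n)" by linarith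
    then show ?thesis unfolding a_def by (simp only: add_divide_distrib) (simp add: pos_divide_le_eq)
  qed
  have a_lim: "(\<lambda>n. a n t) \<longlonglongrightarrow> max t 0" for t
  proof (rule tendsto_sandwich[where f="\<lambda>_. max t 0"])
    show "(\<lambda>n. max t 0 + 1 / Suc n) \<longlonglongrightarrow> max t 0"
      using tendsto_add[OF tendsto_const LIMSEQ_inverse_real_of_nat, of "max t 0"]
      by (simp add: inverse_eq_divide)
  qed (use less_imp_le[OF a_gt] a_le in \<open>auto simp del: of_nat_Suc\<close>)
  have meas: "X' t \<in> borel_measurable M" for t
    unfolding X'_def using N(2) L(2)[of "max t 0"] by (intro measurable_If_set) auto
  have "case_prod X' \<in> borel_measurable (borel \<Otimes>\<^sub>M M)"
  proof (rule borel_measurable_LIMSEQ_metric)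
    fix p :: "real \<times> 'w" assume "p \<in> space (borel \<Otimes>\<^sub>M M)"
    then have sp: "snd p \<in> space M" by (auto simp: space_pair_measure)
    show "(\<lambda>n. X' (a n (fst p)) (snd p)) \<longlonglongrightarrow> case_prod X' p"
    proof (cases "snd p \<in> N")
      case True
      then show ?thesis by (simp add: X'_def split_beta)
    next
      case False
      then have c: "cadlag (\<lambda>t. X t (snd p))" using N sp by auto
      have "a n (fst p) \<ge> 0" for n using a_gt[of "fst p" n] by linarith
      then show ?thesis
        using cadlag_sequentially[OF c _ a_gt a_lim] False
        by (simp add: X'_def split_beta)
    qed
  next
    fix n
    have "(\<lambda>p. X' ((of_int \<lfloor>max (fst p) 0 * real (Suc n)\<rfloor> + 1) / real (Suc n)) (snd p))
            \<in> borel_measurable (borel \<Otimes>\<^sub>M M)"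
      by (rule measurable_compose_countable[where
            g="\<lambda>p. \<lfloor>max (fst p) 0 * real (Suc n)\<rfloor>" and f="\<lambda>k p. X' ((of_int k + 1) / real (Suc n)) (snd p)"])
        (auto intro!: measurable_compose[OF measurable_snd meas])
    then show "(\<lambda>p. X' (a n (fst p)) (snd p)) \<in> borel_measurable (borel \<Otimes>\<^sub>M M)"
      by (simp add: a_def)
  qed
  moreover have "AE \<omega> in M. \<forall>t. X' t \<omega> = X (max t 0) \<omega>"
    using AE_not_in[OF N(2)] by eventually_elim (auto simp: X'_def)
  ultimately show ?thesis using that by blast
qed

definition transition ::
    "'w measure \<Rightarrow> (real \<Rightarrow> 'w \<Rightarrow> 'a::euclidean_space) \<Rightarrow> real \<Rightarrow> ('a \<Rightarrow> ennreal) \<Rightarrow> 'a \<Rightarrow> ennreal" where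
  "transition M X u F x = (\<integral>\<^sup>+\<omega>. F (x + X u \<omega>) \<partial>M)"

text \<open>The weight serves both classes: \<open>discount lam\<close> makes this the potential,
  \<open>indicator {..t}\<close> the occupation up to time \<open>t\<close>.\<close>

definition occupation ::
    "'w measure \<Rightarrow> (real \<Rightarrow> 'w \<Rightarrow> 'a::euclidean_space) \<Rightarrow> (real \<Rightarrow> ennreal) \<Rightarrow> ('a \<Rightarrow> ennreal) \<Rightarrow> 'a \<Rightarrow> ennreal" where
  "occupation M X w F x = (\<integral>\<^sup>+u\<in>{0..}. w u * transition M X u F x \<partial>lborel)"

text \<open>The cut-off \<open>max u 0\<close> gives measurability on the whole time axis although
  negative times are unconstrained.\<close>

lemma transition_measurable:
  fixes X :: "real \<Rightarrow> 'w \<Rightarrow> 'a::euclidean_space"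
  assumes "levy_process M X" and [measurable]: "F \<in> borel_measurable borel"
  shows "(\<lambda>(u, x). transition M X (max u 0) F x) \<in> borel_measurable (borel \<Otimes>\<^sub>M borel)"
proof -
  interpret prob_space M by (rule levy_processD[OF assms(1)])
  obtain X' where X'[measurable]: "case_prod X' \<in> borel_measurable (borel \<Otimes>\<^sub>M M)"
    and ae: "AE \<omega> in M. \<forall>t. X' t \<omega> = X (max t 0) \<omega>"
    using levy_modification[OF assms(1)] by blast
  have "transition M X (max u 0) F x = (\<integral>\<^sup>+\<omega>. F (x + X' u \<omega>) \<partial>M)" for u x
    unfolding transition_def using ae by (intro nn_integral_cong_AE) auto
  then show ?thesis by simp
qed

lemma transition_measurable':
  fixes X :: "real \<Rightarrow> 'w \<Rightarrow> 'a::euclidean_space"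
  assumes "levy_process M X" "F \<in> borel_measurable borel" "u \<ge> 0"
  shows "transition M X u F \<in> borel_measurable borel"
  using measurable_compose[OF measurable_Pair1' transition_measurable[OF assms(1,2)], of u] assms(3)
  by simp

lemma occupation_max:
  "occupation M X w F x = (\<integral>\<^sup>+u\<in>{0..}. w u * transition M X (max u 0) F x \<partial>lborel)"
  unfolding occupation_def by (intro nn_integral_cong) (auto simp: indicator_def)

lemma occupation_measurable:
  fixes X :: "real \<Rightarrow> 'w \<Rightarrow> 'a::euclidean_space"
  assumes "levy_process M X" and [measurable]: "F \<in> borel_measurable borel" "w \<in> borel_measurable borel"
  shows "occupation M X w F \<in> borel_measurable borel"
proof -
  note [measurable] = transition_measurable[OF assms(1,2)]
  have "(\<lambda>x. \<integral>\<^sup>+u\<in>{0..}. w u * transition M X (max u 0) F x \<partial>lborel) \<in> borel_measurable borel"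
    by measurable
  then show ?thesis by (simp add: occupation_max[abs_def])
qed

text \<open>Links the path integrals in the definitions of the Kato classes with transition
  functions. The paths are replaced by the measurable modification before Fubini is applied.\<close>

lemma occupation_pathwise:
  fixes X :: "real \<Rightarrow> 'w \<Rightarrow> 'a::euclidean_space"
  assumes "levy_process M X" and [measurable]: "F \<in> borel_measurable borel" "w \<in> borel_measurable borel"
  shows "(\<integral>\<^sup>+\<omega>. (\<integral>\<^sup>+u\<in>{0..}. w u * F (x + X u \<omega>) \<partial>lborel) \<partial>M) = occupation M X w F x"
proof -
  interpret prob_space M by (rule levy_processD[OF assms(1)])
  interpret pair_sigma_finite lborel M ..
  obtain X' where X'[measurable]: "case_prod X' \<in> borel_measurable (borel \<Otimes>\<^sub>M M)"
    and ae: "AE \<omega> in M. \<forall>t. X' t \<omega> = X (max t 0) \<omega>"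
    using levy_modification[OF assms(1)] by blast
  have [measurable]: "case_prod X' \<in> borel_measurable (lborel \<Otimes>\<^sub>M M)"
    using X' by (simp cong: measurable_cong_sets sets_pair_measure_cong)
  have "(\<integral>\<^sup>+\<omega>. (\<integral>\<^sup>+u\<in>{0..}. w u * F (x + X u \<omega>) \<partial>lborel) \<partial>M)
      = (\<integral>\<^sup>+\<omega>. (\<integral>\<^sup>+u. w u * F (x + X' u \<omega>) * indicator {0..} u \<partial>lborel) \<partial>M)"
    using ae
    by (intro nn_integral_cong_AE) (auto elim!: eventually_mono intro!: nn_integral_cong simp: indicator_def)
  also have "\<dots> = (\<integral>\<^sup>+u. (\<integral>\<^sup>+\<omega>. w u * F (x + X' u \<omega>) * indicator {0..} u \<partial>M) \<partial>lborel)"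
    by (intro Fubini') measurable
  also have "\<dots> = (\<integral>\<^sup>+u. w u * (\<integral>\<^sup>+\<omega>. F (x + X' u \<omega>) \<partial>M) * indicator {0..} u \<partial>lborel)"
    by (simp add: nn_integral_multc nn_integral_cmult)
  also have "\<dots> = (\<integral>\<^sup>+u. w u * transition M X (max u 0) F x * indicator {0..} u \<partial>lborel)"
    unfolding transition_def using ae
    by (intro nn_integral_cong arg_cong2[where f="(*)"] refl nn_integral_cong_AE) auto
  finally show ?thesis by (simp add: occupation_max)
qed

text \<open>The measure is the image of \<open>w u\<close> du times \<open>M\<close> under the
  measurable modification. Having one measure whose translates serve all starting points gives
  access to regularity and to Fubini over shifts.\<close>

lemma occupation_measure:
  fixes X :: "real \<Rightarrow> 'w \<Rightarrow> 'a::euclidean_space"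
  assumes "levy_process M X" and [measurable]: "w \<in> borel_measurable borel"
  obtains U :: "'a measure" where "sets U = sets borel"
    and "\<And>F x. F \<in> borel_measurable borel \<Longrightarrow> (\<integral>\<^sup>+y. F (x + y) \<partial>U) = occupation M X w F x"
proof -
  interpret prob_space M by (rule levy_processD[OF assms(1)])
  obtain X' where X'[measurable]: "case_prod X' \<in> borel_measurable (borel \<Otimes>\<^sub>M M)"
    and ae: "AE \<omega> in M. \<forall>t. X' t \<omega> = X (max t 0) \<omega>"
    using levy_modification[OF assms(1)] by blast
  have [measurable]: "case_prod X' \<in> borel_measurable (lborel \<Otimes>\<^sub>M M)"
    using X' by (simp cong: measurable_cong_sets sets_pair_measure_cong)
  define U where "U = distr (density (lborel \<Otimes>\<^sub>M M) (\<lambda>(u, \<omega>). w u * indicator {0..} u)) borel (case_prod X')"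
  have "(\<integral>\<^sup>+y. F (x + y) \<partial>U) = occupation M X w F x"
    if [measurable]: "F \<in> borel_measurable borel" for F x
  proof -
    have "(\<integral>\<^sup>+y. F (x + y) \<partial>U) = (\<integral>\<^sup>+p. w (fst p) * indicator {0..} (fst p) * F (x + case_prod X' p) \<partial>(lborel \<Otimes>\<^sub>M M))"
      unfolding U_def by (subst nn_integral_distr) (auto simp: nn_integral_density split_beta)
    also have "\<dots> = (\<integral>\<^sup>+u. (\<integral>\<^sup>+\<omega>. w u * indicator {0..} u * F (x + X' u \<omega>) \<partial>M) \<partial>lborel)"
      by (subst nn_integral_fst[symmetric]) (auto simp: split_beta)
    also have "\<dots> = (\<integral>\<^sup>+u. w u * indicator {0..} u * (\<integral>\<^sup>+\<omega>. F (x + X' u \<omega>) \<partial>M) \<partial>lborel)"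
      by (simp add: nn_integral_cmult)
    also have "\<dots> = (\<integral>\<^sup>+u. w u * indicator {0..} u * transition M X (max u 0) F x \<partial>lborel)"
      unfolding transition_def using ae
      by (intro nn_integral_cong arg_cong2[where f="(*)"] refl nn_integral_cong_AE) auto
    finally show ?thesis by (simp add: occupation_max mult_ac)
  qed
  then show ?thesis by (intro that[of U]) (auto simp: U_def)
qed

lemma (in prob_space) nn_integral_indep_sum:
  fixes A B :: "'a \<Rightarrow> 'b::euclidean_space"
  assumes "indep_var borel A borel B" and [measurable]: "F \<in> borel_measurable borel"
  shows "(\<integral>\<^sup>+\<omega>. F (A \<omega> + B \<omega>) \<partial>M) = (\<integral>\<^sup>+\<omega>. (\<integral>\<^sup>+\<omega>'. F (A \<omega> + B \<omega>') \<partial>M) \<partial>M)"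
proof -
  have [measurable]: "A \<in> borel_measurable M" "B \<in> borel_measurable M"
    using assms(1) by (auto simp: indep_var_distribution_eq)
  have eq: "distr M borel A \<Otimes>\<^sub>M distr M borel B = distr M (borel \<Otimes>\<^sub>M borel) (\<lambda>\<omega>. (A \<omega>, B \<omega>))"
    using assms(1) by (auto simp: indep_var_distribution_eq)
  interpret B: prob_space "distr M borel B" by (rule prob_space_distr) simp
  have "(\<integral>\<^sup>+\<omega>. F (A \<omega> + B \<omega>) \<partial>M) = (\<integral>\<^sup>+p. F (fst p + snd p) \<partial>(distr M borel A \<Otimes>\<^sub>M distr M borel B))"
    unfolding eq by (subst nn_integral_distr) auto
  also have "\<dots> = (\<integral>\<^sup>+a. (\<integral>\<^sup>+b. F (a + b) \<partial>distr M borel B) \<partial>distr M borel A)"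
    by (subst B.nn_integral_fst[symmetric]) auto
  also have "\<dots> = (\<integral>\<^sup>+\<omega>. (\<integral>\<^sup>+\<omega>'. F (A \<omega> + B \<omega>') \<partial>M) \<partial>M)"
    by (subst nn_integral_distr, simp, measurable, subst nn_integral_distr) auto
  finally show ?thesis .
qed

text \<open>The first \<open>k\<close> increments enter as one vector, because the event of a first
  grid visit depends on all of them jointly.\<close>

lemma levy_indep_increments:
  fixes X :: "real \<Rightarrow> 'w \<Rightarrow> 'a::euclidean_space"
  assumes "levy_process M X" "0 \<le> t 0" "\<And>i. i \<le> k \<Longrightarrow> t i \<le> t (Suc i)"
  shows "prob_space.indep_var M
    (Pi\<^sub>M {..<k} (\<lambda>_. borel)) (\<lambda>\<omega>. \<lambda>i\<in>{..<k}. X (t (Suc i)) \<omega> - X (t i) \<omega>)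
    (Pi\<^sub>M {k} (\<lambda>_. borel)) (\<lambda>\<omega>. \<lambda>i\<in>{k}. X (t (Suc i)) \<omega> - X (t i) \<omega>)"
proof -
  interpret prob_space M by (rule levy_processD[OF assms(1)])
  have "indep_vars (\<lambda>_. borel) (\<lambda>i \<omega>. X (t (Suc i)) \<omega> - X (t i) \<omega>) {..<Suc k}"
    using assms(2,3) by (intro levy_processD(6)[OF assms(1)]) auto
  from indep_var_restrict[OF this, of "{..<k}" "{k}"] show ?thesis by auto
qed

lemma levy_indep_increment:
  fixes X :: "real \<Rightarrow> 'w \<Rightarrow> 'a::euclidean_space"
  assumes "levy_process M X" "s \<ge> 0" "t \<ge> 0"
  shows "prob_space.indep_var M borel (\<lambda>\<omega>. X s \<omega> - X 0 \<omega>) borel (\<lambda>\<omega>. X (s + t) \<omega> - X s \<omega>)"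
proof -
  interpret prob_space M by (rule levy_processD[OF assms(1)])
  define r where "r i = (if i = 0 then 0 else if i = 1 then s else s + t)" for i :: nat
  have "indep_var (Pi\<^sub>M {..<1} (\<lambda>_. borel)) (\<lambda>\<omega>. \<lambda>i\<in>{..<1::nat}. X (r (Suc i)) \<omega> - X (r i) \<omega>)
    (Pi\<^sub>M {1} (\<lambda>_. borel)) (\<lambda>\<omega>. \<lambda>i\<in>{1}. X (r (Suc i)) \<omega> - X (r i) \<omega>)"
    by (rule levy_indep_increments[OF assms(1)]) (use assms in \<open>auto simp: r_def\<close>)
  from indep_var_compose[OF this, of "\<lambda>f. f 0" borel "\<lambda>f. f 1" borel] show ?thesis
    by (simp add: r_def comp_def)
qed

lemma transition_add:
  fixes X :: "real \<Rightarrow> 'w \<Rightarrow> 'a::euclidean_space"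
  assumes "levy_process M X" and F[measurable]: "F \<in> borel_measurable borel" and "s \<ge> 0" "t \<ge> 0"
  shows "transition M X (s + t) F x = (\<integral>\<^sup>+\<omega>. transition M X t F (x + X s \<omega>) \<partial>M)"
proof -
  note L = levy_processD[OF assms(1)]
  interpret prob_space M by (rule L)
  have [measurable]: "X s \<in> borel_measurable M" "X t \<in> borel_measurable M"
    "X (s + t) \<in> borel_measurable M" "X 0 \<in> borel_measurable M"
    using L(2) assms(3,4) by auto
  \<comment> \<open>Independence concerns increments, so \<open>X s\<close> is first replaced by
    \<open>X s - X 0\<close>, which agrees with it almost surely.\<close>
  have "transition M X (s + t) F x =
      (\<integral>\<^sup>+\<omega>. F (x + ((X s \<omega> - X 0 \<omega>) + (X (s + t) \<omega> - X s \<omega>))) \<partial>M)"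
    unfolding transition_def using L(3) by (intro nn_integral_cong_AE) auto
  also have "\<dots> = (\<integral>\<^sup>+\<omega>. (\<integral>\<^sup>+\<omega>'. F (x + ((X s \<omega> - X 0 \<omega>) + (X (s + t) \<omega>' - X s \<omega>'))) \<partial>M) \<partial>M)"
    by (intro nn_integral_indep_sum levy_indep_increment assms) simp
  also have "\<dots> = (\<integral>\<^sup>+\<omega>. (\<integral>\<^sup>+\<omega>'. F (x + X s \<omega> + (X (s + t) \<omega>' - X s \<omega>')) \<partial>M) \<partial>M)"
    using L(3) by (intro nn_integral_cong_AE) (auto simp: add_ac)
  also have "\<dots> = (\<integral>\<^sup>+\<omega>. (\<integral>\<^sup>+y. F (x + X s \<omega> + y) \<partial>distr M borel (\<lambda>\<omega>'. X (s + t) \<omega>' - X s \<omega>')) \<partial>M)"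
    by (intro nn_integral_cong, subst nn_integral_distr) auto
  also have "\<dots> = (\<integral>\<^sup>+\<omega>. transition M X t F (x + X s \<omega>) \<partial>M)"
    unfolding L(4)[OF assms(3,4)] transition_def
    by (intro nn_integral_cong, subst nn_integral_distr) auto
  finally show ?thesis .
qed

subsection \<open>First visits along a grid of times\<close>

lemma transition_indicator:
  assumes "levy_process M X" "u \<ge> 0" "A \<in> sets borel"
  shows "transition M X u (indicator A) x = emeasure M {\<omega>\<in>space M. x + X u \<omega> \<in> A}"
proof -
  have [measurable]: "X u \<in> borel_measurable M" "A \<in> sets borel"
    using levy_processD(2)[OF assms(1)] assms by auto
  have "transition M X u (indicator A) x
      = (\<integral>\<^sup>+\<omega>. indicator {\<omega>\<in>space M. x + X u \<omega> \<in> A} \<omega> \<partial>M)"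
    unfolding transition_def by (intro nn_integral_cong) (auto simp: indicator_def)
  also have "\<dots> = emeasure M {\<omega>\<in>space M. x + X u \<omega> \<in> A}"
    by (rule nn_integral_indicator) measurable
  finally show ?thesis .
qed

lemma nn_integral_shift_atLeast:
  fixes f :: "real \<Rightarrow> ennreal"
  assumes [measurable]: "f \<in> borel_measurable borel"
  shows "(\<integral>\<^sup>+u\<in>{s..}. f u \<partial>lborel) = (\<integral>\<^sup>+u\<in>{0..}. f (s + u) \<partial>lborel)"
  by (subst nn_integral_real_affine[where c=1 and t=s])
     (auto intro!: nn_integral_cong simp: indicator_def)

text \<open>Up to a null set the grid values are partial sums of the first \<open>k\<close>
  increments, hence independent of the next increment, whose length \<open>w\<close> need not fit
  the grid.\<close>

lemma levy_grid_markov: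
  fixes X :: "real \<Rightarrow> 'w \<Rightarrow> 'a::euclidean_space"
  assumes "levy_process M X" and d: "d \<ge> 0" and w: "w \<ge> 0"
    and D[measurable]: "\<And>j. D j \<in> sets borel" and B[measurable]: "B \<in> sets borel"
  shows "emeasure M {\<omega>\<in>space M. (\<forall>j\<le>k. X (real j * d) \<omega> \<in> D j) \<and> X (real k * d + w) \<omega> - X (real k * d) \<omega> \<in> B}
       = emeasure M {\<omega>\<in>space M. \<forall>j\<le>k. X (real j * d) \<omega> \<in> D j} * emeasure M {\<omega>\<in>space M. X w \<omega> \<in> B}"
proof -
  note L = levy_processD[OF assms(1)]
  interpret prob_space M by (rule L)
  define t where "t i = (if i \<le> k then real i * d else real k * d + w)" for i
  have meas[measurable]: "X (real j * d) \<in> borel_measurable M" "X (real k * d + w) \<in> borel_measurable M"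
    "X w \<in> borel_measurable M" for j
    using L(2) d w by auto
  define R where "R \<omega> = (\<lambda>i\<in>{..<k}. X (t (Suc i)) \<omega> - X (t i) \<omega>)" for \<omega>
  define R' where "R' \<omega> = (\<lambda>i\<in>{k}. X (t (Suc i)) \<omega> - X (t i) \<omega>)" for \<omega>
  define S where "S = {f \<in> space (Pi\<^sub>M {..<k} (\<lambda>_. borel :: 'a measure)). \<forall>j\<in>{..k}. (\<Sum>i<j. f i) \<in> D j}"
  define S' where "S' = {f \<in> space (Pi\<^sub>M {k} (\<lambda>_. borel :: 'a measure)). f k \<in> B}"
  have "indep_var (Pi\<^sub>M {..<k} (\<lambda>_. borel)) R (Pi\<^sub>M {k} (\<lambda>_. borel)) R'"
    unfolding R_def R'_def
  proof (rule levy_indep_increments[OF assms(1)])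
    show "t i \<le> t (Suc i)" if "i \<le> k" for i
    proof (cases "i = k")
      case False
      then have "Suc i \<le> k" using that by simp
      then show ?thesis using d that by (simp add: t_def algebra_simps)
    qed (use w in \<open>simp add: t_def\<close>)
  qed (simp add: t_def)
  moreover have "(\<lambda>f. \<Sum>i<j. f i) \<in> borel_measurable (Pi\<^sub>M {..<k} (\<lambda>_. borel :: 'a measure))" if "j \<le> k" for j
    using that by (intro borel_measurable_sum measurable_component_singleton) auto
  then have "S \<in> sets (Pi\<^sub>M {..<k} (\<lambda>_. borel))"
    unfolding S_def
    by (intro sets.sets_Collect_finite_All' finite_atMost) (auto intro: measurable_sets_Collect[where N=borel])
  moreover have "S' \<in> sets (Pi\<^sub>M {k} (\<lambda>_. borel))"
    unfolding S'_def by measurable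
  ultimately have "prob ((\<lambda>\<omega>. (R \<omega>, R' \<omega>)) -` (S \<times> S') \<inter> space M)
      = prob (R -` S \<inter> space M) * prob (R' -` S' \<inter> space M)"
    by (rule indep_varD)
  moreover have tel: "(\<Sum>i<j. R \<omega> i) = X (real j * d) \<omega> - X 0 \<omega>" if "j \<le> k" for j \<omega>
  proof -
    have "(\<Sum>i<j. R \<omega> i) = (\<Sum>i<j. X (real (Suc i) * d) \<omega> - X (real i * d) \<omega>)"
      using that by (intro sum.cong) (auto simp: R_def t_def)
    also have "\<dots> = X (real j * d) \<omega> - X 0 \<omega>"
      using sum_lessThan_telescope[of "\<lambda>i. X (real i * d) \<omega>" j] by simp
    finally show ?thesis .
  qed
  have S: "R \<omega> \<in> S \<longleftrightarrow> (\<forall>j\<le>k. X (real j * d) \<omega> - X 0 \<omega> \<in> D j)" for \<omega>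
    unfolding S_def using tel by (auto simp: space_PiM R_def)
  have S': "R' \<omega> \<in> S' \<longleftrightarrow> X (real k * d + w) \<omega> - X (real k * d) \<omega> \<in> B" for \<omega>
    unfolding S'_def by (auto simp: space_PiM R'_def t_def)
  have [measurable]: "X 0 \<in> borel_measurable M" using L(2) by simp
  have "(\<lambda>\<omega>. (R \<omega>, R' \<omega>)) -` (S \<times> S') \<inter> space M
      = {\<omega>\<in>space M. (\<forall>j\<le>k. X (real j * d) \<omega> - X 0 \<omega> \<in> D j) \<and> X (real k * d + w) \<omega> - X (real k * d) \<omega> \<in> B}"
    using S S' by auto
  moreover have "prob \<dots>
      = prob {\<omega>\<in>space M. (\<forall>j\<le>k. X (real j * d) \<omega> \<in> D j) \<and> X (real k * d + w) \<omega> - X (real k * d) \<omega> \<in> B}"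
    using L(3) by (intro finite_measure_eq_AE) auto
  moreover have "R -` S \<inter> space M = {\<omega>\<in>space M. \<forall>j\<le>k. X (real j * d) \<omega> - X 0 \<omega> \<in> D j}"
    using S by auto
  moreover have "prob \<dots> = prob {\<omega>\<in>space M. \<forall>j\<le>k. X (real j * d) \<omega> \<in> D j}"
    using L(3) by (intro finite_measure_eq_AE) auto
  moreover have "R' -` S' \<inter> space M = (\<lambda>\<omega>. X (real k * d + w) \<omega> - X (real k * d) \<omega>) -` B \<inter> space M"
    using S' by auto
  moreover have "prob \<dots> = measure (distr M borel (\<lambda>\<omega>. X (real k * d + w) \<omega> - X (real k * d) \<omega>)) B"
    by (subst measure_distr) auto
  moreover have "\<dots> = prob {\<omega>\<in>space M. X w \<omega> \<in> B}"
    using d w by (subst L(4)) (auto simp: measure_distr intro!: arg_cong[where f=prob])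
  ultimately show ?thesis
    by (simp add: emeasure_eq_measure ennreal_mult)
qed

text \<open>Grid time 0 is left out, as in \<open>hitting_time\<close>.\<close>

definition first_at :: "'w measure \<Rightarrow> (real \<Rightarrow> 'w \<Rightarrow> 'a::euclidean_space) \<Rightarrow> real \<Rightarrow> 'a set \<Rightarrow> nat \<Rightarrow> 'w set" where
  "first_at M X d B k = {\<omega>\<in>space M. \<forall>j\<le>k. X (real j * d) \<omega> \<in>
     (if j = 0 then UNIV else if j = k then B else - B)}"

lemma first_at_sets:
  assumes "levy_process M X" "d \<ge> 0" "B \<in> sets borel"
  shows "first_at M X d B k \<in> sets M"
proof -
  have X: "X (real j * d) \<in> borel_measurable M" for j
    using levy_processD(2)[OF assms(1)] assms(2) by simp
  define D where "D j = (if j = 0 then UNIV else if j = k then B else - B)" for j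
  have "D j \<in> sets borel" for j
    using assms(3) by (simp add: D_def borel_comp)
  then have E: "{\<omega>\<in>space M. X (real j * d) \<omega> \<in> D j} \<in> sets M" for j
    using measurable_sets_Collect[OF X[of j], of "\<lambda>x. x \<in> D j"] by simp
  have "{\<omega>\<in>space M. \<forall>j\<in>{..k}. X (real j * d) \<omega> \<in> D j} \<in> sets M"
    by (rule sets.sets_Collect_finite_All'[OF E]) simp_all
  moreover have "first_at M X d B k = {\<omega>\<in>space M. \<forall>j\<in>{..k}. X (real j * d) \<omega> \<in> D j}"
    unfolding first_at_def D_def Ball_def atMost_iff ..
  ultimately show ?thesis by simp
qed

lemma first_at_disjoint: "i \<noteq> j \<Longrightarrow> first_at M X d B (Suc i) \<inter> first_at M X d B (Suc j) = {}"
proof (induction i j rule: linorder_wlog)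
  case (le i j)
  have "False" if "\<omega> \<in> first_at M X d B (Suc i)" "\<omega> \<in> first_at M X d B (Suc j)" for \<omega>
  proof -
    have "X (real (Suc i) * d) \<omega> \<in> B" using that(1) unfolding first_at_def by (auto dest!: spec[of _ "Suc i"])
    moreover have "X (real (Suc i) * d) \<omega> \<in> - B" using that(2) le
      unfolding first_at_def by (auto dest!: spec[of _ "Suc i"])
    ultimately show False by simp
  qed
  then show ?case by auto
qed auto

definition discount :: "real \<Rightarrow> real \<Rightarrow> ennreal" where
  "discount lam u = ennreal (exp (- lam * u))"

lemma discount_measurable [measurable]: "discount lam \<in> borel_measurable borel"
  unfolding discount_def by measurable

lemma discount_add: "discount lam (s + t) = discount lam s * discount lam t"
  by (simp add: discount_def ennreal_mult[symmetric] exp_add[symmetric] algebra_simps)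

text \<open>First visits at different grid times are disjoint events. At such a visit the process is
  within \<epsilon> of \<open>v\<close>, so a further increment in \<open>Ge\<close> puts it into
  \<open>v + G\<close>: shrinking \<open>G\<close> by \<epsilon> absorbs the inexact hit. The Markov
  property at the grid time supplies the potential of \<open>Ge\<close> from a fresh start.\<close>

lemma grid_hitting_bound:
  fixes X :: "real \<Rightarrow> 'w \<Rightarrow> 'a::euclidean_space" and \<epsilon> d :: real
  assumes L: "levy_process M X" and d: "d > 0" and "open G"
  defines "Ge \<equiv> {z. ball z \<epsilon> \<subseteq> G}"
  assumes Ge[measurable]: "Ge \<in> sets borel"
  shows "(\<Sum>k. discount lam (real (Suc k) * d) * emeasure M (first_at M X d (ball v \<epsilon>) (Suc k)))
      * occupation M X (discount lam) (indicator Ge) 0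
    \<le> occupation M X (discount lam) (indicator G) (- v)"
proof -
  have [measurable]: "G \<in> sets borel" using \<open>open G\<close> by simp
  have [measurable]: "X u \<in> borel_measurable M" if "u \<ge> 0" for u
    using levy_processD(2)[OF L] that .
  define A where "A k = first_at M X d (ball v \<epsilon>) (Suc k)" for k
  define c where "c k = real (Suc k) * d" for k
  have c_nonneg: "c k \<ge> 0" for k using d by (simp add: c_def)
  note [measurable] = transition_measurable[OF L]
  \<comment> \<open>The estimate at one fixed time \<open>u\<close>, where only visits up to
    \<open>u\<close> count. Integrating it against \<open>discount lam u\<close> and shifting time
    by \<open>c k\<close> then produces the discount of the visiting time.\<close>
  have tr: "(\<Sum>k. emeasure M (A k) * transition M X (max (u - c k) 0) (indicator Ge) 0 * indicator {c k..} u)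
      \<le> transition M X u (indicator G) (- v)" if "u \<ge> 0" for u
  proof -
    define E where "E k = (if c k \<le> u then {\<omega>\<in>A k. X (c k + (u - c k)) \<omega> - X (c k) \<omega> \<in> Ge} else {})" for k
    have E_sets: "E k \<in> sets M" for k
    proof -
      have [measurable]: "A k \<in> sets M" "X (c k) \<in> borel_measurable M" "X (c k + (u - c k)) \<in> borel_measurable M"
        using c_nonneg \<open>u \<ge> 0\<close> d by (auto simp: A_def first_at_sets[OF L])
      have "{\<omega>\<in>space M. \<omega> \<in> A k \<and> X (c k + (u - c k)) \<omega> - X (c k) \<omega> \<in> Ge} \<in> sets M" by measurable
      moreover have "{\<omega>\<in>space M. \<omega> \<in> A k \<and> X (c k + (u - c k)) \<omega> - X (c k) \<omega> \<in> Ge}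
          = {\<omega>\<in>A k. X (c k + (u - c k)) \<omega> - X (c k) \<omega> \<in> Ge}"
        using sets.sets_into_space[OF \<open>A k \<in> sets M\<close>] by auto
      ultimately show ?thesis by (simp add: E_def)
    qed
    have "emeasure M (A k) * transition M X (max (u - c k) 0) (indicator Ge) 0 * indicator {c k..} u = emeasure M (E k)" for k
    proof (cases "c k \<le> u")
      case True
      have "emeasure M (E k) = emeasure M {\<omega>\<in>space M. (\<forall>j\<le>Suc k. X (real j * d) \<omega> \<in>
            (if j = 0 then UNIV else if j = Suc k then ball v \<epsilon> else - ball v \<epsilon>))
          \<and> X (real (Suc k) * d + (u - c k)) \<omega> - X (real (Suc k) * d) \<omega> \<in> Ge}"
        using True by (intro arg_cong[where f="emeasure M"]) (auto simp: E_def A_def first_at_def c_def)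
      also have "\<dots> = emeasure M (A k) * emeasure M {\<omega>\<in>space M. X (u - c k) \<omega> \<in> Ge}"
        unfolding A_def first_at_def using d True
        by (intro levy_grid_markov[OF L]) auto
      also have "emeasure M {\<omega>\<in>space M. X (u - c k) \<omega> \<in> Ge} = transition M X (max (u - c k) 0) (indicator Ge) 0"
        using True by (subst transition_indicator[OF L]) auto
      finally show ?thesis using True by simp
    qed (auto simp: E_def)
    then have "(\<Sum>k. emeasure M (A k) * transition M X (max (u - c k) 0) (indicator Ge) 0 * indicator {c k..} u)
        = (\<Sum>k. emeasure M (E k))" by simp
    also have "\<dots> = emeasure M (\<Union>k. E k)"
    proof (rule suminf_emeasure)
      show "disjoint_family E"
        unfolding disjoint_family_on_def
        using first_at_disjoint[of _ _ M X d "ball v \<epsilon>"] by (auto simp: E_def A_def set_eq_iff)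
    qed (use E_sets in auto)
    also have "\<dots> \<le> emeasure M {\<omega>\<in>space M. - v + X u \<omega> \<in> G}"
    proof (rule emeasure_mono)
      show "(\<Union>k. E k) \<subseteq> {\<omega>\<in>space M. - v + X u \<omega> \<in> G}"
      proof
        fix \<omega> assume "\<omega> \<in> (\<Union>k. E k)"
        then obtain k where k: "\<omega> \<in> A k" "X u \<omega> - X (c k) \<omega> \<in> Ge"
          by (auto simp: E_def split: if_splits)
        have "\<omega> \<in> space M" "X (c k) \<omega> \<in> ball v \<epsilon>"
          using k(1) by (auto simp: A_def first_at_def c_def dest!: spec[of _ "Suc k"])
        then have "- v + X u \<omega> \<in> ball (X u \<omega> - X (c k) \<omega>) \<epsilon>"
          by (simp add: dist_norm algebra_simps norm_minus_commute)
        with k(2) \<open>\<omega> \<in> space M\<close> show "\<omega> \<in> {\<omega>\<in>space M. - v + X u \<omega> \<in> G}" by (auto simp: Ge_def)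
      qed
      have [measurable]: "X u \<in> borel_measurable M" using that by measurable
      show "{\<omega>\<in>space M. - v + X u \<omega> \<in> G} \<in> sets M" by measurable
    qed
    also have "\<dots> = transition M X u (indicator G) (- v)"
      using that by (simp add: transition_indicator[OF L])
    finally show ?thesis .
  qed
  have "(\<Sum>k. discount lam (c k) * emeasure M (A k)) * occupation M X (discount lam) (indicator Ge) 0
      = (\<Sum>k. emeasure M (A k) * (discount lam (c k) * occupation M X (discount lam) (indicator Ge) 0))"
    unfolding ennreal_suminf_multc[symmetric] by (simp only: mult_ac)
  also have "\<dots> = (\<Sum>k. emeasure M (A k) *
      (\<integral>\<^sup>+u\<in>{c k..}. discount lam u * transition M X (max (u - c k) 0) (indicator Ge) 0 \<partial>lborel))"
  proof (intro suminf_cong arg_cong2[where f="(*)"] refl)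
    fix k
    have "(\<integral>\<^sup>+u\<in>{c k..}. discount lam u * transition M X (max (u - c k) 0) (indicator Ge) 0 \<partial>lborel)
       = (\<integral>\<^sup>+u\<in>{0..}. discount lam (c k + u) * transition M X (max (c k + u - c k) 0) (indicator Ge) 0 \<partial>lborel)"
      by (rule nn_integral_shift_atLeast) measurable
    also have "\<dots> = discount lam (c k) * occupation M X (discount lam) (indicator Ge) 0"
      unfolding discount_add occupation_max
      by (subst nn_integral_cmult[symmetric], measurable) (auto intro!: nn_integral_cong simp: mult_ac)
    finally show "discount lam (c k) * occupation M X (discount lam) (indicator Ge) 0 =
      (\<integral>\<^sup>+u\<in>{c k..}. discount lam u * transition M X (max (u - c k) 0) (indicator Ge) 0 \<partial>lborel)" ..
  qed
  also have "\<dots> = (\<integral>\<^sup>+u. (\<Sum>k. emeasure M (A k) *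
      (discount lam u * transition M X (max (u - c k) 0) (indicator Ge) 0 * indicator {c k..} u)) \<partial>lborel)"
    by (simp add: nn_integral_suminf nn_integral_cmult)
  also have "\<dots> = (\<integral>\<^sup>+u. discount lam u * (\<Sum>k. emeasure M (A k) *
      transition M X (max (u - c k) 0) (indicator Ge) 0 * indicator {c k..} u) \<partial>lborel)"
    unfolding ennreal_suminf_cmult[symmetric] by (simp only: mult_ac)
  also have "\<dots> \<le> (\<integral>\<^sup>+u\<in>{0..}. discount lam u * transition M X u (indicator G) (- v) \<partial>lborel)"
  proof (rule nn_integral_mono)
    fix u :: real
    show "discount lam u * (\<Sum>k. emeasure M (A k) *
      transition M X (max (u - c k) 0) (indicator Ge) 0 * indicator {c k..} u)
      \<le> discount lam u * transition M X u (indicator G) (- v) * indicator {0..} u"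
    proof (cases "u \<ge> 0")
      case True
      then show ?thesis using tr[OF True] by (auto intro!: mult_left_mono)
    next
      case False
      then have "indicator {c k..} u = (0 :: ennreal)" for k
        using c_nonneg[of k] by (auto simp: indicator_def)
      then show ?thesis by simp
    qed
  qed
  finally show ?thesis unfolding A_def c_def occupation_def .
qed

subsection \<open>Potentials and hitting times\<close>

text \<open>If the path is at \<open>v\<close> at time \<open>t\<close>, right continuity keeps it
  in the ball just after \<open>t\<close>, where a fine grid has a point; hence the first grid visit
  is at most slightly later than the hitting time. Fatou's lemma turns this pathwise bound into one
  for expectations.\<close>

lemma hit_laplace_le_liminf:
  fixes X :: "real \<Rightarrow> 'w \<Rightarrow> 'a::euclidean_space" and \<epsilon> :: real and v :: 'a
  assumes L: "levy_process M X" and lam: "lam > 0" and eps: "\<epsilon> > 0"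
  defines "W \<equiv> \<lambda>n \<omega>. \<Sum>k. discount lam (real (Suc k) * (1 / real (Suc n))) *
      indicator (first_at M X (1 / real (Suc n)) (ball v \<epsilon>) (Suc k)) \<omega>"
  shows "ennreal (hit_laplace M X lam v) \<le> liminf (\<lambda>n. \<integral>\<^sup>+\<omega>. W n \<omega> \<partial>M)"
proof -
  define f where "f \<omega> = (if hitting_time X v \<omega> = \<infinity> then 0
         else exp (- lam * real_of_ereal (hitting_time X v \<omega>)))" for \<omega>
  have W[measurable]: "W n \<in> borel_measurable M" for n
    unfolding W_def
    by (intro borel_measurable_suminf_order borel_measurable_times_ennreal borel_measurable_const
          borel_measurable_indicator first_at_sets[OF L]) auto
  have path: "ennreal (f \<omega>) \<le> liminf (\<lambda>n. W n \<omega>)" if cad: "cadlag (\<lambda>t. X t \<omega>)" and sp: "\<omega> \<in> space M" for \<omega>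
  proof (cases "hitting_time X v \<omega> = \<infinity>")
    case True
    then show ?thesis by (simp add: f_def)
  next
    case False
    have "hitting_time X v \<omega> \<ge> 0"
      unfolding hitting_time_def by (auto intro!: Inf_greatest)
    then obtain T where T: "hitting_time X v \<omega> = ereal T" "T \<ge> 0"
      using False by (cases "hitting_time X v \<omega>") auto
    have main: "ennreal (exp (- lam * (T + \<eta>))) \<le> liminf (\<lambda>n. W n \<omega>)" if "\<eta> > 0" for \<eta>
    proof -
      have "Inf (ereal ` {t. 0 < t \<and> X t \<omega> = v}) < ereal (T + \<eta> / 2)"
        using T that unfolding hitting_time_def by simp
      \<comment> \<open>The infimum \<open>T\<close> need not be a visiting time, in particular when
        it is 0; half of \<eta> is spent on a visit near it and half on the mesh.\<close>
      then obtain t where t: "0 < t" "X t \<omega> = v" "t < T + \<eta> / 2"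
        by (auto simp: Inf_less_iff)
      have "((\<lambda>t. X t \<omega>) \<longlongrightarrow> v) (at_right t)"
        using cad t unfolding cadlag_def by (auto dest: spec[of _ t])
      then have "\<forall>\<^sub>F s in at_right t. X s \<omega> \<in> ball v \<epsilon>"
        using eps by (auto dest!: tendstoD[where e=\<epsilon>] simp: dist_commute)
      then obtain b where b: "b > t" "\<And>s. t < s \<Longrightarrow> s < b \<Longrightarrow> X s \<omega> \<in> ball v \<epsilon>"
        unfolding eventually_at_right_field by auto
      define b' where "b' = min b (t + \<eta> / 2)"
      have "b' > t" using b that by (simp add: b'_def)
      then have "\<forall>\<^sub>F n in sequentially. 1 / real (Suc n) < b' - t"
        using order_tendstoD(2)[OF LIMSEQ_inverse_real_of_nat, of "b' - t"]
        by (simp add: inverse_eq_divide)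
      then have "\<forall>\<^sub>F n in sequentially. ennreal (exp (- lam * (T + \<eta>))) \<le> W n \<omega>"
      proof eventually_elim
        case (elim n)
        define d where "d = 1 / real (Suc n)"
        have d: "d > 0" by (simp add: d_def)
        define k where "k = nat \<lfloor>t / d\<rfloor>"
        have k: "real k \<le> t / d" "t / d < real k + 1"
          using t d unfolding k_def by (auto simp: floor_less_iff le_floor_iff)
        then have "real (Suc k) * d > t" "real (Suc k) * d \<le> t + d"
          using d by (auto simp: field_simps)
        moreover have "t + d < b'" using elim unfolding d_def by linarith
        ultimately have kk: "t < real (Suc k) * d" "real (Suc k) * d < b'" by auto
        then have "X (real (Suc k) * d) \<omega> \<in> ball v \<epsilon>"
          by (intro b) (auto simp: b'_def)
        \<comment> \<open>A grid visit earlier than the one just found is possible; it only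
          increases the discount factor.\<close>
        define m where "m = (LEAST m. X (real (Suc m) * d) \<omega> \<in> ball v \<epsilon>)"
        have m: "X (real (Suc m) * d) \<omega> \<in> ball v \<epsilon>" "m \<le> k"
          unfolding m_def by (rule LeastI, fact, rule Least_le, fact)
        have "X (real (Suc j) * d) \<omega> \<notin> ball v \<epsilon>" if "j < m" for j
          using not_less_Least that unfolding m_def by blast
        then have "\<omega> \<in> first_at M X d (ball v \<epsilon>) (Suc m)"
          using m sp unfolding first_at_def
          by (auto simp: less_Suc_eq_le gr0_conv_Suc simp del: of_nat_Suc dest!: gr0_implies_Suc le_neq_implies_less)
        moreover have "real (Suc m) * d \<le> T + \<eta>"
        proof -
          have "real (Suc m) * d \<le> real (Suc k) * d" using m d by (intro mult_right_mono) auto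
          also have "\<dots> \<le> T + \<eta>" using kk t by (simp add: b'_def)
          finally show ?thesis .
        qed
        then have "ennreal (exp (- lam * (T + \<eta>))) \<le> discount lam (real (Suc m) * d)"
          using lam unfolding discount_def by (intro ennreal_leI) simp
        ultimately have "ennreal (exp (- lam * (T + \<eta>)))
            \<le> discount lam (real (Suc m) * d) * indicator (first_at M X d (ball v \<epsilon>) (Suc m)) \<omega>"
          by simp
        also have "\<dots> \<le> W n \<omega>"
        proof -
          define g where "g k = discount lam (real (Suc k) * d) * indicator (first_at M X d (ball v \<epsilon>) (Suc k)) \<omega>" for k
          have "g m \<le> suminf g" using sum_le_suminf[of g "{m}"] by simp
          then show ?thesis unfolding W_def d_def[symmetric] g_def .
        qed
        finally show ?case .
      qed
      then show ?thesis by (rule Liminf_bounded)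
    qed
    have "((\<lambda>\<eta>. ennreal (exp (- lam * (T + \<eta>)))) \<longlongrightarrow> ennreal (exp (- lam * (T + 0)))) (at_right 0)"
      by (intro tendsto_intros)
    then have "ennreal (exp (- lam * (T + 0))) \<le> liminf (\<lambda>n. W n \<omega>)"
      by (rule tendsto_upperbound)
        (use main in \<open>auto simp: eventually_at_right_field intro!: exI[of _ 1]\<close>)
    then show ?thesis using T by (simp add: f_def)
  qed
  \<comment> \<open>Without integrability the Bochner integral is 0 by convention, and the bound
    still holds.\<close>
  have "ennreal (hit_laplace M X lam v) \<le> (\<integral>\<^sup>+\<omega>. ennreal (f \<omega>) \<partial>completion M)"
  proof (cases "integrable (completion M) f")
    case True
    then show ?thesis
      unfolding hit_laplace_def f_def[symmetric]
      by (subst nn_integral_eq_integral) (auto simp: f_def)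
  next
    case False
    then show ?thesis
      unfolding hit_laplace_def f_def[symmetric] by (simp add: not_integrable_integral_eq)
  qed
  also have "\<dots> = (\<integral>\<^sup>+\<omega>. ennreal (f \<omega>) \<partial>M)" by (rule nn_integral_completion)
  also have "\<dots> \<le> (\<integral>\<^sup>+\<omega>. liminf (\<lambda>n. W n \<omega>) \<partial>M)"
    proof (rule nn_integral_mono_AE)
    show "AE \<omega> in M. ennreal (f \<omega>) \<le> liminf (\<lambda>n. W n \<omega>)"
      using levy_processD(5)[OF L] AE_space by eventually_elim (rule path)
  qed
  also have "\<dots> \<le> liminf (\<lambda>n. \<integral>\<^sup>+\<omega>. W n \<omega> \<partial>M)"
    by (rule nn_integral_liminf) measurable
  finally show ?thesis .
qed

lemma closed_shrink: "closed {z::'a::euclidean_space. ball z \<epsilon> \<subseteq> G}"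
proof -
  have "- {z. ball z \<epsilon> \<subseteq> G} = (\<Union>w\<in>-G. ball w \<epsilon>)"
    by (auto simp: dist_commute)
  then show ?thesis by (simp add: closed_def open_UN)
qed

lemma occupation_discount_finite:
  fixes X :: "real \<Rightarrow> 'w \<Rightarrow> 'a::euclidean_space"
  assumes L: "levy_process M X" and lam: "lam > 0"
  shows "occupation M X (discount lam) (\<lambda>_. 1) x = ennreal (1 / lam)"
proof -
  interpret prob_space M by (rule levy_processD[OF L])
  have "occupation M X (discount lam) (\<lambda>_. 1) x = (\<integral>\<^sup>+u. ennreal (exp (- lam * u)) * indicator {0..} u \<partial>lborel)"
    unfolding occupation_def transition_def discount_def by (simp add: emeasure_space_1)
  also have "\<dots> = ennreal (0 - (- exp (- lam * 0) / lam))"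
  proof (rule nn_integral_FTC_atLeast)
    show "((\<lambda>u. - exp (- lam * u) / lam) has_real_derivative exp (- lam * x)) (at x)" for x
      using lam by (auto intro!: derivative_eq_intros)
    have "((\<lambda>u. exp (- lam * u)) \<longlongrightarrow> 0) at_top"
      using lam by (intro filterlim_compose[OF exp_at_bot] filterlim_tendsto_neg_mult_at_bot[OF tendsto_const _ filterlim_ident]) auto
    then show "((\<lambda>u. - exp (- lam * u) / lam) \<longlongrightarrow> 0) at_top"
      using tendsto_divide[OF tendsto_minus tendsto_const, of _ 0 at_top lam] lam by simp
  qed auto
  finally show ?thesis by simp
qed

text \<open>In the grid bound the mesh tends to 0 for a fixed ball radius, and then the radius tends
  to 0; the shrunken sets increase to \<open>G\<close> because \<open>G\<close> is open.\<close>

lemma hit_laplace_occupation_open: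
  fixes X :: "real \<Rightarrow> 'w \<Rightarrow> 'a::euclidean_space"
  assumes L: "levy_process M X" and lam: "lam > 0" and G: "open G"
  shows "ennreal (hit_laplace M X lam v) * occupation M X (discount lam) (indicator G) 0
    \<le> occupation M X (discount lam) (indicator G) (- v)"
proof -
  define h where "h = ennreal (hit_laplace M X lam v)"
  define R where "R = occupation M X (discount lam) (indicator G) (- v)"
  define Ge where "Ge n = {z. ball z (1 / real (Suc n)) \<subseteq> G}" for n
  have Ge_sets: "Ge n \<in> sets borel" for n
    unfolding Ge_def by (intro borel_closed closed_shrink)
  obtain U where U: "sets U = sets borel"
    and occ: "\<And>F x. F \<in> borel_measurable borel \<Longrightarrow> (\<integral>\<^sup>+y. F (x + y) \<partial>U) = occupation M X (discount lam) F x"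
    using occupation_measure[OF L discount_measurable, of lam] by blast
  have occ0: "occupation M X (discount lam) (indicator A) 0 = emeasure U A" if "A \<in> sets borel" for A
    using occ[of "indicator A" 0] that U by simp
  have step: "h * emeasure U (Ge n) \<le> R" for n
  proof (cases "emeasure U (Ge n) = 0")
    case False
    have "emeasure U (Ge n) \<le> emeasure U (space U)" by (rule emeasure_space)
    also have "\<dots> = ennreal (1 / lam)"
      using occ[of "\<lambda>_. 1" 0] occupation_discount_finite[OF L lam, of 0] by simp
    finally have fin: "emeasure U (Ge n) \<noteq> top" by (auto simp: top_unique)
    define \<epsilon> where "\<epsilon> = 1 / real (Suc n)"
    define w where "w m = (\<integral>\<^sup>+\<omega>. (\<Sum>k. discount lam (real (Suc k) * (1 / real (Suc m))) *
      indicator (first_at M X (1 / real (Suc m)) (ball v \<epsilon>) (Suc k)) \<omega>) \<partial>M)" for m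
    have w: "w m * emeasure U (Ge n) \<le> R" for m
    proof -
      have [measurable]: "first_at M X (1 / real (Suc m)) (ball v \<epsilon>) (Suc k) \<in> sets M" for k
        by (intro first_at_sets[OF L]) auto
      have "w m = (\<Sum>k. discount lam (real (Suc k) * (1 / real (Suc m))) *
            emeasure M (first_at M X (1 / real (Suc m)) (ball v \<epsilon>) (Suc k)))"
        unfolding w_def by (subst nn_integral_suminf) (auto simp: nn_integral_cmult simp del: of_nat_Suc)
      then show ?thesis
        using grid_hitting_bound[OF L _ G, of "1 / real (Suc m)" \<epsilon> lam v] occ0[of "Ge n"]
          Ge_sets[of n]
        by (simp add: R_def Ge_def \<epsilon>_def del: of_nat_Suc)
    qed
    have "h \<le> liminf w"
      unfolding h_def w_def[abs_def] by (rule hit_laplace_le_liminf[OF L lam]) (simp add: \<epsilon>_def)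
    \<comment> \<open>Dividing by this finite positive mass leaves the liminf to be taken of the
      hitting weights alone.\<close>
    also have "\<dots> \<le> R / emeasure U (Ge n)"
    proof -
      have "w m \<le> R / emeasure U (Ge n)" for m
        using divide_right_mono_ennreal[OF w[of m], of "emeasure U (Ge n)"] False fin
        by (simp add: ennreal_mult_divide_eq)
      then have "liminf w \<le> liminf (\<lambda>_. R / emeasure U (Ge n))"
        by (intro Liminf_mono) auto
      then show ?thesis by (simp add: Liminf_const)
    qed
    finally have "h * emeasure U (Ge n) \<le> R / emeasure U (Ge n) * emeasure U (Ge n)"
      by (rule mult_right_mono) simp
    also have "\<dots> = R"
      using False fin by (simp add: ennreal_divide_times ennreal_times_divide ennreal_mult_divide_eq)
    finally show ?thesis .
  qed simp
  have "(\<Union>n. Ge n) = G"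
  proof (intro equalityI subsetI)
    fix z assume "z \<in> G"
    then obtain e where e: "e > 0" "ball z e \<subseteq> G" using G open_contains_ball by blast
    obtain n where "1 / real (Suc n) < e" using e(1) nat_approx_posE by blast
    then show "z \<in> (\<Union>n. Ge n)" using e(2) unfolding Ge_def by (auto intro!: exI[of _ n] simp del: of_nat_Suc)
  next
    fix z assume "z \<in> (\<Union>n. Ge n)"
    then obtain n where "ball z (1 / real (Suc n)) \<subseteq> G" by (auto simp: Ge_def)
    then show "z \<in> G" using centre_in_ball[of z "1 / real (Suc n)"] by auto
  qed
  moreover have "incseq Ge"
  proof (rule incseq_SucI)
    fix n
    have "1 / real (Suc (Suc n)) \<le> 1 / real (Suc n)" by (simp add: frac_le)
    then show "Ge n \<le> Ge (Suc n)" unfolding Ge_def using subset_ball by blast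
  qed
  moreover have "range Ge \<subseteq> sets U"
    unfolding U by (intro image_subsetI Ge_sets)
  ultimately have "emeasure U G = (SUP n. emeasure U (Ge n))"
    by (metis SUP_emeasure_incseq)
  then have "h * emeasure U G = (SUP n. h * emeasure U (Ge n))"
    by (simp add: SUP_mult_left_ennreal)
  also have "\<dots> \<le> R" by (intro SUP_least step)
  finally show ?thesis using occ0[of G] G by (simp add: h_def R_def)
qed

text \<open>For indicators both sides are finite measures, so outer regularity extends the
  inequality from open to Borel sets, and domination of measures then gives it for nonnegative
  functions.\<close>

lemma hit_laplace_occupation:
  fixes X :: "real \<Rightarrow> 'w \<Rightarrow> 'a::euclidean_space"
  assumes L: "levy_process M X" and lam: "lam > 0" and F: "F \<in> borel_measurable borel"
  shows "ennreal (hit_laplace M X lam v) * occupation M X (discount lam) F x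
    \<le> occupation M X (discount lam) F (x - v)"
proof -
  define h where "h = ennreal (hit_laplace M X lam v)"
  obtain U where U[measurable_cong, simp]: "sets U = sets borel"
    and occ: "\<And>F x. F \<in> borel_measurable borel \<Longrightarrow> (\<integral>\<^sup>+y. F (x + y) \<partial>U) = occupation M X (discount lam) F x"
    using occupation_measure[OF L discount_measurable, of lam] by blast
  have [simp]: "space U = UNIV" using sets_eq_imp_space_eq[OF U] by simp
  have "emeasure U UNIV = ennreal (1 / lam)"
    using occ[of "\<lambda>_. 1" 0] occupation_discount_finite[OF L lam, of 0] by simp
  then interpret finite_measure U by (intro finite_measureI) simp
  define U' where "U' = distr U borel (\<lambda>y. y - v)"
  interpret U': finite_measure U' unfolding U'_def by (rule finite_measure_distr) simp
  have U'_eq: "emeasure U' A = occupation M X (discount lam) (indicator A) (- v)" if [measurable]: "A \<in> sets borel" for A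
  proof -
    have "emeasure U' A = (\<integral>\<^sup>+y. indicator A (y - v) \<partial>U)"
      unfolding U'_def by (subst nn_integral_indicator[symmetric], simp, subst nn_integral_distr) auto
    also have "\<dots> = (\<integral>\<^sup>+y. indicator A (- v + y) \<partial>U)" by simp
    also have "\<dots> = occupation M X (discount lam) (indicator A) (- v)" by (rule occ) simp
    finally show ?thesis .
  qed
  have "scale_measure h U \<le> U'"
  proof (subst le_measure)
    show "\<forall>A\<in>sets (scale_measure h U). emeasure (scale_measure h U) A \<le> emeasure U' A"
    proof safe
      fix A assume "A \<in> sets (scale_measure h U)"
      then have A: "A \<in> sets borel" by simp
      have "emeasure U' A = (INF G\<in>{G. A \<subseteq> G \<and> open G}. emeasure U' G)"
        by (rule outer_regular) (use A U'.finite_emeasure_space in \<open>auto simp: U'_def\<close>)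
      moreover have "h * emeasure U A \<le> emeasure U' G" if "A \<subseteq> G" "open G" for G
      proof -
        have "h * emeasure U A \<le> h * emeasure U G"
          using that by (intro mult_left_mono emeasure_mono) auto
        also have "\<dots> \<le> emeasure U' G"
          using hit_laplace_occupation_open[OF L lam that(2), of v] occ[of "indicator G" 0] that(2) U'_eq[of G]
          by (simp add: h_def)
        finally show ?thesis .
      qed
      ultimately show "emeasure (scale_measure h U) A \<le> emeasure U' A"
        by (auto intro!: INF_greatest)
    qed
  qed (simp add: U'_def)
  then have "(\<integral>\<^sup>+y. F (x + y) \<partial>scale_measure h U) \<le> (\<integral>\<^sup>+y. F (x + y) \<partial>U')"
    by (intro nn_integral_mono_measure) (auto simp: U'_def)
  also have "\<dots> = (\<integral>\<^sup>+y. F ((x - v) + y) \<partial>U)"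
    unfolding U'_def using F by (subst nn_integral_distr) (auto simp: algebra_simps)
  finally show ?thesis
    using F occ[OF F] by (simp add: nn_integral_scale_measure h_def)
qed

subsection \<open>Potentials and Lebesgue measure on a line\<close>

text \<open>For \<open>p = exp (- lam * T)\<close>, which lies in [0, 1], exp (- \<mu> * T) \<ge> p
  ^ n \<ge> 1 - n * (1 - p) by Bernoulli's inequality. The point is the change of rate: being close
  to 1 at rate \<open>lam\<close> forces closeness to 1 at every rate.\<close>

lemma hit_laplace_bernoulli:
  assumes M: "prob_space M" and lam: "lam > 0" and mu: "\<mu> > 0" "\<mu> \<le> real n * lam"
    and pos: "hit_laplace M X lam v > 0"
  shows "1 - real n * (1 - hit_laplace M X lam v) \<le> hit_laplace M X \<mu> v"
proof -
  interpret C: prob_space "completion M" by (rule prob_space.prob_space_completion[OF M])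
  define f where "f l \<omega> = (if hitting_time X v \<omega> = \<infinity> then 0
         else exp (- l * real_of_ereal (hitting_time X v \<omega>)))" for l \<omega>
  have hit: "hit_laplace M X l v = (LINT \<omega>|completion M. f l \<omega>)" for l
    by (simp add: hit_laplace_def f_def)
  have "hitting_time X v \<omega> \<ge> 0" for \<omega>
    unfolding hitting_time_def by (auto intro!: Inf_greatest)
  then have T: "real_of_ereal (hitting_time X v \<omega>) \<ge> 0" for \<omega>
    by (simp add: real_of_ereal_pos)
  have f01: "0 \<le> f l \<omega>" "l > 0 \<Longrightarrow> f l \<omega> \<le> 1" for l \<omega>
    using T[of \<omega>] by (auto simp: f_def)
  \<comment> \<open>A non-integrable function would have Bochner integral 0, so positivity yields
    integrability, and with it measurability of \<open>f lam\<close>.\<close>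
  have int: "integrable (completion M) (f lam)"
    using pos not_integrable_integral_eq[of "completion M" "f lam"] by (force simp: hit)
  then have [measurable]: "f lam \<in> borel_measurable (completion M)" by simp
  \<comment> \<open>Measurability at rate \<mu> is inherited through a power; infinite hitting times
    fit in because \<open>0 powr _\<close> is 0.\<close>
  have "f \<mu> \<omega> = f lam \<omega> powr (\<mu> / lam)" for \<omega>
    using lam by (simp add: f_def powr_def)
  then have "f \<mu> = (\<lambda>\<omega>. f lam \<omega> powr (\<mu> / lam))" by auto
  then have [measurable]: "f \<mu> \<in> borel_measurable (completion M)" by simp
  have intmu: "integrable (completion M) (f \<mu>)"
    using f01[of \<mu>] mu by (intro C.integrable_const_bound[of _ 1]) auto
  have "n > 0" using mu lam by (cases n) auto
  have le: "1 + real n * (f lam \<omega> - 1) \<le> f \<mu> \<omega>" for \<omega>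
  proof -
    have "1 + real n * (f lam \<omega> - 1) \<le> (1 + (f lam \<omega> - 1)) ^ n"
      using f01[of lam \<omega>] by (intro Bernoulli_inequality) auto
    also have "\<dots> = f lam \<omega> ^ n" by simp
    also have "\<dots> \<le> f \<mu> \<omega>"
    proof (cases "hitting_time X v \<omega> = \<infinity>")
      case True
      then show ?thesis using \<open>n > 0\<close> by (simp add: f_def power_0_left)
    next
      case False
      have "\<mu> * real_of_ereal (hitting_time X v \<omega>) \<le> real n * lam * real_of_ereal (hitting_time X v \<omega>)"
        using T mu by (intro mult_right_mono) auto
      then show ?thesis using False by (simp add: f_def exp_of_nat_mult[symmetric] algebra_simps)
    qed
    finally show ?thesis .
  qed
  have "1 + real n * ((LINT \<omega>|completion M. f lam \<omega>) - 1) = (LINT \<omega>|completion M. 1 + real n * (f lam \<omega> - 1))"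
    using int C.prob_space by simp
  also have "\<dots> \<le> (LINT \<omega>|completion M. f \<mu> \<omega>)"
    using int intmu le by (intro integral_mono) auto
  finally show ?thesis by (simp add: hit algebra_simps)
qed

definition segment_integral :: "'a::euclidean_space \<Rightarrow> real \<Rightarrow> ('a \<Rightarrow> ennreal) \<Rightarrow> 'a \<Rightarrow> ennreal" where
  "segment_integral e r F x = (\<integral>\<^sup>+s\<in>{-r<..<r}. F (x + s *\<^sub>R e) \<partial>lborel)"

lemma segment_integral_measurable [measurable]:
  assumes [measurable]: "F \<in> borel_measurable borel"
  shows "segment_integral e r F \<in> borel_measurable borel"
  unfolding segment_integral_def by measurable

lemma segment_integral_shift:
  assumes [measurable]: "F \<in> borel_measurable borel" and "\<bar>a\<bar> + r \<le> r'"
  shows "segment_integral e r F x \<le> segment_integral e r' F (x + a *\<^sub>R e)"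
proof -
  have "segment_integral e r F x = (\<integral>\<^sup>+s. F (x + (a + s) *\<^sub>R e) * indicator {-r<..<r} (a + s) \<partial>lborel)"
    unfolding segment_integral_def by (subst nn_integral_real_affine[where c=1 and t=a]) auto
  also have "\<dots> \<le> segment_integral e r' F (x + a *\<^sub>R e)"
    unfolding segment_integral_def using assms(2)
    by (intro nn_integral_mono) (auto simp: indicator_def algebra_simps)
  finally show ?thesis .
qed

lemma segment_integral_mono: "r \<le> r' \<Longrightarrow> segment_integral e r F x \<le> segment_integral e r' F x"
  unfolding segment_integral_def by (intro nn_integral_mono) (auto simp: indicator_def)

text \<open>Fubini for the potential measure, whose translates commute with the shifts along
  \<open>e\<close>.\<close>

lemma occupation_segment:
  fixes X :: "real \<Rightarrow> 'w \<Rightarrow> 'a::euclidean_space"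
  assumes L: "levy_process M X" and lam: "lam > 0" and [measurable]: "F \<in> borel_measurable borel"
  shows "(\<integral>\<^sup>+s\<in>{-r<..<r}. occupation M X (discount lam) F (x + s *\<^sub>R e) \<partial>lborel)
     = occupation M X (discount lam) (segment_integral e r F) x"
proof -
  obtain U where U[measurable_cong, simp]: "sets U = sets borel"
    and occ: "\<And>F x. F \<in> borel_measurable borel \<Longrightarrow> (\<integral>\<^sup>+y. F (x + y) \<partial>U) = occupation M X (discount lam) F x"
    using occupation_measure[OF L discount_measurable, of lam] by blast
  have [simp]: "space U = UNIV" using sets_eq_imp_space_eq[OF U] by simp
  have "emeasure U UNIV = ennreal (1 / lam)"
    using occ[of "\<lambda>_. 1" 0] occupation_discount_finite[OF L lam, of 0] by simp
  then interpret finite_measure U by (intro finite_measureI) simp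
  interpret pair_sigma_finite lborel U ..
  have "(\<integral>\<^sup>+s\<in>{-r<..<r}. occupation M X (discount lam) F (x + s *\<^sub>R e) \<partial>lborel)
    = (\<integral>\<^sup>+s. (\<integral>\<^sup>+y. F (x + s *\<^sub>R e + y) * indicator {-r<..<r} s \<partial>U) \<partial>lborel)"
    by (subst occ[symmetric]) (auto simp: nn_integral_multc)
  also have "\<dots> = (\<integral>\<^sup>+y. (\<integral>\<^sup>+s. F (x + s *\<^sub>R e + y) * indicator {-r<..<r} s \<partial>lborel) \<partial>U)"
    by (rule Fubini'[symmetric]) measurable
  also have "\<dots> = (\<integral>\<^sup>+y. segment_integral e r F (x + y) \<partial>U)"
    unfolding segment_integral_def by (simp add: algebra_simps)
  also have "\<dots> = occupation M X (discount lam) (segment_integral e r F) x"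
    by (rule occ) measurable
  finally show ?thesis .
qed

lemma occupation_mono: "(\<And>x. F x \<le> G x) \<Longrightarrow> occupation M X w F x \<le> occupation M X w G x"
  unfolding occupation_def transition_def by (intro nn_integral_mono mult_right_mono mult_left_mono) auto

lemma occupation_const:
  fixes X :: "real \<Rightarrow> 'w \<Rightarrow> 'a::euclidean_space"
  assumes L: "levy_process M X" and lam: "lam > 0"
  shows "occupation M X (discount lam) (\<lambda>_. c) x = c * ennreal (1 / lam)"
proof -
  interpret prob_space M by (rule levy_processD[OF L])
  have "occupation M X (discount lam) (\<lambda>_. c) x = c * occupation M X (discount lam) (\<lambda>_. 1) x"
    unfolding occupation_def transition_def
    by (subst nn_integral_cmult[symmetric]) (auto simp: emeasure_space_1 mult_ac)
  then show ?thesis using occupation_discount_finite[OF L lam] by simp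
qed

text \<open>The hypothesis says that the potential of \<open>X\<close> changes little under small shifts along \<open>e\<close>;
  averaging over such shifts compares it with Lebesgue measure on the line.\<close>

lemma occupation_le_segment:
  fixes X :: "real \<Rightarrow> 'w \<Rightarrow> 'a::euclidean_space"
  assumes L: "levy_process M X" and lam: "lam > 0" and F[measurable]: "F \<in> borel_measurable borel" and "\<delta> > 0"
    and shift: "\<And>s x. \<bar>s\<bar> < \<delta> \<Longrightarrow> occupation M X (discount lam) F x \<le> 2 * occupation M X (discount lam) F (x + s *\<^sub>R e)"
  shows "occupation M X (discount lam) F x \<le> ennreal (1 / (lam * \<delta>)) * (SUP z. segment_integral e \<delta> F z)"
proof -
  let ?O = "occupation M X (discount lam)"
  have "ennreal (2 * \<delta>) * ?O F x = (\<integral>\<^sup>+s\<in>{-\<delta><..<\<delta>}. ?O F x \<partial>lborel)"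
    using \<open>\<delta> > 0\<close> by (subst nn_integral_cmult_indicator) (auto simp: mult.commute)
  also have "\<dots> \<le> (\<integral>\<^sup>+s\<in>{-\<delta><..<\<delta>}. 2 * ?O F (x + s *\<^sub>R e) \<partial>lborel)"
    using shift by (intro nn_integral_mono) (auto simp: indicator_def)
  also have "\<dots> = 2 * (\<integral>\<^sup>+s\<in>{-\<delta><..<\<delta>}. ?O F (x + s *\<^sub>R e) \<partial>lborel)"
    using occupation_measurable[OF L F discount_measurable, of lam]
    by (subst nn_integral_cmult[symmetric]) (auto simp: mult_ac)
  also have "\<dots> = 2 * ?O (segment_integral e \<delta> F) x"
    by (simp add: occupation_segment[OF L lam])
  \<comment> \<open>The potential of a constant is that constant divided by \<open>lam\<close>;
    together with the factor 2 and the length 2 * \<delta> this gives 1 / (lam * \<delta>).\<close>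
  also have "\<dots> \<le> 2 * ?O (\<lambda>_. SUP z. segment_integral e \<delta> F z) x"
    by (intro mult_left_mono occupation_mono SUP_upper) auto
  also have "\<dots> = 2 * ennreal (1 / lam) * (SUP z. segment_integral e \<delta> F z)"
    by (simp add: occupation_const[OF L lam] mult_ac)
  finally have "ennreal (1 / (2 * \<delta>)) * (ennreal (2 * \<delta>) * ?O F x)
      \<le> ennreal (1 / (2 * \<delta>)) * (2 * ennreal (1 / lam) * (SUP z. segment_integral e \<delta> F z))"
    by (rule mult_left_mono) simp
  also have "ennreal (1 / (2 * \<delta>)) * (ennreal (2 * \<delta>) * ?O F x) = ?O F x"
    using \<open>\<delta> > 0\<close> by (simp add: mult.assoc[symmetric] ennreal_mult[symmetric])
  also have "ennreal (1 / (2 * \<delta>)) * (2 * ennreal (1 / lam) * (SUP z. segment_integral e \<delta> F z))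
      = ennreal (1 / (2 * \<delta>) * (2 * (1 / lam))) * (SUP z. segment_integral e \<delta> F z)"
  proof -
    have "2 * ennreal (1 / lam) = ennreal (2 * (1 / lam))"
      using ennreal_mult'[of 2 "1 / lam"] by simp
    then show ?thesis
      using \<open>\<delta> > 0\<close> lam by (simp add: mult.assoc[symmetric] ennreal_mult[symmetric])
  qed
  also have "1 / (2 * \<delta>) * (2 * (1 / lam)) = 1 / (lam * \<delta>)" by (simp add: field_simps)
  finally show ?thesis .
qed

lemma transition_ball_tendsto:
  fixes X :: "real \<Rightarrow> 'w \<Rightarrow> 'a::euclidean_space"
  assumes L: "levy_process M X" and r: "r > 0"
  shows "((\<lambda>t. transition M X t (indicator (ball 0 r)) 0) \<longlongrightarrow> 1) (at_right 0)"
proof (rule tendsto_at_right_sequentially[of _ 1])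
  fix S :: "nat \<Rightarrow> real" assume S: "\<And>n. 0 < S n" "S \<longlonglongrightarrow> 0"
  interpret prob_space M by (rule levy_processD[OF L])
  have [measurable]: "X (S n) \<in> borel_measurable M" for n
    using levy_processD(2)[OF L] S(1)[of n] by simp
  have "(\<lambda>n. \<integral>\<^sup>+\<omega>. indicator (ball 0 r) (0 + X (S n) \<omega>) \<partial>M) \<longlonglongrightarrow> (\<integral>\<^sup>+\<omega>. 1 \<partial>M)"
  proof (rule nn_integral_dominated_convergence[where w="\<lambda>_. 1"])
    show "AE \<omega> in M. (\<lambda>n. indicator (ball 0 r) (0 + X (S n) \<omega>) :: ennreal) \<longlonglongrightarrow> 1"
      using levy_processD(3,5)[OF L]
    proof eventually_elim
      case (elim \<omega>)
      have "(\<lambda>n. X (S n) \<omega>) \<longlonglongrightarrow> 0"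
        using cadlag_sequentially[OF elim(2) order_refl S] elim(1) by simp
      then have "\<forall>\<^sub>F n in sequentially. X (S n) \<omega> \<in> ball 0 r"
        using r by (auto dest!: tendstoD[where e=r] simp: dist_commute)
      then have "\<forall>\<^sub>F n in sequentially. indicator (ball 0 r) (0 + X (S n) \<omega>) = (1 :: ennreal)"
        by eventually_elim simp
      then show ?case by (rule tendsto_eventually)
    qed
  qed (auto simp: indicator_def emeasure_space_1)
  then show "(\<lambda>n. transition M X (S n) (indicator (ball 0 r)) 0) \<longlonglongrightarrow> 1"
    by (simp add: transition_def emeasure_space_1)
qed simp

text \<open>Paths start at 0 and are right continuous, so short times already contribute. The value
  serves as the positive divisor in the lower comparison with segments.\<close>

lemma occupation_ball_pos:
  fixes X :: "real \<Rightarrow> 'w \<Rightarrow> 'a::euclidean_space"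
  assumes L: "levy_process M X" and r: "r > 0"
  shows "occupation M X (discount lam) (indicator (ball 0 r)) 0 > 0"
proof -
  have "\<forall>\<^sub>F t in at_right 0. transition M X t (indicator (ball 0 r)) 0 > ennreal (1/2)"
  proof (rule order_tendstoD[OF transition_ball_tendsto[OF L r]])
    show "ennreal (1/2) < 1" unfolding ennreal_1[symmetric] by (rule ennreal_lessI) auto
  qed
  then obtain b where b: "b > 0" "\<And>t. 0 < t \<Longrightarrow> t < b \<Longrightarrow> transition M X t (indicator (ball 0 r)) 0 > ennreal (1/2)"
    unfolding eventually_at_right_field by auto
  have "0 < ennreal (exp (- \<bar>lam\<bar> * b) * (1/2)) * emeasure lborel {0<..<b}"
    using b(1) by (simp add: ennreal_zero_less_mult_iff)
  also have "\<dots> = (\<integral>\<^sup>+u\<in>{0<..<b}. ennreal (exp (- \<bar>lam\<bar> * b) * (1/2)) \<partial>lborel)"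
    by (rule nn_integral_cmult_indicator[symmetric]) simp
  also have "\<dots> \<le> occupation M X (discount lam) (indicator (ball 0 r)) 0"
    unfolding occupation_def
  proof (rule nn_integral_mono)
    fix u :: real
    have "ennreal (exp (- \<bar>lam\<bar> * b) * (1/2)) \<le> discount lam u * transition M X u (indicator (ball 0 r)) 0"
      if "0 < u" "u < b"
    proof -
      have "lam * u \<le> \<bar>lam\<bar> * u" using that by (intro mult_right_mono) auto
      also have "\<dots> \<le> \<bar>lam\<bar> * b" using that by (intro mult_left_mono) auto
      finally show ?thesis
        unfolding ennreal_mult'[OF exp_ge_zero] discount_def using b(2)[OF that]
        by (intro mult_mono ennreal_leI) auto
    qed
    then show "ennreal (exp (- \<bar>lam\<bar> * b) * (1/2)) * indicator {0<..<b} u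
        \<le> discount lam u * transition M X u (indicator (ball 0 r)) 0 * indicator {0..} u"
      by (auto simp: indicator_def)
  qed
  finally show ?thesis .
qed

text \<open>If \<open>X u\<close> is \<open>a *\<^sub>R e\<close> with |a| < \<delta>/2, the segment
  of radius \<delta> around \<open>x + X u\<close> contains that of radius \<delta>/2 around
  \<open>x\<close>. Hence the left side is at most the potential of
  \<open>segment_integral e \<delta> F\<close>, which Fubini and the shift hypothesis bound by 4 *
  \<delta> times the potential of \<open>F\<close>.\<close>

lemma segment_le_occupation:
  fixes X :: "real \<Rightarrow> 'w \<Rightarrow> 'a::euclidean_space"
  assumes L: "levy_process M X" and lam: "lam > 0" and F[measurable]: "F \<in> borel_measurable borel" and "\<delta> > 0"
    and shift: "\<And>s x. \<bar>s\<bar> < \<delta> \<Longrightarrow> occupation M X (discount lam) F (x + s *\<^sub>R e) \<le> 2 * occupation M X (discount lam) F x"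
    and line: "\<And>t. t \<ge> 0 \<Longrightarrow> AE \<omega> in M. X t \<omega> \<in> range (\<lambda>s. s *\<^sub>R e)" and e: "norm e = 1"
  shows "occupation M X (discount lam) (indicator (ball 0 (\<delta>/2))) 0 * segment_integral e (\<delta>/2) F x
     \<le> ennreal (4 * \<delta>) * occupation M X (discount lam) F x"
proof -
  let ?O = "occupation M X (discount lam)"
  interpret prob_space M by (rule levy_processD[OF L])
  have ball[measurable]: "(indicator (ball 0 (\<delta>/2)) :: 'a \<Rightarrow> ennreal) \<in> borel_measurable borel"
    by (auto intro!: borel_measurable_indicator)
  have "?O (indicator (ball 0 (\<delta>/2))) 0 * segment_integral e (\<delta>/2) F x
      \<le> ?O (segment_integral e \<delta> F) x"
    unfolding occupation_max
  proof (subst nn_integral_multc[symmetric])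
    have "(\<lambda>(u, x). transition M X (max u 0) (indicator (ball 0 (\<delta>/2))) x) \<in> borel_measurable (borel \<Otimes>\<^sub>M borel)"
      by (rule transition_measurable[OF L ball])
    from measurable_compose[OF measurable_Pair2' this, of 0]
    have [measurable]: "(\<lambda>u. transition M X (max u 0) (indicator (ball 0 (\<delta>/2))) 0) \<in> borel_measurable borel"
      by simp
    show "(\<lambda>u. discount lam u * transition M X (max u 0) (indicator (ball 0 (\<delta>/2))) 0 * indicator {0..} u) \<in> borel_measurable lborel"
      by measurable
    show "(\<integral>\<^sup>+u. discount lam u * transition M X (max u 0) (indicator (ball 0 (\<delta>/2))) 0 * indicator {0..} u
        * segment_integral e (\<delta>/2) F x \<partial>lborel)
      \<le> (\<integral>\<^sup>+u\<in>{0..}. discount lam u * transition M X (max u 0) (segment_integral e \<delta> F) x \<partial>lborel)"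
    proof (rule nn_integral_mono)
      fix u :: real
      have [measurable]: "X (max u 0) \<in> borel_measurable M" using levy_processD(2)[OF L] by simp
      have "transition M X (max u 0) (indicator (ball 0 (\<delta>/2))) 0 * segment_integral e (\<delta>/2) F x
         = (\<integral>\<^sup>+\<omega>. indicator (ball 0 (\<delta>/2)) (X (max u 0) \<omega>) * segment_integral e (\<delta>/2) F x \<partial>M)"
        unfolding transition_def by (subst nn_integral_multc) auto
      also have "\<dots> \<le> transition M X (max u 0) (segment_integral e \<delta> F) x"
        unfolding transition_def
      proof (rule nn_integral_mono_AE)
        have "AE \<omega> in M. X (max u 0) \<omega> \<in> range (\<lambda>s. s *\<^sub>R e)" by (rule line) simp
        then show "AE \<omega> in M. indicator (ball 0 (\<delta>/2)) (X (max u 0) \<omega>) * segment_integral e (\<delta>/2) F x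
            \<le> segment_integral e \<delta> F (x + X (max u 0) \<omega>)"
        proof eventually_elim
          case (elim \<omega>)
          then obtain a where a: "X (max u 0) \<omega> = a *\<^sub>R e" by auto
          have "segment_integral e (\<delta>/2) F x \<le> segment_integral e \<delta> F (x + a *\<^sub>R e)" if "\<bar>a\<bar> < \<delta> / 2"
            using that by (intro segment_integral_shift) auto
          then show ?case using e by (auto simp: a indicator_def dist_norm)
        qed
      qed
      finally have "discount lam u * indicator {0..} u *
          (transition M X (max u 0) (indicator (ball 0 (\<delta>/2))) 0 * segment_integral e (\<delta>/2) F x)
        \<le> discount lam u * indicator {0..} u * transition M X (max u 0) (segment_integral e \<delta> F) x"
        by (rule mult_left_mono) simp
      then show "discount lam u * transition M X (max u 0) (indicator (ball 0 (\<delta>/2))) 0 * indicator {0..} u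
        * segment_integral e (\<delta>/2) F x
        \<le> discount lam u * transition M X (max u 0) (segment_integral e \<delta> F) x * indicator {0..} u"
        by (simp add: mult_ac)
    qed
  qed
  also have "\<dots> = (\<integral>\<^sup>+s\<in>{-\<delta><..<\<delta>}. ?O F (x + s *\<^sub>R e) \<partial>lborel)"
    by (simp add: occupation_segment[OF L lam])
  also have "\<dots> \<le> (\<integral>\<^sup>+s\<in>{-\<delta><..<\<delta>}. 2 * ?O F x \<partial>lborel)"
    using shift by (intro nn_integral_mono) (auto simp: indicator_def)
  also have "\<dots> = 2 * ?O F x * ennreal (2 * \<delta>)"
    using \<open>\<delta> > 0\<close> by (subst nn_integral_cmult_indicator) auto
  also have "\<dots> = ennreal (4 * \<delta>) * ?O F x"
  proof -
    have "ennreal (4 * \<delta>) = 2 * ennreal (2 * \<delta>)"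
      using \<open>\<delta> > 0\<close> by (simp add: ennreal_mult'[symmetric] flip: ennreal_numeral)
    then show ?thesis by (simp add: mult_ac)
  qed
  finally show ?thesis .
qed


section \<open>Markov property and occupation up to a small time\<close>

lemma occupation_integral:
  fixes X :: "real \<Rightarrow> 'w \<Rightarrow> 'a::euclidean_space"
  assumes L: "levy_process M X" and N: "sigma_finite_measure N"
    and [measurable]: "F \<in> borel_measurable borel" "w \<in> borel_measurable borel" "f \<in> borel_measurable N"
  shows "(\<integral>\<^sup>+\<omega>. occupation M X w F (f \<omega>) \<partial>N)
    = (\<integral>\<^sup>+u\<in>{0..}. w u * (\<integral>\<^sup>+\<omega>. transition M X u F (f \<omega>) \<partial>N) \<partial>lborel)"
proof -
  interpret N: sigma_finite_measure N by fact
  interpret pair_sigma_finite lborel N ..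
  note [measurable] = transition_measurable[OF L \<open>F \<in> borel_measurable borel\<close>]
  have "(\<integral>\<^sup>+\<omega>. occupation M X w F (f \<omega>) \<partial>N)
      = (\<integral>\<^sup>+u. (\<integral>\<^sup>+\<omega>. w u * transition M X (max u 0) F (f \<omega>) * indicator {0..} u \<partial>N) \<partial>lborel)"
    unfolding occupation_max by (rule Fubini') measurable
  also have "\<dots> = (\<integral>\<^sup>+u\<in>{0..}. w u * (\<integral>\<^sup>+\<omega>. transition M X (max u 0) F (f \<omega>) \<partial>N) \<partial>lborel)"
    by (simp add: nn_integral_multc nn_integral_cmult)
  also have "\<dots> = (\<integral>\<^sup>+u\<in>{0..}. w u * (\<integral>\<^sup>+\<omega>. transition M X u F (f \<omega>) \<partial>N) \<partial>lborel)"
    by (intro nn_integral_cong) (auto simp: indicator_def)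
  finally show ?thesis .
qed

lemma occupation_markov:
  fixes X :: "real \<Rightarrow> 'w \<Rightarrow> 'a::euclidean_space"
  assumes L: "levy_process M X" and F[measurable]: "F \<in> borel_measurable borel"
    and [measurable]: "w \<in> borel_measurable borel" and t: "t \<ge> 0"
  shows "(\<integral>\<^sup>+u\<in>{t..}. w u * transition M X u F x \<partial>lborel)
    = (\<integral>\<^sup>+\<omega>. occupation M X (\<lambda>u. w (t + u)) F (x + X t \<omega>) \<partial>M)"
proof -
  note lp = levy_processD[OF L]
  interpret prob_space M by (rule lp)
  have [measurable]: "X t \<in> borel_measurable M" using lp(2) t .
  have "(\<lambda>u. transition M X (max u 0) F x) \<in> borel_measurable borel"
    using measurable_compose[OF measurable_Pair2' transition_measurable[OF L F], of x] by simp
  note [measurable] = this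
  have "(\<integral>\<^sup>+u\<in>{t..}. w u * transition M X u F x \<partial>lborel)
      = (\<integral>\<^sup>+u\<in>{t..}. w u * transition M X (max u 0) F x \<partial>lborel)"
    using t by (intro nn_integral_cong) (auto simp: indicator_def)
  also have "\<dots> = (\<integral>\<^sup>+u\<in>{0..}. w (t + u) * transition M X (max (t + u) 0) F x \<partial>lborel)"
    by (rule nn_integral_shift_atLeast) measurable
  also have "\<dots> = (\<integral>\<^sup>+u\<in>{0..}. w (t + u) * (\<integral>\<^sup>+\<omega>. transition M X u F (x + X t \<omega>) \<partial>M) \<partial>lborel)"
    using t by (intro nn_integral_cong) (auto simp: indicator_def transition_add[OF L F])
  also have "\<dots> = (\<integral>\<^sup>+\<omega>. occupation M X (\<lambda>u. w (t + u)) F (x + X t \<omega>) \<partial>M)"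
    by (rule occupation_integral[OF L sigma_finite_measure_axioms, symmetric]) measurable
  finally show ?thesis .
qed

lemma suminf_discount:
  assumes "lam > 0" "t > 0"
  shows "(\<Sum>k. discount lam (real k * t)) = ennreal (1 / (1 - exp (- lam * t)))"
proof -
  have "(\<lambda>k. exp (- lam * t) ^ k) sums (1 / (1 - exp (- lam * t)))"
    using assms by (intro geometric_sums) auto
  moreover have "exp (- lam * t) ^ k = exp (- lam * (real k * t))" for k
    by (simp add: exp_of_nat_mult[symmetric] algebra_simps)
  ultimately show ?thesis
    unfolding discount_def by (intro suminf_ennreal_eq) auto
qed

text \<open>Time is cut into blocks of length \<open>t\<close>. The Markov property at the start of
  block \<open>k\<close> bounds its undiscounted occupation by the supremum, and the discounts at
  the block starts form a geometric series. In this way occupation up to a single time controls the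
  whole potential.\<close>

lemma occupation_le_block:
  fixes X :: "real \<Rightarrow> 'w \<Rightarrow> 'a::euclidean_space"
  assumes L: "levy_process M X" and F[measurable]: "F \<in> borel_measurable borel"
    and lam: "lam > 0" and t: "t > 0"
  shows "occupation M X (discount lam) F x
    \<le> ennreal (1 / (1 - exp (- lam * t))) * (SUP y. occupation M X (indicator {..t}) F y)"
proof -
  define S where "S = (SUP y. occupation M X (indicator {..t}) F y)"
  interpret prob_space M by (rule levy_processD[OF L])
  have "(\<lambda>u. transition M X (max u 0) F x) \<in> borel_measurable borel"
    using measurable_compose[OF measurable_Pair2' transition_measurable[OF L F], of x] by simp
  note [measurable] = this
  \<comment> \<open>The blocks are closed and share endpoints, which does no harm in an upper
    bound.\<close>
  define g where "g k u = discount lam (real k * t) *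
      (indicator {..real k * t + t} u * transition M X (max u 0) F x * indicator {real k * t..} u)" for k u
  have [measurable]: "g k \<in> borel_measurable borel" for k
    unfolding g_def by measurable
  have "occupation M X (discount lam) F x \<le> (\<integral>\<^sup>+u. (\<Sum>k. g k u) \<partial>lborel)"
    unfolding occupation_max
  proof (rule nn_integral_mono)
    fix u :: real
    show "discount lam u * transition M X (max u 0) F x * indicator {0..} u \<le> (\<Sum>k. g k u)"
    proof (cases "u \<ge> 0")
      case True
      define k where "k = nat \<lfloor>u / t\<rfloor>"
      have "real k \<le> u / t" "u / t < real k + 1"
        using True t by (auto simp: k_def)
      then have k: "real k * t \<le> u" "u \<le> real k * t + t"
        using t by (auto simp: field_simps)
      then have "discount lam u \<le> discount lam (real k * t)"
        using lam unfolding discount_def by (intro ennreal_leI) auto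
      then have "discount lam u * transition M X (max u 0) F x * indicator {0..} u \<le> g k u"
        using k True by (auto simp: g_def intro!: mult_right_mono)
      also have "\<dots> \<le> (\<Sum>k. g k u)"
        using sum_le_suminf[of "\<lambda>k. g k u" "{k}"] by simp
      finally show ?thesis .
    qed simp
  qed
  also have "\<dots> = (\<Sum>k. \<integral>\<^sup>+u. g k u \<partial>lborel)"
    by (rule nn_integral_suminf) measurable
  also have "\<dots> \<le> (\<Sum>k. discount lam (real k * t) * S)"
  proof (intro suminf_le summableI)
    fix k
    have "(\<integral>\<^sup>+u. g k u \<partial>lborel) = discount lam (real k * t) *
        (\<integral>\<^sup>+u\<in>{real k * t..}. indicator {..real k * t + t} u * transition M X (max u 0) F x \<partial>lborel)"
      unfolding g_def by (rule nn_integral_cmult) measurable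
    also have "(\<integral>\<^sup>+u\<in>{real k * t..}. indicator {..real k * t + t} u * transition M X (max u 0) F x \<partial>lborel)
        = (\<integral>\<^sup>+u\<in>{real k * t..}. indicator {..real k * t + t} u * transition M X u F x \<partial>lborel)"
    proof (rule nn_integral_cong)
      fix u :: real
      have "real k * t \<ge> 0" using t by simp
      then show "indicator {..real k * t + t} u * transition M X (max u 0) F x * indicator {real k * t..} u
          = indicator {..real k * t + t} u * transition M X u F x * indicator {real k * t..} u"
        by (cases "real k * t \<le> u") (auto simp: max_absorb1)
    qed
    also have "\<dots> = (\<integral>\<^sup>+\<omega>. occupation M X (\<lambda>u. indicator {..real k * t + t} (real k * t + u)) F (x + X (real k * t) \<omega>) \<partial>M)"
      using t by (intro occupation_markov[OF L F]) auto
    also have "(\<lambda>u. indicator {..real k * t + t} (real k * t + u)) = (indicator {..t} :: real \<Rightarrow> ennreal)"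
      by (auto simp: indicator_def)
    also have "(\<integral>\<^sup>+\<omega>. occupation M X (indicator {..t}) F (x + X (real k * t) \<omega>) \<partial>M) \<le> (\<integral>\<^sup>+\<omega>. S \<partial>M)"
      unfolding S_def by (intro nn_integral_mono SUP_upper) auto
    also have "\<dots> = S" by (simp add: emeasure_space_1)
    finally show "(\<integral>\<^sup>+u. g k u \<partial>lborel) \<le> discount lam (real k * t) * S"
      by (simp add: mult_left_mono)
  qed
  also have "\<dots> = ennreal (1 / (1 - exp (- lam * t))) * S"
    by (simp only: ennreal_suminf_multc suminf_discount[OF lam t])
  finally show ?thesis by (simp add: S_def)
qed

text \<open>By the Markov property at time \<open>t\<close> the potential after \<open>t\<close> is an average of shifts of the
  whole potential, nearly all of them small, so that little is left for the time before \<open>t\<close>.\<close>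

lemma occupation_small_time:
  fixes X :: "real \<Rightarrow> 'w \<Rightarrow> 'a::euclidean_space"
  assumes L: "levy_process M X" and lam: "lam > 0" and \<kappa>: "0 < \<kappa>" "\<kappa> < 1" and "\<delta> > 0"
    and line: "\<And>t. t \<ge> 0 \<Longrightarrow> AE \<omega> in M. X t \<omega> \<in> range (\<lambda>s. s *\<^sub>R e)" and e: "norm e = 1"
  obtains t0 where "t0 > 0"
    and "\<And>F t x. F \<in> borel_measurable borel \<Longrightarrow> 0 < t \<Longrightarrow> t < t0 \<Longrightarrow>
        (\<And>s x. \<bar>s\<bar> < \<delta> \<Longrightarrow> ennreal \<kappa> * occupation M X (discount lam) F x \<le> occupation M X (discount lam) F (x + s *\<^sub>R e)) \<Longrightarrow>
        occupation M X (indicator {..t}) F x \<le> ennreal (2 * (1 - \<kappa>^3)) * occupation M X (discount lam) F x"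
proof -
  interpret prob_space M by (rule levy_processD[OF L])
  let ?O = "occupation M X (discount lam)"
  have "((\<lambda>t. exp (- lam * t)) \<longlongrightarrow> exp (- lam * 0)) (at_right 0)"
    by (intro tendsto_intros)
  \<comment> \<open>The bound \<kappa> is for the discount of the part after \<open>t\<close>; the
    bound 1/2 lets the discount before \<open>t\<close> be removed at the price of a factor
    2.\<close>
  then have ev1: "\<forall>\<^sub>F t in at_right 0. exp (- lam * t) > max \<kappa> (1/2)"
    by (rule order_tendstoD) (use \<kappa> in auto)
  have ev2: "\<forall>\<^sub>F t in at_right 0. transition M X t (indicator (ball 0 \<delta>)) 0 > ennreal \<kappa>"
  proof (rule order_tendstoD[OF transition_ball_tendsto[OF L \<open>\<delta> > 0\<close>]])
    show "ennreal \<kappa> < 1" unfolding ennreal_1[symmetric] using \<kappa> by (intro ennreal_lessI) auto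
  qed
  obtain t0 where t0: "t0 > 0" "\<And>t. 0 < t \<Longrightarrow> t < t0 \<Longrightarrow> exp (- lam * t) > max \<kappa> (1/2)"
    "\<And>t. 0 < t \<Longrightarrow> t < t0 \<Longrightarrow> transition M X t (indicator (ball 0 \<delta>)) 0 > ennreal \<kappa>"
    using eventually_conj[OF ev1 ev2] unfolding eventually_at_right_field by auto
  have "occupation M X (indicator {..t}) F x \<le> ennreal (2 * (1 - \<kappa>^3)) * ?O F x"
    if F[measurable]: "F \<in> borel_measurable borel" and t: "0 < t" "t < t0"
      and shift: "\<And>s x. \<bar>s\<bar> < \<delta> \<Longrightarrow> ennreal \<kappa> * ?O F x \<le> ?O F (x + s *\<^sub>R e)" for F t x
  \<comment> \<open>An infinite potential makes the bound trivial, as 1 - \<kappa>^3 > 0; a finite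
    one can be subtracted from.\<close>
  proof (cases "?O F x = top")
    case True
    have "\<kappa>^3 < 1" using \<kappa> power_Suc_less_one[of \<kappa> 2] by (simp add: numeral_3_eq_3)
    then show ?thesis using True by (simp add: ennreal_mult_top)
  next
    case False
    have Xt[measurable]: "X t \<in> borel_measurable M" using levy_processD(2)[OF L] t by simp
    have "(\<lambda>u. transition M X (max u 0) F x) \<in> borel_measurable borel"
      using measurable_compose[OF measurable_Pair2' transition_measurable[OF L F], of x] by simp
    note [measurable] = this occupation_measurable[OF L F discount_measurable, of lam]
    define A where "A = (\<integral>\<^sup>+u. discount lam u * transition M X (max u 0) F x * indicator {0..<t} u \<partial>lborel)"
    define B where "B = (\<integral>\<^sup>+u\<in>{t..}. discount lam u * transition M X u F x \<partial>lborel)"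
    have "B = (\<integral>\<^sup>+u\<in>{t..}. discount lam u * transition M X (max u 0) F x \<partial>lborel)"
      unfolding B_def using t by (intro nn_integral_cong) (auto simp: indicator_def)
    then have B_max: "B = (\<integral>\<^sup>+u. discount lam u * transition M X (max u 0) F x * indicator {t..} u \<partial>lborel)" .
    have AB: "?O F x = A + B"
      unfolding occupation_max A_def B_max using t
      by (subst nn_integral_add[symmetric]) (auto intro!: nn_integral_cong simp: indicator_def)
    have tr: "transition M X t (indicator (ball 0 \<delta>)) 0 = (\<integral>\<^sup>+\<omega>. indicator (ball 0 \<delta>) (X t \<omega>) \<partial>M)"
      by (simp add: transition_def)
    have ball[measurable]: "(indicator (ball 0 \<delta>) :: 'a \<Rightarrow> ennreal) \<in> borel_measurable borel"
      by (auto intro!: borel_measurable_indicator)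
    have "B = discount lam t * (\<integral>\<^sup>+\<omega>. ?O F (x + X t \<omega>) \<partial>M)"
    proof -
      have "occupation M X (\<lambda>u. discount lam (t + u)) F y = discount lam t * ?O F y" for y
      proof -
        have "(\<lambda>u. transition M X (max u 0) F y) \<in> borel_measurable borel"
          using measurable_compose[OF measurable_Pair2' transition_measurable[OF L F], of y] by simp
        note [measurable] = this
        show ?thesis unfolding occupation_max discount_add
          by (subst nn_integral_cmult[symmetric]) (auto intro!: nn_integral_cong simp: mult_ac)
      qed
      then show ?thesis
        unfolding B_def using t by (subst occupation_markov[OF L F]) (auto simp: nn_integral_cmult)
    qed
    moreover have "ennreal \<kappa> \<le> discount lam t"
      using t0(2)[OF t] unfolding discount_def by (intro ennreal_leI) auto
    moreover have "ennreal \<kappa> * (ennreal \<kappa> * ?O F x) \<le> (\<integral>\<^sup>+\<omega>. ?O F (x + X t \<omega>) \<partial>M)"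
    proof -
      have "ennreal \<kappa> * (ennreal \<kappa> * ?O F x) \<le> transition M X t (indicator (ball 0 \<delta>)) 0 * (ennreal \<kappa> * ?O F x)"
        using t0(3)[OF t] by (intro mult_right_mono) auto
      also have "\<dots> = (\<integral>\<^sup>+\<omega>. indicator (ball 0 \<delta>) (X t \<omega>) * (ennreal \<kappa> * ?O F x) \<partial>M)"
        unfolding tr by (rule nn_integral_multc[symmetric]) (rule measurable_compose[OF Xt ball])
      also have "\<dots> \<le> (\<integral>\<^sup>+\<omega>. ?O F (x + X t \<omega>) \<partial>M)"
      proof (rule nn_integral_mono_AE)
        have "AE \<omega> in M. X t \<omega> \<in> range (\<lambda>s. s *\<^sub>R e)" using line t by simp
        then show "AE \<omega> in M. indicator (ball 0 \<delta>) (X t \<omega>) * (ennreal \<kappa> * ?O F x) \<le> ?O F (x + X t \<omega>)"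
        proof eventually_elim
          case (elim \<omega>)
          then obtain a where "X t \<omega> = a *\<^sub>R e" by auto
          then show ?case using e shift[of a x] by (auto simp: indicator_def dist_norm)
        qed
      qed
      finally show ?thesis .
    qed
    \<comment> \<open>Three losses of \<kappa>: the discount at \<open>t\<close>, the probability
      that \<open>X t\<close> lies within \<delta> of 0, and the shift of the potential.\<close>
    ultimately have "ennreal \<kappa> * (ennreal \<kappa> * (ennreal \<kappa> * ?O F x)) \<le> B"
      by (simp add: mult_mono)
    then have B: "ennreal (\<kappa>^3) * ?O F x \<le> B"
      using \<kappa> by (simp add: power3_eq_cube ennreal_mult mult_ac)
    obtain p where p: "?O F x = ennreal p" "p \<ge> 0" using False by (cases "?O F x") auto
    obtain a where a: "A = ennreal a" "a \<ge> 0" using False AB by (cases A) auto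
    obtain b where b: "B = ennreal b" "b \<ge> 0" using False AB by (cases B) auto
    have "p = a + b" using AB p a b by (simp flip: ennreal_plus)
    moreover have "\<kappa>^3 * p \<le> b" using B p b \<kappa> by (simp flip: ennreal_mult)
    ultimately have "2 * a \<le> 2 * (1 - \<kappa>^3) * p" by (simp add: algebra_simps)
    then have "ennreal 2 * A \<le> ennreal (2 * (1 - \<kappa>^3)) * ?O F x"
      unfolding p a using p a \<kappa> by (simp add: ennreal_mult'[symmetric] power_le_one del: ennreal_numeral)
    moreover have "occupation M X (indicator {..t}) F x \<le> ennreal 2 * A"
    proof -
      have "occupation M X (indicator {..t}) F x
          = (\<integral>\<^sup>+u. transition M X (max u 0) F x * indicator {0..t} u \<partial>lborel)"
        unfolding occupation_max by (intro nn_integral_cong) (auto simp: indicator_def)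
      also have "\<dots> = (\<integral>\<^sup>+u. transition M X (max u 0) F x * indicator {0..<t} u \<partial>lborel)"
        using AE_lborel_singleton[of t] by (intro nn_integral_cong_AE) (auto simp: indicator_def elim!: eventually_mono)
      also have "\<dots> \<le> (\<integral>\<^sup>+u. ennreal 2 * (discount lam u * transition M X (max u 0) F x * indicator {0..<t} u) \<partial>lborel)"
      proof (rule nn_integral_mono)
        fix u :: real
        have "1 \<le> ennreal 2 * discount lam u" if "u < t"
        proof -
          have "1 \<le> 2 * exp (- lam * t)" using t0(2)[OF t] by simp
          also have "\<dots> \<le> 2 * exp (- lam * u)" using that lam by simp
          finally show ?thesis unfolding discount_def
            by (subst ennreal_mult[symmetric]) (auto simp flip: ennreal_1 intro!: ennreal_leI)
        qed
        then show "transition M X (max u 0) F x * indicator {0..<t} u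
          \<le> ennreal 2 * (discount lam u * transition M X (max u 0) F x * indicator {0..<t} u)"
          using mult_right_mono[of 1 "ennreal 2 * discount lam u" "transition M X (max u 0) F x"]
          by (auto simp: indicator_def mult_ac)
      qed
      also have "\<dots> = ennreal 2 * A" unfolding A_def by (rule nn_integral_cmult) measurable
      finally show ?thesis .
    qed
    ultimately show ?thesis by (rule order_trans[rotated])
  qed
  with t0(1) show ?thesis by (rule that)
qed

subsection \<open>Holding probabilities of compound Poisson processes\<close>

lemma cis_measurable [measurable]: "cis \<in> borel_measurable borel"
  by (intro borel_measurable_continuous_onI continuous_intros)

text \<open>A Gaussian average turns a characteristic function into an expectation of exp (- |y|^2 /
  2), which concentrates at \<open>y = 0\<close> after scaling; this detects an atom at 0. The
  measure is a product of standard normal distributions.\<close>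

lemma gaussian_measure:
  obtains \<Gamma> :: "'a::euclidean_space measure" where "prob_space \<Gamma>" "sets \<Gamma> = sets borel"
    and "\<And>y. (LINT x|\<Gamma>. cis (x \<bullet> y)) = complex_of_real (exp (- (norm y)\<^sup>2 / 2))"
proof -
  let ?P = "Pi\<^sub>M Basis (\<lambda>_. std_normal_distribution) :: ('a \<Rightarrow> real) measure"
  interpret N: prob_space std_normal_distribution by (rule real_dist_normal_dist[THEN real_distribution.axioms(1)])
  interpret P: product_prob_space "\<lambda>_. std_normal_distribution" "Basis :: 'a set" ..
  define T where "T f = (\<Sum>b\<in>Basis. f b *\<^sub>R b)" for f :: "'a \<Rightarrow> real"
  have T[measurable]: "T \<in> borel_measurable ?P"
    unfolding T_def by measurable
  have "(LINT x|distr ?P borel T. cis (x \<bullet> y)) = complex_of_real (exp (- (norm y)\<^sup>2 / 2))" for y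
  proof -
    have cis_sum: "cis (\<Sum>b\<in>B. g b) = (\<Prod>b\<in>B. cis (g b))" if "finite B" for B :: "'a set" and g
      using that by (induction B) (auto simp: cis_mult[symmetric])
    have "(LINT x|distr ?P borel T. cis (x \<bullet> y)) = (LINT f|?P. cis (T f \<bullet> y))"
      by (rule integral_distr) measurable
    also have "\<dots> = (LINT f|?P. (\<Prod>b\<in>Basis. cis (f b * (b \<bullet> y))))"
      by (simp add: T_def inner_sum_left cis_sum)
    also have "\<dots> = (\<Prod>b\<in>Basis. LINT s|std_normal_distribution. cis (s * (b \<bullet> y)))"
      by (rule P.product_integral_prod)
         (auto intro!: N.integrable_const_bound[of _ 1])
    also have "\<dots> = (\<Prod>b\<in>Basis. complex_of_real (exp (- (b \<bullet> y)\<^sup>2 / 2)))"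
    proof (rule prod.cong[OF refl])
      fix b :: 'a
      have "(LINT s|std_normal_distribution. cis (s * (b \<bullet> y))) = char std_normal_distribution (b \<bullet> y)"
        by (simp add: char_def cis_conv_exp mult_ac)
      then show "(LINT s|std_normal_distribution. cis (s * (b \<bullet> y))) = complex_of_real (exp (- (b \<bullet> y)\<^sup>2 / 2))"
        by (simp add: char_std_normal_distribution)
    qed
    also have "\<dots> = complex_of_real (exp (\<Sum>b\<in>Basis. - (b \<bullet> y)\<^sup>2 / 2))"
      by (simp add: exp_sum)
    also have "(\<Sum>b\<in>Basis. - (b \<bullet> y)\<^sup>2 / 2) = - (norm y)\<^sup>2 / 2"
      unfolding power2_norm_eq_inner euclidean_inner[of y y]
      by (simp add: sum_negf sum_divide_distrib power2_eq_square inner_commute)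
    finally show ?thesis .
  qed
  moreover have "prob_space (distr ?P borel T)" by (rule P.prob_space_distr) measurable
  ultimately show ?thesis by (intro that[of "distr ?P borel T"]) auto
qed

lemma norm_integral_cis_le:
  assumes "finite_measure \<nu>" "sets \<nu> = sets borel"
  shows "norm (LINT z|\<nu>. cis (x \<bullet> z)) \<le> measure \<nu> UNIV"
proof -
  interpret finite_measure \<nu> by fact
  have "norm (LINT z|\<nu>. cis (x \<bullet> z)) \<le> (LINT z|\<nu>. norm (cis (x \<bullet> z)))"
    by (rule integral_norm_bound)
  also have "\<dots> = measure \<nu> UNIV"
    using sets_eq_imp_space_eq[OF assms(2)] by simp
  finally show ?thesis .
qed

text \<open>The powers of the Fourier transform of \<open>\<nu>\<close> are those of the convolution powers of \<open>\<nu>\<close>,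
  hence positive definite; integrating out one factor at a time avoids the convolutions.\<close>

lemma gaussian_average_power_nonneg:
  fixes \<Gamma> \<nu> :: "'a::euclidean_space measure"
  assumes \<Gamma>: "prob_space \<Gamma>" "sets \<Gamma> = sets borel"
    and gauss: "\<And>y. (LINT x|\<Gamma>. cis (x \<bullet> y)) = complex_of_real (exp (- (norm y)\<^sup>2 / 2))"
    and \<nu>: "finite_measure \<nu>" "sets \<nu> = sets borel"
  shows "\<exists>r\<ge>0. (LINT x|\<Gamma>. (LINT z|\<nu>. cis ((\<sigma> *\<^sub>R x) \<bullet> z)) ^ n * cis (x \<bullet> w)) = complex_of_real r"
\<comment> \<open>The argument \<open>w\<close> must vary: integrating out one factor replaces it by
  \<open>w + \<sigma> *\<^sub>R z\<close>.\<close>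
proof (induction n arbitrary: w)
  case 0
  show ?case by (intro exI[of _ "exp (- (norm w)\<^sup>2 / 2)"]) (simp add: gauss)
next
  case (Suc n)
  interpret \<Gamma>: prob_space \<Gamma> by fact
  interpret \<nu>: finite_measure \<nu> by fact
  interpret P: pair_sigma_finite \<nu> \<Gamma> ..
  note [measurable_cong] = \<Gamma>(2) \<nu>(2)
  define \<phi> where "\<phi> x = (LINT z|\<nu>. cis ((\<sigma> *\<^sub>R x) \<bullet> z))" for x
  have [measurable]: "\<phi> \<in> borel_measurable borel" unfolding \<phi>_def by measurable
  have \<phi>_le: "norm (\<phi> x) \<le> measure \<nu> UNIV" for x
    unfolding \<phi>_def by (rule norm_integral_cis_le[OF \<nu>])
  have int: "integrable (\<nu> \<Otimes>\<^sub>M \<Gamma>) (\<lambda>(z, x). \<phi> x ^ n * cis (x \<bullet> (w + \<sigma> *\<^sub>R z)))"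
  proof (rule finite_measure.integrable_const_bound[of _ _ "measure \<nu> UNIV ^ n"])
    show "finite_measure (\<nu> \<Otimes>\<^sub>M \<Gamma>)"
      by (rule finite_measure_pair_measure) unfold_locales
  qed (auto simp: norm_mult norm_power split_beta intro!: power_mono \<phi>_le)
  obtain r where r: "\<And>w. r w \<ge> 0" "\<And>w. (LINT x|\<Gamma>. \<phi> x ^ n * cis (x \<bullet> w)) = complex_of_real (r w)"
    using Suc.IH unfolding \<phi>_def by metis
  have "(LINT x|\<Gamma>. \<phi> x ^ Suc n * cis (x \<bullet> w)) = (LINT x|\<Gamma>. (LINT z|\<nu>. \<phi> x ^ n * cis (x \<bullet> (w + \<sigma> *\<^sub>R z))))"
  proof (rule Bochner_Integration.integral_cong[OF refl])
    fix x
    have "(LINT z|\<nu>. \<phi> x ^ n * cis (x \<bullet> (w + \<sigma> *\<^sub>R z)))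
        = (LINT z|\<nu>. (\<phi> x ^ n * cis (x \<bullet> w)) * cis ((\<sigma> *\<^sub>R x) \<bullet> z))"
      by (simp add: inner_add_right cis_mult[symmetric] mult_ac)
    also have "\<dots> = (\<phi> x ^ n * cis (x \<bullet> w)) * \<phi> x"
      unfolding \<phi>_def by (rule integral_mult_right_zero)
    finally have eq: "(LINT z|\<nu>. \<phi> x ^ n * cis (x \<bullet> (w + \<sigma> *\<^sub>R z))) = (\<phi> x ^ n * cis (x \<bullet> w)) * \<phi> x" .
    show "\<phi> x ^ Suc n * cis (x \<bullet> w) = (LINT z|\<nu>. \<phi> x ^ n * cis (x \<bullet> (w + \<sigma> *\<^sub>R z)))"
      unfolding eq by (simp only: power_Suc mult_ac)
  qed
  also have "\<dots> = (LINT z|\<nu>. (LINT x|\<Gamma>. \<phi> x ^ n * cis (x \<bullet> (w + \<sigma> *\<^sub>R z))))"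
    using P.Fubini_integral[OF int] by simp
  also have "\<dots> = (LINT z|\<nu>. complex_of_real (r (w + \<sigma> *\<^sub>R z)))"
    by (simp add: r)
  also have "\<dots> = complex_of_real (LINT z|\<nu>. r (w + \<sigma> *\<^sub>R z))"
    by (rule integral_complex_of_real)
  finally have "(LINT x|\<Gamma>. \<phi> x ^ Suc n * cis (x \<bullet> w)) = complex_of_real (LINT z|\<nu>. r (w + \<sigma> *\<^sub>R z))" .
  moreover have "(LINT z|\<nu>. r (w + \<sigma> *\<^sub>R z)) \<ge> 0"
    by (rule Bochner_Integration.integral_nonneg) (simp add: r)
  ultimately show ?case unfolding \<phi>_def by blast
qed

text \<open>In the power series of the exponential every averaged power is real and nonnegative, and
  the term of order 0 contributes 1.\<close>

lemma gaussian_average_exp_ge: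
  fixes \<Gamma> \<nu> :: "'a::euclidean_space measure"
  assumes \<Gamma>: "prob_space \<Gamma>" "sets \<Gamma> = sets borel"
    and gauss: "\<And>y. (LINT x|\<Gamma>. cis (x \<bullet> y)) = complex_of_real (exp (- (norm y)\<^sup>2 / 2))"
    and \<nu>: "finite_measure \<nu>" "sets \<nu> = sets borel" and u: "u \<ge> 0"
  shows "Re (LINT x|\<Gamma>. exp (of_real u * (LINT z|\<nu>. cis ((\<sigma> *\<^sub>R x) \<bullet> z)))) \<ge> 1"
proof -
  interpret \<Gamma>: prob_space \<Gamma> by fact
  interpret \<nu>: finite_measure \<nu> by fact
  note [measurable_cong] = \<Gamma>(2) \<nu>(2)
  define \<phi> where "\<phi> x = (LINT z|\<nu>. cis ((\<sigma> *\<^sub>R x) \<bullet> z))" for x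
  have [measurable]: "\<phi> \<in> borel_measurable borel" unfolding \<phi>_def by measurable
  have \<phi>_le: "norm (\<phi> x) \<le> measure \<nu> UNIV" for x
    unfolding \<phi>_def by (rule norm_integral_cis_le[OF \<nu>])
  have int: "integrable \<Gamma> (\<lambda>x. \<phi> x ^ n)" for n
    by (rule \<Gamma>.integrable_const_bound[of _ "measure \<nu> UNIV ^ n"])
      (auto simp: norm_power intro!: power_mono \<phi>_le)
  define S where "S N x = (\<Sum>n<N. (of_real u * \<phi> x) ^ n /\<^sub>R fact n)" for N x
  have S_int: "integrable \<Gamma> (S N)" for N
    unfolding S_def power_mult_distrib using int by simp
  have lim: "(\<lambda>N. LINT x|\<Gamma>. S N x) \<longlonglongrightarrow> (LINT x|\<Gamma>. exp (of_real u * \<phi> x))"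
  proof (rule integral_dominated_convergence[where w="\<lambda>_. exp (u * measure \<nu> UNIV)"])
    show "AE x in \<Gamma>. (\<lambda>N. S N x) \<longlonglongrightarrow> exp (of_real u * \<phi> x)"
      using exp_converges[of "of_real u * \<phi> _"] unfolding S_def sums_def by auto
    have "norm (S N x) \<le> exp (u * measure \<nu> UNIV)" for N x
    proof -
      have "norm (S N x) \<le> (\<Sum>n<N. norm ((of_real u * \<phi> x) ^ n /\<^sub>R fact n))"
        unfolding S_def by (rule norm_sum)
      also have "\<dots> \<le> (\<Sum>n<N. (u * measure \<nu> UNIV) ^ n /\<^sub>R fact n)"
        using u \<phi>_le by (intro sum_mono) (auto simp: norm_mult norm_power intro!: power_mono mult_left_mono)
      also have "\<dots> \<le> (\<Sum>n. (u * measure \<nu> UNIV) ^ n /\<^sub>R fact n)"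
        using u by (intro sum_le_suminf summable_exp_generic) auto
      finally show ?thesis by (simp add: exp_def)
    qed
    then show "AE x in \<Gamma>. norm (S N x) \<le> exp (u * measure \<nu> UNIV)" for N by simp
  qed (use S_int in auto)
  moreover have "Re (LINT x|\<Gamma>. S N x) \<ge> 1" if "N \<ge> 1" for N
  proof -
    have "Re (LINT x|\<Gamma>. S N x) = (\<Sum>n<N. u ^ n / fact n * Re (LINT x|\<Gamma>. \<phi> x ^ n))"
    proof -
      have "(LINT x|\<Gamma>. S N x) = (\<Sum>n<N. LINT x|\<Gamma>. of_real (u ^ n / fact n) * \<phi> x ^ n)"
        unfolding S_def using int
        by (subst Bochner_Integration.integral_sum)
           (auto simp: power_mult_distrib scaleR_conv_of_real field_simps)
      also have "\<dots> = (\<Sum>n<N. of_real (u ^ n / fact n) * (LINT x|\<Gamma>. \<phi> x ^ n))"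
        by (simp only: integral_mult_right_zero)
      finally show ?thesis by (simp add: Re_sum del: of_real_power of_real_divide of_real_mult)
    qed
    also have "\<dots> \<ge> (\<Sum>n\<in>{0}. u ^ n / fact n * Re (LINT x|\<Gamma>. \<phi> x ^ n))"
    proof (rule sum_mono2)
      show "0 \<le> u ^ n / fact n * Re (LINT x|\<Gamma>. \<phi> x ^ n)" for n
        using gaussian_average_power_nonneg[OF \<Gamma> gauss \<nu>, of \<sigma> n 0] u
        by (auto simp: \<phi>_def)
    qed (use that in auto)
    finally show ?thesis by (simp add: \<Gamma>.prob_space)
  qed
  ultimately have "1 \<le> Re (LINT x|\<Gamma>. exp (of_real u * \<phi> x))"
    by (intro LIMSEQ_le_const[OF tendsto_Re[OF lim]]) auto
  then show ?thesis by (simp add: \<phi>_def)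
qed

text \<open>The process is known only through its exponent, so the probability of having no jump
  must be read off the characteristic function. With \<open>c\<close> the mass of \<nu>, the
  Gaussian average at scale \<sigma> is at least exp (- c * u) for every \<sigma>, and as \<sigma>
  grows the corresponding kernel tends to the indicator of 0.\<close>

lemma compound_poisson_at_zero:
  fixes Y :: "real \<Rightarrow> 'w \<Rightarrow> 'a::euclidean_space"
  assumes "compound_poisson_with M Y \<nu>" and u: "u \<ge> 0"
  shows "measure M {\<omega>\<in>space M. Y u \<omega> = 0} \<ge> exp (- (measure \<nu> UNIV * u))"
proof -
  have L: "levy_process M Y" and \<nu>: "finite_measure \<nu>" "sets \<nu> = sets borel"
    and ex: "has_levy_exponent M Y (\<lambda>x. - (LINT z|\<nu>. cis (x \<bullet> z) - 1))"
    using assms unfolding compound_poisson_with_def by auto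
  interpret prob_space M by (rule levy_processD[OF L])
  interpret \<nu>: finite_measure \<nu> by fact
  have [measurable]: "Y u \<in> borel_measurable M" using levy_processD(2)[OF L u] .
  obtain \<Gamma> :: "'a measure" where \<Gamma>: "prob_space \<Gamma>" "sets \<Gamma> = sets borel"
    and gauss: "\<And>y. (LINT x|\<Gamma>. cis (x \<bullet> y)) = complex_of_real (exp (- (norm y)\<^sup>2 / 2))"
    using gaussian_measure by blast
  interpret \<Gamma>: prob_space \<Gamma> by fact
  interpret P: pair_sigma_finite \<Gamma> M ..
  note [measurable_cong] = \<Gamma>(2) \<nu>(2)
  define c where "c = measure \<nu> UNIV"
  have char: "(LINT \<omega>|M. cis (x \<bullet> Y u \<omega>)) = of_real (exp (- c * u)) * exp (of_real u * (LINT z|\<nu>. cis (x \<bullet> z)))" for x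
  proof -
    have "integrable \<nu> (\<lambda>z. cis (x \<bullet> z))"
      by (rule \<nu>.integrable_const_bound[of _ 1]) auto
    then have eq: "(LINT z|\<nu>. cis (x \<bullet> z) - 1) = (LINT z|\<nu>. cis (x \<bullet> z)) - of_real c"
      using sets_eq_imp_space_eq[OF \<nu>(2)] by (subst Bochner_Integration.integral_diff) (auto simp: c_def scaleR_conv_of_real)
    have "(LINT \<omega>|M. cis (x \<bullet> Y u \<omega>)) = exp (- (of_real u * - (LINT z|\<nu>. cis (x \<bullet> z) - 1)))"
      using ex u unfolding has_levy_exponent_def by blast
    also have "\<dots> = exp (of_real (- c * u) + of_real u * (LINT z|\<nu>. cis (x \<bullet> z)))"
      unfolding eq by (simp add: algebra_simps)
    finally show ?thesis by (simp only: exp_add exp_of_real)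
  qed
  have ge: "exp (- c * u) \<le> (LINT \<omega>|M. exp (- (norm (\<sigma> *\<^sub>R Y u \<omega>))\<^sup>2 / 2))" for \<sigma>
  proof -
    have int: "integrable (\<Gamma> \<Otimes>\<^sub>M M) (\<lambda>(x, \<omega>). cis (x \<bullet> (\<sigma> *\<^sub>R Y u \<omega>)))"
    proof (rule finite_measure.integrable_const_bound[of _ _ 1])
      show "finite_measure (\<Gamma> \<Otimes>\<^sub>M M)"
        by (rule finite_measure_pair_measure) unfold_locales
    qed (auto simp: split_beta)
    have "complex_of_real (LINT \<omega>|M. exp (- (norm (\<sigma> *\<^sub>R Y u \<omega>))\<^sup>2 / 2))
        = (LINT \<omega>|M. (LINT x|\<Gamma>. cis (x \<bullet> (\<sigma> *\<^sub>R Y u \<omega>))))"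
      unfolding gauss by (rule integral_complex_of_real[symmetric])
    also have "\<dots> = (LINT x|\<Gamma>. (LINT \<omega>|M. cis (x \<bullet> (\<sigma> *\<^sub>R Y u \<omega>))))"
      using P.Fubini_integral[OF int] by simp
    also have "\<dots> = (LINT x|\<Gamma>. of_real (exp (- c * u)) * exp (of_real u * (LINT z|\<nu>. cis ((\<sigma> *\<^sub>R x) \<bullet> z))))"
      using char[of "\<sigma> *\<^sub>R _"] by (intro Bochner_Integration.integral_cong) auto
    also have "\<dots> = of_real (exp (- c * u)) * (LINT x|\<Gamma>. exp (of_real u * (LINT z|\<nu>. cis ((\<sigma> *\<^sub>R x) \<bullet> z))))"
      by (rule integral_mult_right_zero)
    finally have "(LINT \<omega>|M. exp (- (norm (\<sigma> *\<^sub>R Y u \<omega>))\<^sup>2 / 2))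
        = Re (of_real (exp (- c * u)) * (LINT x|\<Gamma>. exp (of_real u * (LINT z|\<nu>. cis ((\<sigma> *\<^sub>R x) \<bullet> z)))))"
      by (metis Re_complex_of_real)
    also have "\<dots> = exp (- c * u) * Re (LINT x|\<Gamma>. exp (of_real u * (LINT z|\<nu>. cis ((\<sigma> *\<^sub>R x) \<bullet> z))))"
      by (subst Re_complex_of_real[of "exp (- c * u)", symmetric]) simp
    also have "\<dots> \<ge> exp (- c * u) * 1"
      using gaussian_average_exp_ge[OF \<Gamma> gauss \<nu> u, of \<sigma>] by (intro mult_left_mono) auto
    finally show ?thesis by simp
  qed
  have lim: "(\<lambda>n. LINT \<omega>|M. exp (- (norm (real n *\<^sub>R Y u \<omega>))\<^sup>2 / 2))
      \<longlonglongrightarrow> (LINT \<omega>|M. indicator {\<omega>\<in>space M. Y u \<omega> = 0} \<omega>)"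
  proof (rule integral_dominated_convergence[where w="\<lambda>_. 1"])
    show "AE \<omega> in M. (\<lambda>n. exp (- (norm (real n *\<^sub>R Y u \<omega>))\<^sup>2 / 2)) \<longlonglongrightarrow> indicator {\<omega>\<in>space M. Y u \<omega> = 0} \<omega>"
    proof (rule AE_I2)
      fix \<omega> assume "\<omega> \<in> space M"
      show "(\<lambda>n. exp (- (norm (real n *\<^sub>R Y u \<omega>))\<^sup>2 / 2)) \<longlonglongrightarrow> indicator {\<omega>\<in>space M. Y u \<omega> = 0} \<omega>"
      proof (cases "Y u \<omega> = 0")
        case True
        then show ?thesis using \<open>\<omega> \<in> space M\<close> by simp
      next
        case False
        have "filterlim (\<lambda>n. real n * real n) at_top sequentially"
          by (rule filterlim_at_top_mult_at_top[OF filterlim_real_sequentially filterlim_real_sequentially])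
        then have "filterlim (\<lambda>n. (- (norm (Y u \<omega>))\<^sup>2 / 2) * (real n * real n)) at_bot sequentially"
          using False by (intro filterlim_tendsto_neg_mult_at_bot[OF tendsto_const]) auto
        then have "(\<lambda>n. exp ((- (norm (Y u \<omega>))\<^sup>2 / 2) * (real n * real n))) \<longlonglongrightarrow> 0"
          by (rule filterlim_compose[OF exp_at_bot])
        then show ?thesis using False by (simp add: power_mult_distrib power2_eq_square mult_ac)
      qed
    qed
  qed auto
  have "exp (- c * u) \<le> (LINT \<omega>|M. indicator {\<omega>\<in>space M. Y u \<omega> = 0} \<omega>)"
    by (rule LIMSEQ_le_const[OF lim]) (intro exI[of _ 0] allI impI ge)
  then show ?thesis by (simp add: c_def)
qed

lemma zero_or_compound_poisson_at_zero:
  fixes Y :: "real \<Rightarrow> 'w \<Rightarrow> 'a::euclidean_space"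
  assumes L: "levy_process M Y" and "zero_process M Y \<or> (\<exists>\<nu>. compound_poisson_with M Y \<nu>)"
  obtains c where "c \<ge> 0" "\<And>u. u \<ge> 0 \<Longrightarrow> measure M {\<omega>\<in>space M. Y u \<omega> = 0} \<ge> exp (- (c * u))"
proof (cases "zero_process M Y")
  case True
  interpret prob_space M by (rule levy_processD[OF L])
  have "measure M {\<omega>\<in>space M. Y u \<omega> = 0} = 1" if "u \<ge> 0" for u
  proof -
    have [measurable]: "Y u \<in> borel_measurable M" using levy_processD(2)[OF L that] .
    show ?thesis using True that unfolding zero_process_def by (subst prob_Collect_eq_1) auto
  qed
  then show ?thesis by (intro that[of 0]) auto
next
  case False
  then obtain \<nu> where "compound_poisson_with M Y \<nu>" using assms by blast
  from compound_poisson_at_zero[OF this] show ?thesis by (intro that[of "measure \<nu> UNIV"]) auto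
qed

subsection \<open>The sum of the two processes\<close>

text \<open>Two points of a line that both lie in a ball of radius \<open>r\<close> are less than 2
  * r apart. So, whatever \<delta> is, the ball only sees a segment of radius 2 * r around any one
  of them.\<close>

lemma segment_integral_restrict_ball:
  assumes [measurable]: "F \<in> borel_measurable borel" and e: "norm e = 1"
  shows "segment_integral e \<delta> (\<lambda>y. indicator (ball x r) y * F y) z \<le> (SUP z. segment_integral e (2 * r) F z)"
proof (cases "\<exists>a. z + a *\<^sub>R e \<in> ball x r")
  case True
  then obtain a where a: "z + a *\<^sub>R e \<in> ball x r" by blast
  have "segment_integral e \<delta> (\<lambda>y. indicator (ball x r) y * F y) z
      \<le> (\<integral>\<^sup>+s. F (z + s *\<^sub>R e) * indicator {-(2 * r)<..<2 * r} (s - a) \<partial>lborel)"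
    unfolding segment_integral_def
  proof (rule nn_integral_mono)
    fix s
    have "\<bar>s - a\<bar> < 2 * r" if "z + s *\<^sub>R e \<in> ball x r"
    proof -
      have "\<bar>s - a\<bar> = dist (z + s *\<^sub>R e) (z + a *\<^sub>R e)"
        using e by (simp add: dist_norm scaleR_left_diff_distrib[symmetric])
      also have "\<dots> \<le> dist x (z + s *\<^sub>R e) + dist x (z + a *\<^sub>R e)"
        by (metis dist_commute dist_triangle)
      finally show ?thesis using that a by simp
    qed
    then show "indicator (ball x r) (z + s *\<^sub>R e) * F (z + s *\<^sub>R e) * indicator {-\<delta><..<\<delta>} s
        \<le> F (z + s *\<^sub>R e) * indicator {-(2 * r)<..<2 * r} (s - a)"
      by (auto simp: indicator_def abs_less_iff)
  qed
  also have "\<dots> = (\<integral>\<^sup>+s. F (z + (a + s) *\<^sub>R e) * indicator {-(2 * r)<..<2 * r} s \<partial>lborel)"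
    by (subst nn_integral_real_affine[where c=1 and t=a]) auto
  also have "\<dots> = segment_integral e (2 * r) F (z + a *\<^sub>R e)"
    unfolding segment_integral_def by (simp add: algebra_simps)
  also have "\<dots> \<le> (SUP z. segment_integral e (2 * r) F z)" by (rule SUP_upper) simp
  finally show ?thesis .
next
  case False
  then have "segment_integral e \<delta> (\<lambda>y. indicator (ball x r) y * F y) z = (\<integral>\<^sup>+s. 0 \<partial>(lborel :: real measure))"
    unfolding segment_integral_def by (intro nn_integral_cong) (simp add: indicator_def)
  then show ?thesis by simp
qed

lemma segment_integral_ball:
  assumes "norm e = 1" "r \<le> \<delta>"
  shows "segment_integral e \<delta> (\<lambda>y. indicator (ball x r) y * F y) x = segment_integral e r F x"
  unfolding segment_integral_def using assms
  by (intro nn_integral_cong) (auto simp: indicator_def dist_norm)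

text \<open>Translates of \<open>(-r, r)\<close> centred at -r, 0 and r cover
  \<open>(-2 * r, 2 * r)\<close>; the middle one catches the point 0.\<close>

lemma segment_integral_double:
  assumes [measurable]: "F \<in> borel_measurable borel"
  shows "(SUP x. segment_integral e (2 * r) F x) \<le> 3 * (SUP x. segment_integral e r F x)"
proof (rule SUP_least)
  fix x
  have shift: "segment_integral e r F (x + a *\<^sub>R e) = (\<integral>\<^sup>+s. F (x + s *\<^sub>R e) * indicator {-r<..<r} (s - a) \<partial>lborel)" for a
    unfolding segment_integral_def
    by (subst (2) nn_integral_real_affine[where c=1 and t=a]) (auto simp: algebra_simps)
  have "segment_integral e (2 * r) F x \<le> (\<integral>\<^sup>+s. F (x + s *\<^sub>R e) * indicator {-r<..<r} (s - (-r))
      + F (x + s *\<^sub>R e) * indicator {-r<..<r} (s - 0) + F (x + s *\<^sub>R e) * indicator {-r<..<r} (s - r) \<partial>lborel)"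
    unfolding segment_integral_def by (intro nn_integral_mono) (auto simp: indicator_def)
  also have "\<dots> = segment_integral e r F (x + (-r) *\<^sub>R e) + segment_integral e r F (x + 0 *\<^sub>R e)
      + segment_integral e r F (x + r *\<^sub>R e)"
    unfolding shift by (subst nn_integral_add; (subst nn_integral_add)?) auto
  also have "\<dots> \<le> (SUP x. segment_integral e r F x) + (SUP x. segment_integral e r F x)
      + (SUP x. segment_integral e r F x)"
    by (intro add_mono SUP_upper) auto
  also have "\<dots> = 3 * (SUP x. segment_integral e r F x)"
  proof -
    have "(3 :: ennreal) = 1 + 1 + 1" by simp
    then show ?thesis by (simp only: distrib_right mult_1_left)
  qed
  finally show "segment_integral e (2 * r) F x \<le> 3 * (SUP x. segment_integral e r F x)" .
qed

text \<open>Repeated doubling, so that finiteness does not depend on the radius.\<close>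

lemma segment_integral_finite:
  assumes "F \<in> borel_measurable borel" "r > 0" and fin: "(SUP x. segment_integral e r F x) < \<infinity>"
  shows "(SUP x. segment_integral e r' F x) < \<infinity>"
proof -
  have *: "(SUP x. segment_integral e (2 ^ n * r) F x) < \<infinity>" for n
  proof (induction n)
    case (Suc n)
    have "(SUP x. segment_integral e (2 ^ Suc n * r) F x) \<le> 3 * (SUP x. segment_integral e (2 ^ n * r) F x)"
      using segment_integral_double[OF assms(1), of e "2 ^ n * r"] by (simp add: mult_ac)
    also have "\<dots> < \<infinity>" using Suc by (simp add: ennreal_mult_less_top)
    finally show ?case .
  qed (use fin in simp)
  obtain n where "r' / r < 2 ^ n" using real_arch_pow[of 2 "r' / r"] by auto
  then have "r' \<le> 2 ^ n * r" using \<open>r > 0\<close> by (simp add: field_simps)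
  then have "(SUP x. segment_integral e r' F x) \<le> (SUP x. segment_integral e (2 ^ n * r) F x)"
    by (intro SUP_mono) (auto intro: segment_integral_mono)
  then show ?thesis using * le_less_trans by blast
qed

text \<open>All that is kept of the structure of \<open>Y\<close> is the lower bound, with rate
  \<open>c\<close>, on its probability of being at 0. The limit in \<open>hit\<close> is over
  \<open>nhds 0\<close>, so it includes the value at 0.\<close>

locale regular_line_sum =
  fixes M :: "'w measure" and X Y Z :: "real \<Rightarrow> 'w \<Rightarrow> 'a::euclidean_space" and e :: 'a and lam c :: real
  assumes levy: "levy_process M X" "levy_process M Y" "levy_process M Z"
    and sum: "\<And>t \<omega>. t \<ge> 0 \<Longrightarrow> \<omega> \<in> space M \<Longrightarrow> X t \<omega> = Y t \<omega> + Z t \<omega>"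
    and indep: "indep_processes M Y Z"
    and c: "c \<ge> 0"
    and Y_zero: "\<And>u. u \<ge> 0 \<Longrightarrow> measure M {\<omega>\<in>space M. Y u \<omega> = 0} \<ge> exp (- (c * u))"
    and e: "norm e = 1"
    and line: "\<And>t. t \<ge> 0 \<Longrightarrow> AE \<omega> in M. Z t \<omega> \<in> range (\<lambda>s. s *\<^sub>R e)"
    and lam: "lam > 0"
    and hit: "((\<lambda>s. hit_laplace M Z lam (s *\<^sub>R e)) \<longlongrightarrow> 1) (nhds 0)"
begin

sublocale prob_space M by (rule levy_processD[OF levy(1)])

lemma process_measurable:
  assumes "t \<ge> 0"
  shows "X t \<in> borel_measurable M" "Y t \<in> borel_measurable M" "Z t \<in> borel_measurable M"
  using levy_processD(2)[OF levy(1) assms] levy_processD(2)[OF levy(2) assms] levy_processD(2)[OF levy(3) assms] .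

lemma transition_sum:
  assumes "u \<ge> 0" and [measurable]: "F \<in> borel_measurable borel"
  shows "transition M X u F x = (\<integral>\<^sup>+\<omega>. transition M Z u F (x + Y u \<omega>) \<partial>M)"
proof -
  have "indep_var borel ((\<lambda>f. f u) \<circ> (\<lambda>\<omega>. \<lambda>t\<in>{0..}. Y t \<omega>)) borel ((\<lambda>f. f u) \<circ> (\<lambda>\<omega>. \<lambda>t\<in>{0..}. Z t \<omega>))"
    using indep assms(1) unfolding indep_processes_def by (intro indep_var_compose) auto
  then have ind: "indep_var borel (Y u) borel (Z u)"
    using assms(1) by (simp add: comp_def)
  have "transition M X u F x = (\<integral>\<^sup>+\<omega>. F (x + (Y u \<omega> + Z u \<omega>)) \<partial>M)"
    unfolding transition_def using sum assms(1) by (intro nn_integral_cong) auto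
  also have "\<dots> = (\<integral>\<^sup>+\<omega>. transition M Z u F (x + Y u \<omega>) \<partial>M)"
    unfolding transition_def by (subst nn_integral_indep_sum[OF ind]) (auto simp: add_ac)
  finally show ?thesis .
qed

lemma average_at_zero_jump:
  assumes "u \<ge> 0"
  shows "ennreal (exp (- (c * u))) * G x \<le> (\<integral>\<^sup>+\<omega>. G (x + Y u \<omega>) \<partial>M)"
proof -
  note [measurable] = process_measurable[OF assms]
  have "ennreal (exp (- (c * u))) * G x \<le> G x * emeasure M {\<omega>\<in>space M. Y u \<omega> = 0}"
    unfolding emeasure_eq_measure using Y_zero[OF assms]
    by (subst mult.commute) (intro mult_left_mono ennreal_leI, auto)
  also have "\<dots> = (\<integral>\<^sup>+\<omega>. G x * indicator {\<omega>\<in>space M. Y u \<omega> = 0} \<omega> \<partial>M)"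
    by (rule nn_integral_cmult_indicator[symmetric]) measurable
  also have "\<dots> \<le> (\<integral>\<^sup>+\<omega>. G (x + Y u \<omega>) \<partial>M)"
    by (intro nn_integral_mono) (auto simp: indicator_def)
  finally show ?thesis .
qed

lemma transition_sum_ge:
  assumes "u \<ge> 0" "F \<in> borel_measurable borel"
  shows "ennreal (exp (- (c * u))) * transition M Z u F x \<le> transition M X u F x"
  unfolding transition_sum[OF assms] by (rule average_at_zero_jump[OF assms(1)])

text \<open>The probability of at least exp (- c * u) that \<open>Y\<close> is at 0 is absorbed into
  the discount, which is why the rate for \<open>Z\<close> rises to \<mu> + c.\<close>

lemma occupation_sum_ge:
  assumes "F \<in> borel_measurable borel"
  shows "occupation M Z (discount (\<mu> + c)) F x \<le> occupation M X (discount \<mu>) F x"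
  unfolding occupation_def
proof (rule nn_integral_mono)
  fix u :: real
  have "discount (\<mu> + c) u * transition M Z u F x \<le> discount \<mu> u * transition M X u F x" if "u \<ge> 0"
  proof -
    have "discount (\<mu> + c) u = discount \<mu> u * ennreal (exp (- (c * u)))"
      unfolding discount_def by (simp add: ennreal_mult[symmetric] exp_add[symmetric] algebra_simps)
    then show ?thesis
      using transition_sum_ge[OF that assms] by (simp add: mult.assoc mult_left_mono)
  qed
  then show "discount (\<mu> + c) u * transition M Z u F x * indicator {0..} u
      \<le> discount \<mu> u * transition M X u F x * indicator {0..} u"
    by (auto simp: indicator_def)
qed

text \<open>Since \<open>Y\<close> stands still between times \<open>u\<close> and \<open>1\<close> with probability at least
  \<open>exp (- c)\<close>, its law at time \<open>u\<close> is dominated by a multiple of its law at time \<open>1\<close>.\<close>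

lemma transition_dominated:
  assumes "0 \<le> u" "u \<le> 1" and [measurable]: "G \<in> borel_measurable borel"
  shows "transition M Y u G x \<le> ennreal (exp c) * transition M Y 1 G x"
proof -
  note [measurable] = process_measurable[OF assms(1)]
  have "ennreal (exp (- c)) * transition M Y u G x = (\<integral>\<^sup>+\<omega>. ennreal (exp (- c)) * G (x + Y u \<omega>) \<partial>M)"
    unfolding transition_def by (rule nn_integral_cmult[symmetric]) measurable
  also have "\<dots> \<le> (\<integral>\<^sup>+\<omega>. transition M Y (1 - u) G (x + Y u \<omega>) \<partial>M)"
  proof (rule nn_integral_mono)
    fix \<omega>
    have "c * (1 - u) \<le> c * 1" using c assms by (intro mult_left_mono) auto
    then have "ennreal (exp (- c)) * G (x + Y u \<omega>) \<le> ennreal (exp (- (c * (1 - u)))) * G (x + Y u \<omega>)"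
      by (intro mult_right_mono ennreal_leI) auto
    also have "\<dots> \<le> transition M Y (1 - u) G (x + Y u \<omega>)"
      unfolding transition_def using assms by (intro average_at_zero_jump) auto
    finally show "ennreal (exp (- c)) * G (x + Y u \<omega>) \<le> transition M Y (1 - u) G (x + Y u \<omega>)" .
  qed
  also have "\<dots> = transition M Y 1 G x"
    using transition_add[OF levy(2) assms(3), of u "1 - u" x] assms by simp
  finally have "ennreal (exp c) * (ennreal (exp (- c)) * transition M Y u G x) \<le> ennreal (exp c) * transition M Y 1 G x"
    by (rule mult_left_mono) simp
  moreover have "ennreal (exp c) * ennreal (exp (- c)) = 1"
    by (simp add: ennreal_mult[symmetric] exp_add[symmetric])
  ultimately show ?thesis by (simp add: mult.assoc[symmetric])
qed

text \<open>Replacing the law of \<open>Y u\<close> by that of \<open>Y 1\<close> frees the starting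
  point of \<open>Z\<close> from the time \<open>u\<close>, so Fubini turns the time integral into
  an occupation of \<open>Z\<close> from a single random point.\<close>

lemma occupation_sum_le:
  assumes [measurable]: "F \<in> borel_measurable borel" and "t \<le> 1"
  shows "occupation M X (indicator {..t}) F x \<le> ennreal (exp c) * (SUP y. occupation M Z (indicator {..t}) F y)"
proof -
  note [measurable] = process_measurable(2)[of 1, simplified]
  have sf: "sigma_finite_measure M" by unfold_locales
  have "occupation M X (indicator {..t}) F x
      \<le> (\<integral>\<^sup>+u\<in>{0..}. ennreal (exp c) * indicator {..t} u * (\<integral>\<^sup>+\<omega>. transition M Z u F (x + Y 1 \<omega>) \<partial>M) \<partial>lborel)"
    unfolding occupation_def
  proof (rule nn_integral_mono)
    fix u :: real
    have "transition M X u F x \<le> ennreal (exp c) * (\<integral>\<^sup>+\<omega>. transition M Z u F (x + Y 1 \<omega>) \<partial>M)"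
      if "0 \<le> u" "u \<le> 1"
      using transition_dominated[OF that transition_measurable'[OF levy(3) assms(1) that(1)], of x]
      unfolding transition_sum[OF that(1) assms(1)] unfolding transition_def[of M Y] .
    then show "indicator {..t} u * transition M X u F x * indicator {0..} u
        \<le> ennreal (exp c) * indicator {..t} u * (\<integral>\<^sup>+\<omega>. transition M Z u F (x + Y 1 \<omega>) \<partial>M) * indicator {0..} u"
      using \<open>t \<le> 1\<close> by (auto simp: indicator_def)
  qed
  also have "\<dots> = (\<integral>\<^sup>+\<omega>. occupation M Z (\<lambda>u. ennreal (exp c) * indicator {..t} u) F (x + Y 1 \<omega>) \<partial>M)"
    by (rule occupation_integral[OF levy(3) sf, symmetric]) measurable
  also have "\<dots> \<le> (\<integral>\<^sup>+\<omega>. ennreal (exp c) * (SUP y. occupation M Z (indicator {..t}) F y) \<partial>M)"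
  proof (rule nn_integral_mono)
    fix \<omega>
    have "(\<lambda>u. transition M Z (max u 0) F y) \<in> borel_measurable borel" for y
      using measurable_compose[OF measurable_Pair2' transition_measurable[OF levy(3) assms(1)], of y] by simp
    note [measurable] = this
    have "occupation M Z (\<lambda>u. ennreal (exp c) * indicator {..t} u) F y = ennreal (exp c) * occupation M Z (indicator {..t}) F y" for y
      unfolding occupation_max by (subst nn_integral_cmult[symmetric]) (auto simp: mult_ac)
    then show "occupation M Z (\<lambda>u. ennreal (exp c) * indicator {..t} u) F (x + Y 1 \<omega>)
        \<le> ennreal (exp c) * (SUP y. occupation M Z (indicator {..t}) F y)"
      by (auto intro!: mult_left_mono SUP_upper)
  qed
  also have "\<dots> = ennreal (exp c) * (SUP y. occupation M Z (indicator {..t}) F y)"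
    by (simp add: emeasure_space_1)
  finally show ?thesis .
qed

text \<open>Combines waiting for a nearby point with the change of rate. Values of \<kappa> close to
  1 serve the small-time estimate, the value 1/2 the comparisons with segments.\<close>

lemma shift_along_line:
  assumes \<mu>: "\<mu> > 0" and \<kappa>: "\<kappa> < 1"
  obtains \<delta> where "\<delta> > 0"
    and "\<And>F s x. F \<in> borel_measurable borel \<Longrightarrow> \<bar>s\<bar> < \<delta> \<Longrightarrow>
      ennreal \<kappa> * occupation M Z (discount \<mu>) F x \<le> occupation M Z (discount \<mu>) F (x + s *\<^sub>R e)"
proof -
  obtain n :: nat where n: "\<mu> / lam < real n" using reals_Archimedean2 by blast
  then have "\<mu> \<le> real n * lam" "n > 0" using lam \<mu> by (auto simp: field_simps intro!: Nat.gr0I)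
  define h where "h s = hit_laplace M Z lam (s *\<^sub>R e)" for s
  \<comment> \<open>The term with \<open>n\<close> makes Bernoulli's bound at least \<kappa>; the
    maximum with 0 secures the positivity that \<open>hit_laplace_bernoulli\<close>
    requires.\<close>
  have "max 0 (1 - (1 - \<kappa>) / real n) < 1" using \<kappa> \<open>n > 0\<close> by simp
  then have "\<forall>\<^sub>F s in nhds 0. h s > max 0 (1 - (1 - \<kappa>) / real n)"
    unfolding h_def by (rule order_tendstoD[OF hit])
  then obtain \<delta> where \<delta>: "\<delta> > 0" "\<And>s. \<bar>s\<bar> < \<delta> \<Longrightarrow> h s > max 0 (1 - (1 - \<kappa>) / real n)"
    unfolding eventually_nhds_metric by (auto simp: dist_norm)
  have "ennreal \<kappa> * occupation M Z (discount \<mu>) F x \<le> occupation M Z (discount \<mu>) F (x + s *\<^sub>R e)"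
    if F: "F \<in> borel_measurable borel" and s: "\<bar>s\<bar> < \<delta>" for F s x
  proof -
    \<comment> \<open>\<open>hit_laplace_occupation\<close> moves the start by minus the target
      point, hence the sign.\<close>
    have hs: "h (-s) > 0" "h (-s) > 1 - (1 - \<kappa>) / real n" using \<delta>(2)[of "-s"] s by auto
    have "real n * (1 - h (-s)) \<le> 1 - \<kappa>" using hs(2) \<open>n > 0\<close> by (simp add: field_simps)
    then have "\<kappa> \<le> 1 - real n * (1 - h (-s))" by simp
    also have "\<dots> \<le> hit_laplace M Z \<mu> ((-s) *\<^sub>R e)"
      unfolding h_def
      by (rule hit_laplace_bernoulli[OF prob_space_axioms lam \<mu> \<open>\<mu> \<le> real n * lam\<close>]) (use hs in \<open>simp add: h_def\<close>)
    finally have "ennreal \<kappa> * occupation M Z (discount \<mu>) F x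
        \<le> ennreal (hit_laplace M Z \<mu> ((-s) *\<^sub>R e)) * occupation M Z (discount \<mu>) F x"
      by (intro mult_right_mono ennreal_leI) auto
    also have "\<dots> \<le> occupation M Z (discount \<mu>) F (x - (-s) *\<^sub>R e)"
      by (rule hit_laplace_occupation[OF levy(3) \<mu> F])
    finally show ?thesis by simp
  qed
  with \<delta>(1) show ?thesis by (rule that)
qed

text \<open>The cap \<delta> \<le> 1 lets segments of radius \<delta> sit inside unit
  segments.\<close>

lemma shift_factor_two:
  assumes \<mu>: "\<mu> > 0"
  obtains \<delta> where "\<delta> > 0" "\<delta> \<le> 1"
    and "\<And>F s x. F \<in> borel_measurable borel \<Longrightarrow> \<bar>s\<bar> < \<delta> \<Longrightarrow>
      occupation M Z (discount \<mu>) F x \<le> 2 * occupation M Z (discount \<mu>) F (x + s *\<^sub>R e)"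
proof -
  obtain \<delta> where \<delta>: "\<delta> > 0" "\<And>F s x. F \<in> borel_measurable borel \<Longrightarrow> \<bar>s\<bar> < \<delta> \<Longrightarrow>
      ennreal (1/2) * occupation M Z (discount \<mu>) F x \<le> occupation M Z (discount \<mu>) F (x + s *\<^sub>R e)"
    using shift_along_line[OF \<mu>, of "1/2"] by auto
  have half: "2 * ennreal (1/2) = 1" using ennreal_mult'[of 2 "1/2"] by simp
  have "occupation M Z (discount \<mu>) F x \<le> 2 * occupation M Z (discount \<mu>) F (x + s *\<^sub>R e)"
    if "F \<in> borel_measurable borel" "\<bar>s\<bar> < min \<delta> 1" for F s x
    using mult_left_mono[OF \<delta>(2)[OF that(1), of s x], of 2] that(2) half by (simp add: mult.assoc[symmetric])
  then show ?thesis using \<delta>(1) by (intro that[of "min \<delta> 1"]) auto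
qed

lemma occupation_Z_upper:
  obtains C where "C > 0"
    and "\<And>F x. F \<in> borel_measurable borel \<Longrightarrow>
      occupation M Z (discount lam) F x \<le> ennreal C * (SUP z. segment_integral e 1 F z)"
proof -
  obtain \<delta> where \<delta>: "\<delta> > 0" "\<delta> \<le> 1" "\<And>F s x. F \<in> borel_measurable borel \<Longrightarrow> \<bar>s\<bar> < \<delta> \<Longrightarrow>
      occupation M Z (discount lam) F x \<le> 2 * occupation M Z (discount lam) F (x + s *\<^sub>R e)"
    using shift_factor_two[OF lam] by metis
  have "occupation M Z (discount lam) F x \<le> ennreal (1 / (lam * \<delta>)) * (SUP z. segment_integral e 1 F z)"
    if F: "F \<in> borel_measurable borel" for F x
  proof -
    have "occupation M Z (discount lam) F x \<le> ennreal (1 / (lam * \<delta>)) * (SUP z. segment_integral e \<delta> F z)"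
      by (rule occupation_le_segment[OF levy(3) lam F \<delta>(1)]) (rule \<delta>(3)[OF F])
    also have "\<dots> \<le> ennreal (1 / (lam * \<delta>)) * (SUP z. segment_integral e 1 F z)"
      using \<delta>(2) by (intro mult_left_mono SUP_mono) (auto intro: segment_integral_mono)
    finally show ?thesis .
  qed
  then show ?thesis using \<delta>(1) lam by (intro that[of "1 / (lam * \<delta>)"]) auto
qed

text \<open>The law of \<open>Y\<close> is dominated only up to time 1, so the potential of
  \<open>X\<close> is first bounded by unit blocks. On a block the occupation of \<open>Z\<close> is
  compared with its potential, undoing the discount at the cost of a factor exp lam.\<close>

lemma occupation_upper:
  obtains C where "\<And>F x. F \<in> borel_measurable borel \<Longrightarrow>
      occupation M X (discount lam) F x \<le> ennreal C * (SUP z. segment_integral e 1 F z)"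
proof -
  obtain C where C: "C > 0" "\<And>F x. F \<in> borel_measurable borel \<Longrightarrow>
      occupation M Z (discount lam) F x \<le> ennreal C * (SUP z. segment_integral e 1 F z)"
    using occupation_Z_upper by blast
  define A where "A = 1 / (1 - exp (- lam * 1))"
  have "A \<ge> 0" using lam by (simp add: A_def)
  have "occupation M X (discount lam) F x \<le> ennreal (A * (exp c * (exp lam * C))) * (SUP z. segment_integral e 1 F z)"
    if F: "F \<in> borel_measurable borel" for F x
  proof -
    define S where "S = (SUP z. segment_integral e 1 F z)"
    have Z: "occupation M Z (indicator {..1}) F y \<le> ennreal (exp lam) * (ennreal C * S)" for y
    proof -
      have "(\<lambda>u. transition M Z (max u 0) F y) \<in> borel_measurable borel"
        using measurable_compose[OF measurable_Pair2' transition_measurable[OF levy(3) F], of y] by simp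
      note [measurable] = this
      have "occupation M Z (indicator {..1}) F y \<le> ennreal (exp lam) * occupation M Z (discount lam) F y"
        unfolding occupation_max
      proof (subst nn_integral_cmult[symmetric])
        show "(\<integral>\<^sup>+u\<in>{0..}. indicator {..1} u * transition M Z (max u 0) F y \<partial>lborel)
          \<le> (\<integral>\<^sup>+u. ennreal (exp lam) * (discount lam u * transition M Z (max u 0) F y * indicator {0..} u) \<partial>lborel)"
        proof (rule nn_integral_mono)
          fix u :: real
          have "1 \<le> ennreal (exp lam) * discount lam u" if "u \<le> 1"
          proof -
            have "lam * u \<le> lam * 1" using that lam by (intro mult_left_mono) auto
            then show ?thesis unfolding discount_def
              by (simp add: ennreal_mult[symmetric] exp_add[symmetric])
          qed
          then show "indicator {..1} u * transition M Z (max u 0) F y * indicator {0..} u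
              \<le> ennreal (exp lam) * (discount lam u * transition M Z (max u 0) F y * indicator {0..} u)"
            using mult_right_mono[of 1 "ennreal (exp lam) * discount lam u" "transition M Z (max u 0) F y"]
            by (auto simp: indicator_def mult.assoc)
        qed
      qed measurable
      also have "\<dots> \<le> ennreal (exp lam) * (ennreal C * S)"
        unfolding S_def by (intro mult_left_mono C F) auto
      finally show ?thesis .
    qed
    have "occupation M X (discount lam) F x \<le> ennreal A * (SUP y. occupation M X (indicator {..1}) F y)"
      unfolding A_def by (rule occupation_le_block[OF levy(1) F lam]) simp
    also have "\<dots> \<le> ennreal A * (ennreal (exp c) * (ennreal (exp lam) * (ennreal C * S)))"
    proof (intro mult_left_mono SUP_least)
      fix y
      have "occupation M X (indicator {..1}) F y \<le> ennreal (exp c) * (SUP y. occupation M Z (indicator {..1}) F y)"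
        by (rule occupation_sum_le[OF F]) simp
      also have "\<dots> \<le> ennreal (exp c) * (ennreal (exp lam) * (ennreal C * S))"
        by (intro mult_left_mono SUP_least Z) auto
      finally show "occupation M X (indicator {..1}) F y \<le> ennreal (exp c) * (ennreal (exp lam) * (ennreal C * S))" .
    qed auto
    also have "\<dots> = ennreal (A * (exp c * (exp lam * C))) * S"
      using \<open>A \<ge> 0\<close> C(1) by (simp add: ennreal_mult mult_ac)
    finally show ?thesis by (simp add: S_def)
  qed
  then show ?thesis by (rule that)
qed

text \<open>Every rate \<mu> is allowed, since membership in \<open>kato_space\<close> provides just
  some rate; the potential of \<open>Z\<close> is then taken at rate \<mu> + c.\<close>

lemma occupation_lower:
  assumes \<mu>: "\<mu> > 0"
  obtains C \<delta> where "\<delta> > 0"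
    and "\<And>F x. F \<in> borel_measurable borel \<Longrightarrow>
      segment_integral e \<delta> F x \<le> ennreal C * occupation M X (discount \<mu>) F x"
proof -
  have \<mu>c: "\<mu> + c > 0" using \<mu> c by simp
  let ?O = "occupation M Z (discount (\<mu> + c))"
  obtain \<delta> where \<delta>: "\<delta> > 0" "\<And>F s x. F \<in> borel_measurable borel \<Longrightarrow> \<bar>s\<bar> < \<delta> \<Longrightarrow> ?O F x \<le> 2 * ?O F (x + s *\<^sub>R e)"
    using shift_factor_two[OF \<mu>c] by metis
  define B where "B = ?O (indicator (ball 0 (\<delta>/2))) 0"
  have "B \<le> ?O (\<lambda>_. 1) 0" unfolding B_def by (intro occupation_mono) (auto simp: indicator_def)
  also have "\<dots> < top" by (simp add: occupation_discount_finite[OF levy(3) \<mu>c])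
  finally obtain b where b: "B = ennreal b" "b \<ge> 0" by (cases B) auto
  have "B > 0" unfolding B_def using \<delta>(1) by (intro occupation_ball_pos[OF levy(3)]) simp
  then have "b > 0" using b by simp
  have "segment_integral e (\<delta>/2) F x \<le> ennreal (4 * \<delta> / b) * occupation M X (discount \<mu>) F x"
    if F: "F \<in> borel_measurable borel" for F x
  proof -
    have "B * segment_integral e (\<delta>/2) F x \<le> ennreal (4 * \<delta>) * ?O F x"
      unfolding B_def
    proof (rule segment_le_occupation[OF levy(3) \<mu>c F \<delta>(1) _ line e])
      fix s :: real and x assume "\<bar>s\<bar> < \<delta>"
      then show "?O F (x + s *\<^sub>R e) \<le> 2 * ?O F x" using \<delta>(2)[OF F, of "-s" "x + s *\<^sub>R e"] by simp
    qed
    also have "\<dots> \<le> ennreal (4 * \<delta>) * occupation M X (discount \<mu>) F x"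
      by (intro mult_left_mono occupation_sum_ge F) simp
    finally have "ennreal (1 / b) * (ennreal b * segment_integral e (\<delta>/2) F x)
        \<le> ennreal (1 / b) * (ennreal (4 * \<delta>) * occupation M X (discount \<mu>) F x)"
      unfolding b by (rule mult_left_mono) simp
    then show ?thesis
      using \<open>b > 0\<close> \<delta>(1) by (simp add: mult.assoc[symmetric] ennreal_mult[symmetric])
  qed
  then show ?thesis using \<delta>(1) by (intro that[of "\<delta>/2"]) auto
qed

text \<open>The radius stays 1 while the factor is arbitrary: this is what makes mere finiteness of
  the segment integrals sufficient for \<open>kato_time\<close>.\<close>

lemma occupation_small:
  assumes "\<epsilon> > 0"
  obtains t0 where "t0 > 0"
    and "\<And>F t x. F \<in> borel_measurable borel \<Longrightarrow> 0 < t \<Longrightarrow> t < t0 \<Longrightarrow>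
      occupation M X (indicator {..t}) F x \<le> ennreal \<epsilon> * (SUP z. segment_integral e 1 F z)"
proof -
  obtain C where C: "C > 0" "\<And>F x. F \<in> borel_measurable borel \<Longrightarrow>
      occupation M Z (discount lam) F x \<le> ennreal C * (SUP z. segment_integral e 1 F z)"
    using occupation_Z_upper by blast
  \<comment> \<open>The constants of the passage to \<open>X\<close>, of the small-time bound and of
    the segment bound multiply to this expression, which vanishes as \<kappa> tends to 1.\<close>
  have "((\<lambda>\<kappa>. exp c * (2 * (1 - \<kappa>^3) * C)) \<longlongrightarrow> exp c * (2 * (1 - 1^3) * C)) (at_left (1::real))"
    by (intro tendsto_intros)
  then have "\<forall>\<^sub>F \<kappa> in at_left 1. exp c * (2 * (1 - \<kappa>^3) * C) < \<epsilon>"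
    by (rule order_tendstoD) (use assms in simp)
  moreover have "\<forall>\<^sub>F \<kappa> in at_left 1. (0::real) < \<kappa> \<and> \<kappa> < 1"
    by (auto simp: eventually_at_left_field intro!: exI[of _ 0])
  ultimately have "\<forall>\<^sub>F \<kappa> in at_left 1. exp c * (2 * (1 - \<kappa>^3) * C) < \<epsilon> \<and> 0 < \<kappa> \<and> \<kappa> < 1"
    by (rule eventually_conj)
  then obtain \<kappa> where \<kappa>: "exp c * (2 * (1 - \<kappa>^3) * C) < \<epsilon>" "0 < \<kappa>" "\<kappa> < 1"
    using eventually_happens'[OF trivial_limit_at_left_real] by blast
  obtain \<delta> where \<delta>: "\<delta> > 0" "\<And>F s x. F \<in> borel_measurable borel \<Longrightarrow> \<bar>s\<bar> < \<delta> \<Longrightarrow>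
      ennreal \<kappa> * occupation M Z (discount lam) F x \<le> occupation M Z (discount lam) F (x + s *\<^sub>R e)"
    using shift_along_line[OF lam \<kappa>(3)] by metis
  obtain t0 where t0: "t0 > 0" "\<And>F t x. F \<in> borel_measurable borel \<Longrightarrow> 0 < t \<Longrightarrow> t < t0 \<Longrightarrow>
      (\<And>s x. \<bar>s\<bar> < \<delta> \<Longrightarrow> ennreal \<kappa> * occupation M Z (discount lam) F x \<le> occupation M Z (discount lam) F (x + s *\<^sub>R e)) \<Longrightarrow>
      occupation M Z (indicator {..t}) F x \<le> ennreal (2 * (1 - \<kappa>^3)) * occupation M Z (discount lam) F x"
    using occupation_small_time[OF levy(3) lam \<kappa>(2,3) \<delta>(1) line e] by metis
  have "occupation M X (indicator {..t}) F x \<le> ennreal \<epsilon> * (SUP z. segment_integral e 1 F z)"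
    if F: "F \<in> borel_measurable borel" and t: "0 < t" "t < min t0 1" for F t x
  proof -
    define S where "S = (SUP z. segment_integral e 1 F z)"
    have "occupation M X (indicator {..t}) F x \<le> ennreal (exp c) * (SUP y. occupation M Z (indicator {..t}) F y)"
      using t by (intro occupation_sum_le[OF F]) auto
    also have "\<dots> \<le> ennreal (exp c) * (ennreal (2 * (1 - \<kappa>^3)) * (ennreal C * S))"
    proof (intro mult_left_mono SUP_least)
      fix y
      have "occupation M Z (indicator {..t}) F y \<le> ennreal (2 * (1 - \<kappa>^3)) * occupation M Z (discount lam) F y"
        using t by (intro t0(2)[OF F]) (auto intro: \<delta>(2)[OF F])
      also have "\<dots> \<le> ennreal (2 * (1 - \<kappa>^3)) * (ennreal C * S)"
        unfolding S_def by (intro mult_left_mono C F) auto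
      finally show "occupation M Z (indicator {..t}) F y \<le> ennreal (2 * (1 - \<kappa>^3)) * (ennreal C * S)" .
    qed auto
    also have "\<dots> = ennreal (exp c * (2 * (1 - \<kappa>^3) * C)) * S"
      using \<kappa> C(1) by (simp add: ennreal_mult power_le_one mult_ac)
    also have "\<dots> \<le> ennreal \<epsilon> * S"
      using \<kappa>(1) by (intro mult_right_mono ennreal_leI) auto
    finally show ?thesis by (simp add: S_def)
  qed
  then show ?thesis using t0(1) by (intro that[of "min t0 1"]) auto
qed

end

subsection \<open>Kato classes\<close>

lemma restrict_ball_measurable:
  fixes F :: "'a::euclidean_space \<Rightarrow> ennreal"
  assumes "F \<in> borel_measurable borel"
  shows "(\<lambda>y. indicator (ball x r) y * F y) \<in> borel_measurable borel"
  by (intro borel_measurable_times_ennreal borel_measurable_indicator assms) auto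

context regular_line_sum
begin

lemma kato_time_iff:
  "q \<in> kato_time M X \<longleftrightarrow> q \<in> borel_measurable borel \<and>
     ((\<lambda>t. SUP x. occupation M X (indicator {..t}) (\<lambda>y. ennreal \<bar>q y\<bar>) x) \<longlongrightarrow> 0) (at_right 0)"
proof -
  have "(\<integral>\<^sup>+\<omega>. (\<integral>\<^sup>+u\<in>{0..t}. ennreal \<bar>q (x + X u \<omega>)\<bar> \<partial>lborel) \<partial>M)
      = occupation M X (indicator {..t}) (\<lambda>y. ennreal \<bar>q y\<bar>) x"
    if [measurable]: "q \<in> borel_measurable borel" for t x
    by (subst occupation_pathwise[OF levy(1), symmetric])
       (auto intro!: nn_integral_cong simp: indicator_def)
  then show ?thesis unfolding kato_time_def by auto
qed

lemma kato_space_iff: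
  "q \<in> kato_space M X \<longleftrightarrow> q \<in> borel_measurable borel \<and> (\<exists>\<mu>>0.
     ((\<lambda>r. SUP x. occupation M X (discount \<mu>) (\<lambda>y. indicator (ball x r) y * ennreal \<bar>q y\<bar>) x) \<longlongrightarrow> 0) (at_right 0))"
proof -
  have "(\<integral>\<^sup>+\<omega>. (\<integral>\<^sup>+u\<in>{0..}. ennreal (exp (- \<mu> * u)) * indicator (ball x r) (x + X u \<omega>) *
             ennreal \<bar>q (x + X u \<omega>)\<bar> \<partial>lborel) \<partial>M)
      = occupation M X (discount \<mu>) (\<lambda>y. indicator (ball x r) y * ennreal \<bar>q y\<bar>) x"
    if [measurable]: "q \<in> borel_measurable borel" for \<mu> r x
    by (subst occupation_pathwise[OF levy(1) restrict_ball_measurable, symmetric])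
       (auto simp: discount_def mult.assoc)
  then show ?thesis unfolding kato_space_def by auto
qed

text \<open>A ball of radius \<open>r\<close> cuts a segment of radius exactly \<open>r\<close> from
  the line through its centre, and from any parallel line a piece lying within distance 2 * r of
  each of its points. The constants do not depend on \<open>r\<close>, so the limits in
  \<open>r\<close> transfer both ways.\<close>

lemma kato_space_iff_segment:
  "q \<in> kato_space M X \<longleftrightarrow> q \<in> borel_measurable borel \<and>
     ((\<lambda>r. SUP x. segment_integral e r (\<lambda>y. ennreal \<bar>q y\<bar>) x) \<longlongrightarrow> 0) (at_right 0)"
proof (cases "q \<in> borel_measurable borel")
  case q[measurable]: True
  define F where "F y = ennreal \<bar>q y\<bar>" for y
  have F[measurable]: "F \<in> borel_measurable borel" unfolding F_def by measurable
  define S where "S r = (SUP x. segment_integral e r F x)" for r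
  define K where "K \<mu> r = (SUP x. occupation M X (discount \<mu>) (\<lambda>y. indicator (ball x r) y * F y) x)" for \<mu> r
  have "(\<exists>\<mu>>0. (K \<mu> \<longlongrightarrow> 0) (at_right 0)) \<longleftrightarrow> (S \<longlongrightarrow> 0) (at_right 0)"
  proof
    assume "\<exists>\<mu>>0. (K \<mu> \<longlongrightarrow> 0) (at_right 0)"
    then obtain \<mu> where \<mu>: "\<mu> > 0" "(K \<mu> \<longlongrightarrow> 0) (at_right 0)" by blast
    obtain C \<delta> where \<delta>: "\<delta> > 0" and C: "\<And>F x. F \<in> borel_measurable borel \<Longrightarrow>
        segment_integral e \<delta> F x \<le> ennreal C * occupation M X (discount \<mu>) F x"
      using occupation_lower[OF \<mu>(1)] by metis
    have "S r \<le> ennreal C * K \<mu> r" if "r < \<delta>" for r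
      unfolding S_def
    proof (rule SUP_least)
      fix x
      have "segment_integral e r F x = segment_integral e \<delta> (\<lambda>y. indicator (ball x r) y * F y) x"
        using that e by (intro segment_integral_ball[symmetric]) auto
      also have "\<dots> \<le> ennreal C * occupation M X (discount \<mu>) (\<lambda>y. indicator (ball x r) y * F y) x"
        by (rule C[OF restrict_ball_measurable[OF F]])
      also have "\<dots> \<le> ennreal C * K \<mu> r"
        unfolding K_def by (intro mult_left_mono SUP_upper) auto
      finally show "segment_integral e r F x \<le> ennreal C * K \<mu> r" .
    qed
    then have "\<forall>\<^sub>F r in at_right 0. S r \<le> ennreal C * K \<mu> r"
      using \<delta> by (auto simp: eventually_at_right_field)
    moreover have "((\<lambda>r. ennreal C * K \<mu> r) \<longlongrightarrow> ennreal C * 0) (at_right 0)"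
      by (intro ennreal_tendsto_cmult \<mu>(2)) simp
    ultimately show "(S \<longlongrightarrow> 0) (at_right 0)"
      by (intro tendsto_sandwich[of "\<lambda>_. 0" S _ "\<lambda>r. ennreal C * K \<mu> r"]) auto
  next
    assume S: "(S \<longlongrightarrow> 0) (at_right 0)"
    obtain C where C: "\<And>F x. F \<in> borel_measurable borel \<Longrightarrow>
        occupation M X (discount lam) F x \<le> ennreal C * (SUP z. segment_integral e 1 F z)"
      using occupation_upper by blast
    have "K lam r \<le> ennreal C * S (2 * r)" for r
      unfolding K_def
    proof (rule SUP_least)
      fix x
      have "occupation M X (discount lam) (\<lambda>y. indicator (ball x r) y * F y) x
          \<le> ennreal C * (SUP z. segment_integral e 1 (\<lambda>y. indicator (ball x r) y * F y) z)"
        by (rule C[OF restrict_ball_measurable[OF F]])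
      also have "\<dots> \<le> ennreal C * S (2 * r)"
        unfolding S_def by (intro mult_left_mono SUP_least segment_integral_restrict_ball F e) auto
      finally show "occupation M X (discount lam) (\<lambda>y. indicator (ball x r) y * F y) x \<le> ennreal C * S (2 * r)" .
    qed
    moreover have "((\<lambda>r. ennreal C * S (2 * r)) \<longlongrightarrow> ennreal C * 0) (at_right 0)"
    proof (intro ennreal_tendsto_cmult filterlim_compose[OF S])
      have "((\<lambda>r::real. 2 * r) \<longlongrightarrow> 2 * 0) (at_right 0)" by (intro tendsto_intros)
      then show "filterlim (\<lambda>r::real. 2 * r) (at_right 0) (at_right 0)"
        by (auto simp: filterlim_at eventually_at_right_field intro!: exI[of _ 1])
    qed simp
    ultimately have "(K lam \<longlongrightarrow> 0) (at_right 0)"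
      by (intro tendsto_sandwich[of "\<lambda>_. 0" "K lam" _ "\<lambda>r. ennreal C * S (2 * r)"]) auto
    then show "\<exists>\<mu>>0. (K \<mu> \<longlongrightarrow> 0) (at_right 0)" using lam by blast
  qed
  then show ?thesis using q unfolding kato_space_iff K_def S_def F_def by simp
qed (simp add: kato_space_iff)

text \<open>One time \<open>t\<close> with occupation below 1 bounds the whole potential through
  blocks, hence the integrals over short segments, and doubling reaches radius 1. Conversely,
  \<open>occupation_small\<close> makes the occupation as small as desired.\<close>

lemma kato_time_iff_segment:
  "q \<in> kato_time M X \<longleftrightarrow> q \<in> borel_measurable borel \<and>
     (SUP x. segment_integral e 1 (\<lambda>y. ennreal \<bar>q y\<bar>) x) < \<infinity>"
proof (cases "q \<in> borel_measurable borel")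
  case q[measurable]: True
  define F where "F y = ennreal \<bar>q y\<bar>" for y
  have F[measurable]: "F \<in> borel_measurable borel" unfolding F_def by measurable
  define S where "S = (SUP x. segment_integral e 1 F x)"
  define K where "K t = (SUP x. occupation M X (indicator {..t}) F x)" for t
  have "(K \<longlongrightarrow> 0) (at_right 0) \<longleftrightarrow> S < \<infinity>"
  proof
    assume "(K \<longlongrightarrow> 0) (at_right 0)"
    then have "\<forall>\<^sub>F t in at_right 0. K t < 1" by (rule order_tendstoD) simp
    then obtain b where b: "b > 0" "\<And>t. 0 < t \<Longrightarrow> t < b \<Longrightarrow> K t < 1"
      unfolding eventually_at_right_field by auto
    define t where "t = b / 2"
    have t: "t > 0" "K t < 1" using b by (auto simp: t_def)
    obtain C \<delta> where \<delta>: "\<delta> > 0" and C: "\<And>F x. F \<in> borel_measurable borel \<Longrightarrow>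
        segment_integral e \<delta> F x \<le> ennreal C * occupation M X (discount 1) F x"
      using occupation_lower[of 1] by (metis zero_less_one)
    define A where "A = 1 / (1 - exp (- 1 * t))"
    have "(SUP x. segment_integral e \<delta> F x) \<le> ennreal C * (ennreal A * 1)"
    proof (rule SUP_least)
      fix x
      have "segment_integral e \<delta> F x \<le> ennreal C * occupation M X (discount 1) F x" by (rule C[OF F])
      also have "\<dots> \<le> ennreal C * (ennreal A * K t)"
        unfolding A_def K_def by (intro mult_left_mono occupation_le_block[OF levy(1) F _ t(1)]) auto
      also have "\<dots> \<le> ennreal C * (ennreal A * 1)"
        using t(2) by (intro mult_left_mono) auto
      finally show "segment_integral e \<delta> F x \<le> ennreal C * (ennreal A * 1)" .
    qed
    also have "\<dots> < \<infinity>" by (simp add: ennreal_mult_less_top)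
    finally show "S < \<infinity>"
      unfolding S_def by (rule segment_integral_finite[OF F \<delta>])
  next
    assume "S < \<infinity>"
    then obtain s where s: "S = ennreal s" "s \<ge> 0" by (cases S) auto
    show "(K \<longlongrightarrow> 0) (at_right 0)"
    proof (rule order_tendstoI)
      fix a :: ennreal assume "a > 0"
      obtain a' where a': "a' > 0" "ennreal a' < a"
      proof -
        obtain z where z: "0 < z" "z < a" using dense[OF \<open>a > 0\<close>] by blast
        then obtain a' where "z = ennreal a'" "a' \<ge> 0" by (cases z) auto
        then show ?thesis using z by (intro that[of a']) auto
      qed
      \<comment> \<open>The denominator is \<open>s + 1\<close> because \<open>s\<close> may be
        0.\<close>
      have "a' / (s + 1) > 0" using a' s by simp
      then obtain t0 where t0: "t0 > 0" "\<And>F t x. F \<in> borel_measurable borel \<Longrightarrow> 0 < t \<Longrightarrow> t < t0 \<Longrightarrow>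
          occupation M X (indicator {..t}) F x \<le> ennreal (a' / (s + 1)) * (SUP z. segment_integral e 1 F z)"
        using occupation_small by metis
      have "K t < a" if "0 < t" "t < t0" for t
      proof -
        have "K t \<le> ennreal (a' / (s + 1)) * S"
          unfolding K_def S_def by (intro SUP_least t0(2) F that)
        also have "\<dots> = ennreal (a' / (s + 1) * s)"
          unfolding s(1) using a' s(2) by (subst ennreal_mult[symmetric]) auto
        also have "\<dots> \<le> ennreal a'"
          using a' s by (intro ennreal_leI) (simp add: field_simps)
        finally show ?thesis using a' by simp
      qed
      then show "\<forall>\<^sub>F t in at_right 0. K t < a"
        using t0(1) by (auto simp: eventually_at_right_field)
    qed simp
  qed
  then show ?thesis using q unfolding kato_time_iff K_def S_def F_def by simp
qed (simp add: kato_time_iff)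

text \<open>A single radius with finite supremum is enough, by doubling.\<close>

lemma kato_space_subset_kato_time: "kato_space M X \<subseteq> kato_time M X"
proof
  fix q assume "q \<in> kato_space M X"
  then have q[measurable]: "q \<in> borel_measurable borel"
    and lim: "((\<lambda>r. SUP x. segment_integral e r (\<lambda>y. ennreal \<bar>q y\<bar>) x) \<longlongrightarrow> 0) (at_right 0)"
    by (auto simp: kato_space_iff_segment)
  have "\<forall>\<^sub>F r in at_right 0. (SUP x. segment_integral e r (\<lambda>y. ennreal \<bar>q y\<bar>) x) < 1"
    by (rule order_tendstoD[OF lim]) simp
  moreover have "\<forall>\<^sub>F r in at_right (0::real). r > 0" by (rule eventually_at_right_less)
  ultimately have "\<forall>\<^sub>F r in at_right 0. (SUP x. segment_integral e r (\<lambda>y. ennreal \<bar>q y\<bar>) x) < 1 \<and> r > 0"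
    by (rule eventually_conj)
  then obtain r where r: "(SUP x. segment_integral e r (\<lambda>y. ennreal \<bar>q y\<bar>) x) < 1" "r > 0"
    using eventually_happens'[OF trivial_limit_at_right_real] by blast
  have "(SUP x. segment_integral e 1 (\<lambda>y. ennreal \<bar>q y\<bar>) x) < \<infinity>"
    by (rule segment_integral_finite[OF _ r(2)]) (use r(1) in \<open>auto intro: less_trans\<close>)
  then show "q \<in> kato_time M X" using q by (simp add: kato_time_iff_segment)
qed

text \<open>On each line parallel to \<open>e\<close> at height \<open>y = x \<bullet> f > 0\<close>
  the witness equals 1 / y on a segment of length 2 * y and 0 elsewhere: its mass is always 2, but
  it sits on ever shorter segments as \<open>y\<close> tends to 0.\<close>

lemma kato_space_noteq_kato_time:
  assumes f: "f \<noteq> 0" "e \<bullet> f = 0"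
  shows "kato_space M X \<noteq> kato_time M X"
proof -
  define q where "q x = (if \<bar>x \<bullet> e\<bar> < x \<bullet> f then 1 / (x \<bullet> f) else 0)" for x
  have q[measurable]: "q \<in> borel_measurable borel" unfolding q_def by measurable
  have q_line: "q (x + s *\<^sub>R e) = (if \<bar>x \<bullet> e + s\<bar> < x \<bullet> f then 1 / (x \<bullet> f) else 0)" for x s
    using e f(2) by (simp add: q_def inner_add_left dot_square_norm)
  have two: "ennreal (1 / y) * ennreal (2 * y) = 2" if "y > 0" for y
    using that by (simp add: ennreal_mult[symmetric] del: ennreal_numeral) simp
  have "segment_integral e 1 (\<lambda>y. ennreal \<bar>q y\<bar>) x \<le> 2" for x
  proof (cases "x \<bullet> f > 0")
    case True
    have "segment_integral e 1 (\<lambda>y. ennreal \<bar>q y\<bar>) x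
        \<le> (\<integral>\<^sup>+s. ennreal (1 / (x \<bullet> f)) * indicator {- (x \<bullet> e) - x \<bullet> f <..< - (x \<bullet> e) + x \<bullet> f} s \<partial>lborel)"
      unfolding segment_integral_def q_line using True
      by (intro nn_integral_mono) (auto simp: indicator_def)
    also have "\<dots> = ennreal (1 / (x \<bullet> f)) * ennreal (2 * (x \<bullet> f))"
      using True by (subst nn_integral_cmult_indicator) auto
    finally show ?thesis by (simp only: two[OF True])
  next
    case False
    then have "\<not> \<bar>x \<bullet> e + s\<bar> < x \<bullet> f" for s by linarith
    then show ?thesis unfolding segment_integral_def q_line by simp
  qed
  then have "(SUP x. segment_integral e 1 (\<lambda>y. ennreal \<bar>q y\<bar>) x) \<le> 2" by (rule SUP_least)
  also have "\<dots> < \<infinity>" by simp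
  finally have "q \<in> kato_time M X" using q by (simp add: kato_time_iff_segment)
  moreover have "q \<notin> kato_space M X"
  proof
    assume "q \<in> kato_space M X"
    then have lim: "((\<lambda>r. SUP x. segment_integral e r (\<lambda>y. ennreal \<bar>q y\<bar>) x) \<longlongrightarrow> 0) (at_right 0)"
      by (simp add: kato_space_iff_segment)
    have "\<forall>\<^sub>F r in at_right 0. (SUP x. segment_integral e r (\<lambda>y. ennreal \<bar>q y\<bar>) x) < 2"
      by (rule order_tendstoD[OF lim]) simp
    then obtain b where b: "b > 0" "\<And>r. 0 < r \<Longrightarrow> r < b \<Longrightarrow> (SUP x. segment_integral e r (\<lambda>y. ennreal \<bar>q y\<bar>) x) < 2"
      unfolding eventually_at_right_field by auto
    define r where "r = b / 2"
    have r: "r > 0" "r < b" using b(1) by (auto simp: r_def)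
    \<comment> \<open>The centre of such a segment at height \<open>r\<close>; \<open>f\<close> need
      not be a unit vector.\<close>
    define x where "x = (r / (f \<bullet> f)) *\<^sub>R f"
    have x: "x \<bullet> f = r" "x \<bullet> e = 0" using f by (auto simp: x_def inner_commute)
    have "2 = ennreal (1 / r) * ennreal (2 * r)" by (simp only: two[OF r(1)])
    also have "\<dots> = (\<integral>\<^sup>+s. ennreal (1 / r) * indicator {- r <..< r} s \<partial>lborel)"
      using r by (subst nn_integral_cmult_indicator) auto
    also have "\<dots> = segment_integral e r (\<lambda>y. ennreal \<bar>q y\<bar>) x"
      unfolding segment_integral_def q_line x using r
      by (intro nn_integral_cong) (auto simp: indicator_def)
    also have "\<dots> \<le> (SUP x. segment_integral e r (\<lambda>y. ennreal \<bar>q y\<bar>) x)" by (rule SUP_upper) simp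
    finally show False using b(2)[OF r] by simp
  qed
  ultimately show ?thesis by blast
qed

end

section \<open>From segments to the subspace \<open>V\<close>\<close>

lemma line_lebesgue_segment:
  fixes F :: "'a::euclidean_space \<Rightarrow> ennreal"
  assumes V: "subspace V" "dim V = 1" and e: "e \<in> V" "norm e = 1" and [measurable]: "F \<in> borel_measurable borel"
  shows "(\<integral>\<^sup>+v\<in>ball 0 r \<inter> V. F (x + v) \<partial>line_lebesgue V) = segment_integral e r F x"
proof -
  have [measurable]: "V \<in> sets borel" by (intro borel_closed closed_subspace V)
  have [measurable]: "ball (0::'a) r \<in> sets borel" by simp
  have "(\<integral>\<^sup>+v\<in>ball 0 r \<inter> V. F (x + v) \<partial>line_lebesgue V)
      = (\<integral>\<^sup>+s. F (x + s *\<^sub>R e) * indicator (ball 0 r \<inter> V) (s *\<^sub>R e) \<partial>lborel)"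
    unfolding line_lebesgue_eq[OF V e] by (rule nn_integral_distr) measurable
  also have "\<dots> = segment_integral e r F x"
    unfolding segment_integral_def using V(1) e
    by (intro nn_integral_cong) (auto simp: indicator_def subspace_scale)
  finally show ?thesis .
qed

theorem theorem4p12:
  fixes M :: "'w measure"
    and X Y Z :: "real \<Rightarrow> 'w \<Rightarrow> 'a::euclidean_space"
    and V :: "'a set"
    and lam :: real
  assumes "DIM('a) > 1"
    and "subspace V" and "dim V = 1"
    and "levy_process M X" and "levy_process M Y" and "levy_process M Z"
    and "\<forall>t\<ge>0. \<forall>\<omega>\<in>space M. X t \<omega> = Y t \<omega> + Z t \<omega>"
    and "indep_processes M Y Z"
    and "zero_process M Y \<or> (\<exists>\<nu>. compound_poisson_with M Y \<nu> \<and> emeasure \<nu> V = 0)"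
    and "supported_on M Z V"
    and "\<not> compound_poisson M Z"
    and "lam > 0"
    and "hit_laplace M Z lam 0 = 1"
    and "(hit_laplace M Z lam \<longlongrightarrow> 1) (at 0 within V)"
  shows "kato_space M X \<subset> kato_time M X
    \<and> kato_space M X =
        {q \<in> borel_measurable borel.
           ((\<lambda>r. SUP x. \<integral>\<^sup>+v\<in>ball 0 r \<inter> V. ennreal \<bar>q (x + v)\<bar> \<partial>line_lebesgue V)
              \<longlongrightarrow> 0) (at_right 0)}
    \<and> kato_time M X =
        {q \<in> borel_measurable borel.
           (SUP x. \<integral>\<^sup>+v\<in>ball 0 1 \<inter> V. ennreal \<bar>q (x + v)\<bar> \<partial>line_lebesgue V) < \<infinity>}"
proof -
  have "\<not> V \<subseteq> {0}" using \<open>dim V = 1\<close> by (auto simp: dim_eq_0[symmetric])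
  then obtain v where v: "v \<in> V" "v \<noteq> 0" by blast
  define e where "e = v /\<^sub>R norm v"
  have eV: "e \<in> V" "norm e = 1" using v \<open>subspace V\<close> by (auto simp: e_def subspace_scale)
  have "independent {e}" using eV by auto
  then have V_eq: "V \<subseteq> range (\<lambda>s. s *\<^sub>R e)"
    using card_ge_dim_independent[of "{e}" V] eV \<open>dim V = 1\<close> by (auto simp: span_singleton)
  obtain c where c: "c \<ge> 0" "\<And>u. u \<ge> 0 \<Longrightarrow> measure M {\<omega>\<in>space M. Y u \<omega> = 0} \<ge> exp (- (c * u))"
    using zero_or_compound_poisson_at_zero[OF \<open>levy_process M Y\<close>] assms(9) by blast
  \<comment> \<open>The limit within \<open>V\<close> is punctured, and \<open>s *\<^sub>R e\<close>
    is nonzero for nonzero \<open>s\<close>; the value at 0 is added next.\<close>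
  have "((\<lambda>s. hit_laplace M Z lam (s *\<^sub>R e)) \<longlongrightarrow> 1) (at 0)"
  proof (rule filterlim_compose[OF assms(14)])
    have "((\<lambda>s. s *\<^sub>R e) \<longlongrightarrow> 0 *\<^sub>R e) (at 0)" by (intro tendsto_intros)
    then show "filterlim (\<lambda>s. s *\<^sub>R e) (at 0 within V) (at 0)"
      using eV \<open>subspace V\<close> by (auto simp: filterlim_at subspace_scale eventually_at intro!: exI[of _ 1])
  qed
  then have hit: "((\<lambda>s. hit_laplace M Z lam (s *\<^sub>R e)) \<longlongrightarrow> 1) (nhds 0)"
    using assms(13) by (simp add: tendsto_nhds_iff)
  interpret regular_line_sum M X Y Z e lam c
  proof
    show "AE \<omega> in M. Z t \<omega> \<in> range (\<lambda>s. s *\<^sub>R e)" if "t \<ge> 0" for t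
      using \<open>supported_on M Z V\<close> that V_eq unfolding supported_on_def by (auto elim!: eventually_mono)
  qed (use assms c eV hit in auto)
  \<comment> \<open>A direction orthogonal to \<open>V\<close> exists because the dimension exceeds
    1; the witness of strict inclusion varies along it.\<close>
  obtain f where f: "f \<noteq> 0" "\<And>y. y \<in> span V \<Longrightarrow> orthogonal f y"
    using orthogonal_to_subspace_exists[of V] \<open>DIM('a) > 1\<close> \<open>dim V = 1\<close> by metis
  have "e \<bullet> f = 0" using f(2)[OF span_base[OF eV(1)]] by (simp add: orthogonal_def inner_commute)
  then have "kato_space M X \<subset> kato_time M X"
    using kato_space_subset_kato_time kato_space_noteq_kato_time f(1) by blast
  moreover have "(\<integral>\<^sup>+v\<in>ball 0 r \<inter> V. ennreal \<bar>q (x + v)\<bar> \<partial>line_lebesgue V) = segment_integral e r (\<lambda>y. ennreal \<bar>q y\<bar>) x"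
    if [measurable]: "q \<in> borel_measurable borel" for q r x
    using line_lebesgue_segment[OF \<open>subspace V\<close> \<open>dim V = 1\<close> eV, where F="\<lambda>y. ennreal \<bar>q y\<bar>"] by simp
  ultimately show ?thesis
    by (auto simp: kato_space_iff_segment kato_time_iff_segment)
qed

end
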